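(* Let $n\ge1$. The following formulas define the antipode $S_{\mathcal K}$ of $\mathcal K_n$: $$S_{\mathcal K}(u)=S_{\mathcal F_{\mathcal K}}(u_{\langle1\rangle})\,S_{\mathcal U}(u_{\langle0\rangle})\ \ (u\in\mathcal U(V)),\qquad S_{\mathcal K}(f)=S_{\mathcal F_{\mathcal K}}(f)\ \ (f\in\mathcal F_{\mathcal K}).$$ Hence $\mathcal K_n$ is a Hopf algebra, and the map $\mathcal I:\mathcal F_{\mathcal K}\bowtie\mathcal U(V)\to\mathcal K_n^{\rm cop}$, $\mathcal I(f\bowtie u)=fu$, is an isomorphism of Hopf algebras.
   Context: Repeated indices are summed; $H^{\rm cop}$ is $H$ with opposite coproduct. $\mathbf G$ is the discrete group of orientation preserving diffeomorphisms of $\mathbb R^n$; $\mathcal A=C_c^\infty(\mathbb R^n)\rtimes\mathbf G$ consists of finite sums $\sum f_iU^*_{\varphi_i}$ with $fU^*_\varphi\,gU^*_\psi=f(g\circ\varphi)U^*_{\psi\varphi}$. Operators on $\mathcal A$: $X_k(fU^*_\varphi)=\partial_k(f)U^*_\varphi$, $\sigma^i_{j_1,\ldots,j_r}(fU^*_\varphi)=\partial_{j_r}\cdots\partial_{j_1}(\varphi^i)fU^*_\varphi$, $\sigma^{\pm1}(fU^*_\varphi)=\det(\varphi')^{\pm1}fU^*_\varphi$. $\mathcal K_n$ is the unital algebra of operators generated by $X_k,\sigma^i_j,\sigma^{-1}$; it contains all $\sigma^i_{j_1,\ldots,j_r}$ since $[X_\ell,\sigma^i_{j_1,\ldots,j_r}]=\sigma^i_{j_1,\ldots,j_r,\ell}$.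 It is a bialgebra with coproduct determined by $k(ab)=k_{(1)}(a)k_{(2)}(b)$ ($a,b\in\mathcal A$) and counit by $k(1)=\varepsilon(k)1$; e.g. $\Delta(X_\ell)=X_\ell\otimes1+\sigma^k_\ell\otimes X_k$, $\Delta(\sigma^i_j)=\sigma^k_j\otimes\sigma^i_k$. $\mathcal K_{\rm ab}$ is the commutative subalgebra generated by all $\sigma^i_{j_1,\ldots,j_r}$ and $\sigma^{-1}$, which is a Hopf algebra (with antipode $S(f)(gU^*_\psi)=(\gamma(f)(\psi^{-1})\circ\psi)\,gU^*_\psi$, where $f(gU^*_\psi)=\gamma(f)(\psi)gU^*_\psi$); $\mathcal F_{\mathcal K}=\mathcal K_{\rm ab}^{\rm cop}$, with antipode $S_{\mathcal F_{\mathcal K}}$ (equal to $S$). $V$ is the commutative Lie algebra spanned by $X_1,\ldots,X_n$, and $\mathcal U(V)$ is its enveloping algebra with antipode $S_{\mathcal U}$. $V$ acts on $\mathcal F_{\mathcal K}$ by $X\triangleright f=[X,f]$, and $\mathcal F_{\mathcal K}$ coacts on $V$ by $X_\ell\mapsto X_{\ell\langle0\rangle}\otimes X_{\ell\langle1\rangle}=X_k\otimes\sigma^k_\ell$; this extends to a coaction $u\mapsto u_{\langle0\rangle}\otimes u_{\langle1\rangle}$ on $\mathcal U(V)$ by $1\mapsto1\otimes1$, $uv\mapsto u_{(1)\langle0\rangle}v_{\langle0\rangle}\otimes u_{(1)\langle1\rangle}(u_{(2)}\triangleright v_{\langle1\rangle})$. The bicrossed product Hopf algebra $\mathcal F_{\mathcal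 K}\bowtie\mathcal U(V)$ is $\mathcal F_{\mathcal K}\otimes\mathcal U(V)$ with product $(f\bowtie u)(g\bowtie v)=f(u_{(1)}\triangleright g)\bowtie u_{(2)}v$, unit $1\bowtie1$, coproduct $\Delta(f\bowtie u)=(f_{(1)}\bowtie u_{(1)\langle0\rangle})\otimes(f_{(2)}u_{(1)\langle1\rangle}\bowtie u_{(2)})$, counit $\varepsilon\otimes\varepsilon$.
   Formalization: The formula for S_K(u) fails on U(V) (e.g. u=X², n=1); it is stated for u in V, where with S_K=S_F on F_K it determines S_K as the unique unital anti-homomorphism; for all u in U(V) the corrected formula applies the coaction to S_U(u). *)

theory Defs
  imports "HOL-Analysis.Analysis" "HOL-Library.Poly_Mapping"
begin

section \<open>Complex vector spaces and their tensor product\<close>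

class complex_space = ab_group_add +
  fixes scaleC :: "complex \<Rightarrow> 'a \<Rightarrow> 'a"  (infixr "*\<^sub>C" 75)
  assumes scaleC_add_right: "c *\<^sub>C (x + y) = c *\<^sub>C x + c *\<^sub>C y"
    and scaleC_add_left: "(c + d) *\<^sub>C x = c *\<^sub>C x + d *\<^sub>C x"
    and scaleC_scaleC: "c *\<^sub>C d *\<^sub>C x = (c * d) *\<^sub>C x"
    and scaleC_one: "1 *\<^sub>C x = x"

global_interpretation complex_space: vector_space "scaleC :: complex \<Rightarrow> 'a \<Rightarrow> 'a::complex_space"
  by standard (rule scaleC_add_right scaleC_add_left scaleC_scaleC scaleC_one)+

abbreviation clinear :: "('a::complex_space \<Rightarrow> 'b::complex_space) \<Rightarrow> bool"
  where "clinear \<equiv> Vector_Spaces.linear (*\<^sub>C) (*\<^sub>C)"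

lemma clinearI:
  assumes "\<And>x y. f (x + y) = f x + f y" "\<And>c x. f (c *\<^sub>C x) = c *\<^sub>C f x"
  shows "clinear f"
  using assms by unfold_locales auto

lemma clinear_add: "clinear f \<Longrightarrow> f (x + y) = f x + f y"
  by (simp add: Vector_Spaces.linear_def module_hom_def module_hom_axioms_def)

lemma clinear_scale: "clinear f \<Longrightarrow> f (c *\<^sub>C x) = c *\<^sub>C f x"
  by (simp add: Vector_Spaces.linear_def module_hom_def module_hom_axioms_def)

instantiation complex :: complex_space
begin
definition scaleC_complex :: "complex \<Rightarrow> complex \<Rightarrow> complex" where "scaleC_complex c x = c * x"
instance by standard (auto simp: scaleC_complex_def algebra_simps)
end

instantiation poly_mapping :: (type, complex_space) complex_space
begin
definition scaleC_poly_mapping :: "complex \<Rightarrow> ('a \<Rightarrow>\<^sub>0 'b) \<Rightarrow> ('a \<Rightarrow>\<^sub>0 'b)"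
  where "scaleC_poly_mapping c = Poly_Mapping.map ((*\<^sub>C) c)"

lemma lookup_scaleC: "Poly_Mapping.lookup (c *\<^sub>C p) k = c *\<^sub>C Poly_Mapping.lookup p k"
  by (simp add: scaleC_poly_mapping_def Poly_Mapping.map.rep_eq when_def)

instance
  by standard
    (auto intro!: poly_mapping_eqI
      simp: lookup_scaleC lookup_add scaleC_add_right scaleC_add_left scaleC_scaleC scaleC_one)
end

text \<open>\<open>V \<otimes> W\<close> is the free vector space on \<open>V \<times> W\<close> modulo the bilinearity relations.\<close>

definition tensor_rels :: "('a::complex_space \<times> 'b::complex_space \<Rightarrow>\<^sub>0 complex) set"
  where "tensor_rels =
    {Poly_Mapping.single (x + x', y) 1 - Poly_Mapping.single (x, y) 1 - Poly_Mapping.single (x', y) 1 | x x' y. True}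
    \<union> {Poly_Mapping.single (x, y + y') 1 - Poly_Mapping.single (x, y) 1 - Poly_Mapping.single (x, y') 1 | x y y'. True}
    \<union> {Poly_Mapping.single (c *\<^sub>C x, y) 1 - c *\<^sub>C Poly_Mapping.single (x, y) 1 | c x y. True}
    \<union> {Poly_Mapping.single (x, c *\<^sub>C y) 1 - c *\<^sub>C Poly_Mapping.single (x, y) 1 | c x y. True}"

definition tensor_eq ::
    "('a::complex_space \<times> 'b::complex_space \<Rightarrow>\<^sub>0 complex) \<Rightarrow> ('a \<times> 'b \<Rightarrow>\<^sub>0 complex) \<Rightarrow> bool"
  where "tensor_eq p q \<longleftrightarrow> p - q \<in> complex_space.span tensor_rels"

lemma equivp_diff_span: "equivp (\<lambda>p q. p - q \<in> complex_space.span S)"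
proof (rule equivpI)
  show "reflp (\<lambda>p q. p - q \<in> complex_space.span S)"
    by (auto intro!: reflpI complex_space.span_zero)
  show "symp (\<lambda>p q. p - q \<in> complex_space.span S)"
  proof (rule sympI)
    fix x y assume "x - y \<in> complex_space.span S"
    from complex_space.span_neg[OF this] show "y - x \<in> complex_space.span S" by simp
  qed
  show "transp (\<lambda>p q. p - q \<in> complex_space.span S)"
  proof (rule transpI)
    fix x y z assume "x - y \<in> complex_space.span S" "y - z \<in> complex_space.span S"
    from complex_space.span_add[OF this] show "x - z \<in> complex_space.span S" by simp
  qed
qed

lemma diff_span_add:
  "p - q \<in> complex_space.span S \<Longrightarrow> p' - q' \<in> complex_space.span S
    \<Longrightarrow> (p + p') - (q + q') \<in> complex_space.span S"
  using complex_space.span_add[of "p - q" S "p' - q'"] by (simp add: algebra_simps)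

lemma diff_span_diff:
  "p - q \<in> complex_space.span S \<Longrightarrow> p' - q' \<in> complex_space.span S
    \<Longrightarrow> (p - p') - (q - q') \<in> complex_space.span S"
  using complex_space.span_diff[of "p - q" S "p' - q'"] by (simp add: algebra_simps)

lemma diff_span_neg:
  "p - q \<in> complex_space.span S \<Longrightarrow> (- p) - (- q) \<in> complex_space.span S"
  using complex_space.span_neg[of "p - q" S] by simp

lemma diff_span_scale:
  "p - q \<in> complex_space.span S \<Longrightarrow> c *\<^sub>C p - c *\<^sub>C q \<in> complex_space.span S"
  using complex_space.span_scale[of "p - q" S c] by (simp add: complex_space.scale_right_diff_distrib)

quotient_type (overloaded) ('a, 'b) tensor =
    "'a::complex_space \<times> 'b::complex_space \<Rightarrow>\<^sub>0 complex" / tensor_eq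
  unfolding tensor_eq_def by (rule equivp_diff_span)

instantiation tensor :: (complex_space, complex_space) complex_space
begin
lift_definition zero_tensor :: "('a, 'b) tensor" is 0 .
lift_definition plus_tensor :: "('a, 'b) tensor \<Rightarrow> ('a, 'b) tensor \<Rightarrow> ('a, 'b) tensor" is "(+)"
  unfolding tensor_eq_def by (rule diff_span_add)
lift_definition minus_tensor :: "('a, 'b) tensor \<Rightarrow> ('a, 'b) tensor \<Rightarrow> ('a, 'b) tensor" is "(-)"
  unfolding tensor_eq_def by (rule diff_span_diff)
lift_definition uminus_tensor :: "('a, 'b) tensor \<Rightarrow> ('a, 'b) tensor" is uminus
  unfolding tensor_eq_def by (rule diff_span_neg)
lift_definition scaleC_tensor :: "complex \<Rightarrow> ('a, 'b) tensor \<Rightarrow> ('a, 'b) tensor" is "(*\<^sub>C)"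
  unfolding tensor_eq_def by (rule diff_span_scale)
instance
  by standard
    (transfer, simp add: tensor_eq_def complex_space.span_zero algebra_simps
        scaleC_add_right scaleC_add_left scaleC_scaleC scaleC_one)+
end

lift_definition tensor :: "'a::complex_space \<Rightarrow> 'b::complex_space \<Rightarrow> ('a, 'b) tensor"  (infixr "\<otimes>" 72)
  is "\<lambda>x y. Poly_Mapping.single (x, y) 1" .

text \<open>The linear extension of \<open>x \<otimes> y \<mapsto> h x y\<close>. It is evaluated on an arbitrary representative,
  so it is meaningful for bilinear \<open>h\<close> only; Sweedler notation is expressed through it.\<close>

definition tensor_lift ::
    "('a::complex_space \<Rightarrow> 'b::complex_space \<Rightarrow> 'c::complex_space) \<Rightarrow> ('a, 'b) tensor \<Rightarrow> 'c"
  where "tensor_lift h t =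
    (\<Sum>xy \<in> Poly_Mapping.keys (rep_tensor t). Poly_Mapping.lookup (rep_tensor t) xy *\<^sub>C h (fst xy) (snd xy))"

definition tensor_map ::
    "('a::complex_space \<Rightarrow> 'c::complex_space) \<Rightarrow> ('b::complex_space \<Rightarrow> 'd::complex_space)
      \<Rightarrow> ('a, 'b) tensor \<Rightarrow> ('c, 'd) tensor"
  where "tensor_map f g = tensor_lift (\<lambda>x y. f x \<otimes> g y)"

definition tensor_flip :: "('a::complex_space, 'b::complex_space) tensor \<Rightarrow> ('b, 'a) tensor"
  where "tensor_flip = tensor_lift (\<lambda>x y. y \<otimes> x)"

definition tensor_assoc ::
    "(('a::complex_space, 'b::complex_space) tensor, 'c::complex_space) tensor \<Rightarrow> ('a, ('b, 'c) tensor) tensor"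
  where "tensor_assoc = tensor_lift (\<lambda>t z. tensor_lift (\<lambda>x y. x \<otimes> (y \<otimes> z)) t)"

definition tensor_mult ::
    "('a::complex_space \<Rightarrow> 'a \<Rightarrow> 'a) \<Rightarrow> ('b::complex_space \<Rightarrow> 'b \<Rightarrow> 'b)
      \<Rightarrow> ('a, 'b) tensor \<Rightarrow> ('a, 'b) tensor \<Rightarrow> ('a, 'b) tensor"
  where "tensor_mult m m' s t =
    tensor_lift (\<lambda>x y. tensor_lift (\<lambda>x' y'. m x x' \<otimes> m' y y') t) s"


section \<open>Bialgebras and Hopf algebras over the complex numbers\<close>

record (overloaded) ('a::complex_space) bialgebra_data =
  mult :: "'a \<Rightarrow> 'a \<Rightarrow> 'a"
  unit :: 'a
  comult :: "'a \<Rightarrow> ('a, 'a) tensor"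
  counit :: "'a \<Rightarrow> complex"

definition algebra :: "('a::complex_space, 'm) bialgebra_data_scheme \<Rightarrow> bool"
  where "algebra B \<longleftrightarrow>
    (\<forall>x. clinear (mult B x)) \<and> (\<forall>y. clinear (\<lambda>x. mult B x y)) \<and>
    (\<forall>x y z. mult B (mult B x y) z = mult B x (mult B y z)) \<and>
    (\<forall>x. mult B (unit B) x = x) \<and> (\<forall>x. mult B x (unit B) = x)"

definition coalgebra :: "('a::complex_space, 'm) bialgebra_data_scheme \<Rightarrow> bool"
  where "coalgebra B \<longleftrightarrow>
    clinear (comult B) \<and> clinear (counit B) \<and>
    (\<forall>x. tensor_assoc (tensor_map (comult B) id (comult B x)) = tensor_map id (comult B) (comult B x)) \<and>
    (\<forall>x. tensor_lift (\<lambda>x\<^sub>1 x\<^sub>2. counit B x\<^sub>1 *\<^sub>C x\<^sub>2) (comult B x) = x) \<and>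
    (\<forall>x. tensor_lift (\<lambda>x\<^sub>1 x\<^sub>2. counit B x\<^sub>2 *\<^sub>C x\<^sub>1) (comult B x) = x)"

definition bialgebra :: "('a::complex_space, 'm) bialgebra_data_scheme \<Rightarrow> bool"
  where "bialgebra B \<longleftrightarrow>
    algebra B \<and> coalgebra B \<and>
    (\<forall>x y. comult B (mult B x y) = tensor_mult (mult B) (mult B) (comult B x) (comult B y)) \<and>
    comult B (unit B) = unit B \<otimes> unit B \<and>
    (\<forall>x y. counit B (mult B x y) = counit B x * counit B y) \<and>
    counit B (unit B) = 1"

definition antipode :: "('a::complex_space, 'm) bialgebra_data_scheme \<Rightarrow> ('a \<Rightarrow> 'a) \<Rightarrow> bool"
  where "antipode B S \<longleftrightarrow>
    clinear S \<and>
    (\<forall>x. tensor_lift (\<lambda>x\<^sub>1 x\<^sub>2. mult B (S x\<^sub>1) x\<^sub>2) (comult B x) = counit B x *\<^sub>C unit B) \<and>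
    (\<forall>x. tensor_lift (\<lambda>x\<^sub>1 x\<^sub>2. mult B x\<^sub>1 (S x\<^sub>2)) (comult B x) = counit B x *\<^sub>C unit B)"

definition hopf_algebra :: "('a::complex_space, 'm) bialgebra_data_scheme \<Rightarrow> bool"
  where "hopf_algebra B \<longleftrightarrow> bialgebra B \<and> (\<exists>S. antipode B S)"

definition antihom :: "('a::complex_space, 'm) bialgebra_data_scheme \<Rightarrow> ('a \<Rightarrow> 'a) \<Rightarrow> bool"
  where "antihom B S \<longleftrightarrow>
    clinear S \<and> S (unit B) = unit B \<and> (\<forall>x y. S (mult B x y) = mult B (S y) (S x))"

definition hopf_iso ::
    "('a::complex_space, 'm) bialgebra_data_scheme \<Rightarrow> ('b::complex_space, 'k) bialgebra_data_scheme
      \<Rightarrow> ('a \<Rightarrow> 'b) \<Rightarrow> bool"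
  where "hopf_iso A B h \<longleftrightarrow>
    hopf_algebra A \<and> hopf_algebra B \<and> clinear h \<and> bij h \<and>
    (\<forall>x y. h (mult A x y) = mult B (h x) (h y)) \<and> h (unit A) = unit B \<and>
    (\<forall>x. comult B (h x) = tensor_map h h (comult A x)) \<and> (\<forall>x. counit B (h x) = counit A x) \<and>
    (\<forall>S T. antipode A S \<longrightarrow> antipode B T \<longrightarrow> (\<forall>x. h (S x) = T (h x)))"

definition cop :: "('a::complex_space) bialgebra_data \<Rightarrow> 'a bialgebra_data"
  where "cop B = B\<lparr>comult := \<lambda>x. tensor_flip (comult B x)\<rparr>"


section \<open>Enveloping algebras\<close>

class lie_algebra = complex_space +
  fixes lie :: "'a \<Rightarrow> 'a \<Rightarrow> 'a"
  assumes lie_add_left: "lie (x + y) z = lie x z + lie y z"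
    and lie_scale_left: "lie (c *\<^sub>C x) z = c *\<^sub>C lie x z"
    and lie_add_right: "lie z (x + y) = lie z x + lie z y"
    and lie_scale_right: "lie z (c *\<^sub>C x) = c *\<^sub>C lie z x"
    and lie_self: "lie x x = 0"
    and lie_jacobi: "lie x (lie y z) + lie y (lie z x) + lie z (lie x y) = 0"

text \<open>Words form the free monoid, so that \<open>'a list \<Rightarrow>\<^sub>0 complex\<close> is the free associative algebra
  on the set \<open>'a\<close>.\<close>

instantiation list :: (type) monoid_add
begin
definition zero_list :: "'a list" where "zero_list = []"
definition plus_list :: "'a list \<Rightarrow> 'a list \<Rightarrow> 'a list" where "plus_list = (@)"
instance by standard (auto simp: zero_list_def plus_list_def)
end

definition letter :: "'a \<Rightarrow> ('a list \<Rightarrow>\<^sub>0 complex)"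
  where "letter x = Poly_Mapping.single [x] 1"

definition uea_rels :: "('a::lie_algebra list \<Rightarrow>\<^sub>0 complex) set"
  where "uea_rels =
    {letter (x + y) - letter x - letter y | x y. True}
    \<union> {letter (c *\<^sub>C x) - c *\<^sub>C letter x | c x. True}
    \<union> {letter x * letter y - letter y * letter x - letter (lie x y) | x y. True}"

definition uea_ideal :: "('a::lie_algebra list \<Rightarrow>\<^sub>0 complex) set"
  where "uea_ideal = complex_space.span {p * r * q | p r q. r \<in> uea_rels}"

definition uea_eq :: "('a::lie_algebra list \<Rightarrow>\<^sub>0 complex) \<Rightarrow> ('a list \<Rightarrow>\<^sub>0 complex) \<Rightarrow> bool"
  where "uea_eq p q \<longleftrightarrow> p - q \<in> uea_ideal"

quotient_type (overloaded) 'a uea = "'a::lie_algebra list \<Rightarrow>\<^sub>0 complex" / uea_eq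
  unfolding uea_eq_def uea_ideal_def by (rule equivp_diff_span)

lemma scaleC_eq_times: "c *\<^sub>C p = Poly_Mapping.single 0 c * p"
  for p :: "'a::monoid_add \<Rightarrow>\<^sub>0 complex"
proof -
  have "(*\<^sub>C) c = (*) c" by (auto simp: scaleC_complex_def)
  then show ?thesis by (simp add: scaleC_poly_mapping_def mult_map_scale_conv_mult)
qed

lemma single_0_commute: "p * Poly_Mapping.single 0 c = Poly_Mapping.single 0 c * p"
  for p :: "'a::monoid_add \<Rightarrow>\<^sub>0 complex"
proof -
  have p: "p = (\<Sum>k\<in>Poly_Mapping.keys p. Poly_Mapping.single k (Poly_Mapping.lookup p k))"
    by (rule poly_mapping_eqI)
      (auto simp: lookup_sum lookup_single when_def not_in_keys_iff_lookup_eq_zero)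
  show ?thesis
    by (subst (1 2) p) (simp add: sum_distrib_left sum_distrib_right mult_single mult.commute)
qed

lemma uea_ideal_mult:
  assumes "r \<in> uea_ideal"
  shows "a * r * b \<in> uea_ideal"
proof -
  have sub: "complex_space.subspace {r. a * r * b \<in> uea_ideal}"
    unfolding complex_space.subspace_def uea_ideal_def
  proof (intro conjI ballI allI)
    show "0 \<in> {r. a * r * b \<in> complex_space.span {p * r * q |p r q. r \<in> uea_rels}}"
      by (simp add: complex_space.span_zero)
  next
    fix x y
    assume "x \<in> {r. a * r * b \<in> complex_space.span {p * r * q |p r q. r \<in> uea_rels}}"
      "y \<in> {r. a * r * b \<in> complex_space.span {p * r * q |p r q. r \<in> uea_rels}}"
    then show "x + y \<in> {r. a * r * b \<in> complex_space.span {p * r * q |p r q. r \<in> uea_rels}}"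
      by (simp add: distrib_left distrib_right complex_space.span_add)
  next
    fix c x
    assume x: "x \<in> {r. a * r * b \<in> complex_space.span {p * r * q |p r q. r \<in> uea_rels}}"
    have "a * (c *\<^sub>C x) * b = c *\<^sub>C (a * x * b)"
      unfolding scaleC_eq_times by (metis mult.assoc single_0_commute)
    with x show "c *\<^sub>C x \<in> {r. a * r * b \<in> complex_space.span {p * r * q |p r q. r \<in> uea_rels}}"
      by (simp add: complex_space.span_scale)
  qed
  have gen: "a * r * b \<in> uea_ideal" if "r \<in> {p * r * q |p r q. r \<in> uea_rels}" for r
  proof -
    from that obtain p r' q where r: "r = p * r' * q" "r' \<in> uea_rels" by blast
    have "a * r * b = (a * p) * r' * (q * b)" by (simp add: r mult.assoc)
    with r(2) show ?thesis unfolding uea_ideal_def by (blast intro: complex_space.span_base)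
  qed
  show ?thesis
    using complex_space.span_induct[OF assms[unfolded uea_ideal_def] sub gen] by blast
qed

lemma lookup_times_Nil:
  "Poly_Mapping.lookup (p * q) [] = Poly_Mapping.lookup p [] * Poly_Mapping.lookup q []"
  for p q :: "'a list \<Rightarrow>\<^sub>0 complex"
proof -
  have "Poly_Mapping.lookup (p * q) [] = Sum_any (\<lambda>l. Poly_Mapping.lookup p l *
      Sum_any (\<lambda>k. Poly_Mapping.lookup q k when [] = l + k))"
    by (simp add: times_poly_mapping.rep_eq prod_fun_def)
  also have "\<dots> = Sum_any (\<lambda>l. Poly_Mapping.lookup p [] * Poly_Mapping.lookup q [] when l = ([] :: 'a list))"
  proof (rule Sum_any.cong)
    fix l :: "'a list"
    have *: "(\<lambda>k. Poly_Mapping.lookup q k when [] = l + k) =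
        (\<lambda>k. (Poly_Mapping.lookup q k when l = []) when k = [])"
      by (auto simp: plus_list_def when_def)
    show "Poly_Mapping.lookup p l * Sum_any (\<lambda>k. Poly_Mapping.lookup q k when [] = l + k) =
        (Poly_Mapping.lookup p [] * Poly_Mapping.lookup q [] when l = ([] :: 'a list))"
      unfolding * by (cases "l = []") simp_all
  qed
  finally show ?thesis by simp
qed

lemma uea_ideal_lookup_Nil:
  assumes "p \<in> uea_ideal"
  shows "Poly_Mapping.lookup p [] = 0"
proof -
  have sub: "complex_space.subspace {p :: 'a list \<Rightarrow>\<^sub>0 complex. Poly_Mapping.lookup p [] = 0}"
    by (auto simp: complex_space.subspace_def lookup_add lookup_scaleC scaleC_complex_def)
  have gen: "Poly_Mapping.lookup r [] = 0" if "r \<in> {p * r * q |p r q. r \<in> uea_rels}" for r :: "'a list \<Rightarrow>\<^sub>0 complex"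
    using that by (auto simp: lookup_times_Nil uea_rels_def letter_def lookup_minus lookup_single
        lookup_scaleC scaleC_complex_def)
  show ?thesis
    using complex_space.span_induct[OF assms[unfolded uea_ideal_def] sub gen] by blast
qed

instantiation uea :: (lie_algebra) "{complex_space, ring_1}"
begin
lift_definition zero_uea :: "'a uea" is 0 .
lift_definition one_uea :: "'a uea" is 1 .
lift_definition plus_uea :: "'a uea \<Rightarrow> 'a uea \<Rightarrow> 'a uea" is "(+)"
  unfolding uea_eq_def uea_ideal_def by (rule diff_span_add)
lift_definition minus_uea :: "'a uea \<Rightarrow> 'a uea \<Rightarrow> 'a uea" is "(-)"
  unfolding uea_eq_def uea_ideal_def by (rule diff_span_diff)
lift_definition uminus_uea :: "'a uea \<Rightarrow> 'a uea" is uminus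
  unfolding uea_eq_def uea_ideal_def by (rule diff_span_neg)
lift_definition scaleC_uea :: "complex \<Rightarrow> 'a uea \<Rightarrow> 'a uea" is "(*\<^sub>C)"
  unfolding uea_eq_def uea_ideal_def by (rule diff_span_scale)
lift_definition times_uea :: "'a uea \<Rightarrow> 'a uea \<Rightarrow> 'a uea" is "(*)"
proof -
  fix p q p' q' :: "'a list \<Rightarrow>\<^sub>0 complex"
  assume "uea_eq p q" "uea_eq p' q'"
  then have "1 * (p - q) * p' \<in> uea_ideal" "q * (p' - q') * 1 \<in> uea_ideal"
    unfolding uea_eq_def by (blast intro: uea_ideal_mult)+
  then have "1 * (p - q) * p' + q * (p' - q') * 1 \<in> uea_ideal"
    unfolding uea_ideal_def by (rule complex_space.span_add)
  then show "uea_eq (p * p') (q * q')"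
    by (simp add: uea_eq_def algebra_simps)
qed
instance
proof
  fix a b c :: "'a uea" and x y :: complex
  have [simp]: "(0 :: 'a list \<Rightarrow>\<^sub>0 complex) \<in> uea_ideal"
    by (simp add: uea_ideal_def complex_space.span_zero)
  show "a + b + c = a + (b + c)" by transfer (simp add: uea_eq_def algebra_simps)
  show "a + b = b + a" by transfer (simp add: uea_eq_def algebra_simps)
  show "0 + a = a" by transfer (simp add: uea_eq_def)
  show "- a + a = 0" by transfer (simp add: uea_eq_def)
  show "a - b = a + - b" by transfer (simp add: uea_eq_def)
  show "x *\<^sub>C (a + b) = x *\<^sub>C a + x *\<^sub>C b" by transfer (simp add: uea_eq_def scaleC_add_right)
  show "(x + y) *\<^sub>C a = x *\<^sub>C a + y *\<^sub>C a" by transfer (simp add: uea_eq_def scaleC_add_left)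
  show "x *\<^sub>C y *\<^sub>C a = (x * y) *\<^sub>C a" by transfer (simp add: uea_eq_def scaleC_scaleC)
  show "1 *\<^sub>C a = a" by transfer (simp add: uea_eq_def scaleC_one)
  show "a * b * c = a * (b * c)" by transfer (simp add: uea_eq_def mult.assoc)
  show "1 * a = a" by transfer (simp add: uea_eq_def)
  show "a * 1 = a" by transfer (simp add: uea_eq_def)
  show "(a + b) * c = a * c + b * c" by transfer (simp add: uea_eq_def algebra_simps)
  show "a * (b + c) = a * b + a * c" by transfer (simp add: uea_eq_def algebra_simps)
  show "(0 :: 'a uea) \<noteq> 1"
  proof (transfer, rule notI)
    assume "uea_eq (0 :: 'a list \<Rightarrow>\<^sub>0 complex) 1"
    then have "Poly_Mapping.lookup (0 - 1 :: 'a list \<Rightarrow>\<^sub>0 complex) [] = 0"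
      unfolding uea_eq_def by (rule uea_ideal_lookup_Nil)
    then show False by (simp add: lookup_minus lookup_one zero_list_def)
  qed
qed
end


lift_definition uea_of :: "'a::lie_algebra \<Rightarrow> 'a uea" is letter .

text \<open>If \<open>h\<close> is a representation of the Lie algebra on a vector space, this is the induced
  action of the enveloping algebra.\<close>

definition uea_act :: "('a::lie_algebra \<Rightarrow> 'm \<Rightarrow> 'm) \<Rightarrow> 'a uea \<Rightarrow> 'm \<Rightarrow> 'm::complex_space"
  where "uea_act h u m =
    (\<Sum>w \<in> Poly_Mapping.keys (rep_uea u). Poly_Mapping.lookup (rep_uea u) w *\<^sub>C foldr h w m)"

definition uea_comult :: "'a::lie_algebra uea \<Rightarrow> ('a uea, 'a uea) tensor"
  where "uea_comult u =
    uea_act (\<lambda>x. tensor_mult (*) (*) (uea_of x \<otimes> 1 + 1 \<otimes> uea_of x)) u (1 \<otimes> 1)"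

definition uea_counit :: "'a::lie_algebra uea \<Rightarrow> complex"
  where "uea_counit u = uea_act (\<lambda>x c. 0) u 1"

definition uea_antipode :: "'a::lie_algebra uea \<Rightarrow> 'a uea"
  where "uea_antipode u = uea_act (\<lambda>x v. v * (- uea_of x)) u 1"


section \<open>Smooth functions and diffeomorphisms\<close>

definition partial :: "'n \<Rightarrow> (real^'n \<Rightarrow> 'b::real_normed_vector) \<Rightarrow> real^'n \<Rightarrow> 'b"
  where "partial k f x = frechet_derivative f (at x) (axis k 1)"

primrec Cm :: "nat \<Rightarrow> (real^'n \<Rightarrow> 'b::real_normed_vector) \<Rightarrow> bool"
  where
    "Cm 0 f \<longleftrightarrow> continuous_on UNIV f"
  | "Cm (Suc m) f \<longleftrightarrow> (\<forall>x. f differentiable (at x)) \<and> (\<forall>k. Cm m (partial k f))"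

definition smooth :: "(real^'n \<Rightarrow> 'b::real_normed_vector) \<Rightarrow> bool"
  where "smooth f \<longleftrightarrow> (\<forall>m. Cm m f)"

lemma partial_has_derivative:
  "(f has_derivative D) (at x) \<Longrightarrow> partial k f x = D (axis k 1)"
  unfolding partial_def by (metis frechet_derivative_at)

lemma Cm_continuous: "Cm m f \<Longrightarrow> continuous_on UNIV f"
  by (cases m) (auto intro: differentiable_imp_continuous_on simp: differentiable_on_def)

lemma Cm_Suc_D: "Cm (Suc m) f \<Longrightarrow> Cm m f"
proof (induction m arbitrary: f)
  case 0
  then show ?case using Cm_continuous[of "Suc 0" f] by simp
next
  case (Suc m)
  from Suc.prems have "\<forall>x. f differentiable (at x)" "\<And>k. Cm (Suc m) (partial k f)" by auto
  then show ?case using Suc.IH by (simp only: Cm.simps) blast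
qed

lemma Cm_linear:
  assumes L: "bounded_linear L"
  shows "Cm m f \<Longrightarrow> Cm m (\<lambda>x. L (f x))"
proof (induction m arbitrary: f)
  case 0
  then show ?case
    using bounded_linear.continuous_on[OF L] by auto
next
  case (Suc m)
  then have d: "(f has_derivative frechet_derivative f (at x)) (at x)" for x
    by (simp add: frechet_derivative_works)
  have D: "((\<lambda>x. L (f x)) has_derivative (\<lambda>h. L (frechet_derivative f (at x) h))) (at x)" for x
    by (rule bounded_linear.has_derivative[OF L d])
  have "partial k (\<lambda>x. L (f x)) = (\<lambda>x. L (partial k f x))" for k
    by (rule ext) (simp add: partial_has_derivative[OF D] partial_def[symmetric])
  with Suc show ?case using D by (auto simp: differentiable_def)
qed

lemma Cm_add:
  "Cm m f \<Longrightarrow> Cm m g \<Longrightarrow> Cm m (\<lambda>x. f x + g x)"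
proof (induction m arbitrary: f g)
  case 0
  then show ?case by (auto intro: continuous_intros)
next
  case (Suc m)
  then have "(f has_derivative frechet_derivative f (at x)) (at x)"
    "(g has_derivative frechet_derivative g (at x)) (at x)" for x
    by (simp_all add: frechet_derivative_works)
  then have D: "((\<lambda>x. f x + g x) has_derivative
      (\<lambda>h. frechet_derivative f (at x) h + frechet_derivative g (at x) h)) (at x)" for x
    by (intro derivative_intros)
  have "partial k (\<lambda>x. f x + g x) = (\<lambda>x. partial k f x + partial k g x)" for k
    by (rule ext) (simp add: partial_has_derivative[OF D] partial_def[symmetric])
  with Suc show ?case using D by (simp add: differentiable_def) blast
qed

lemma Cm_const: "Cm m (\<lambda>x :: real^'n. c)"
proof (induction m arbitrary: c)
  case (Suc m)
  have "partial k (\<lambda>x :: real^'n. c) = (\<lambda>x. 0)" for k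
    by (simp add: partial_def fun_eq_iff)
  with Suc show ?case by simp
qed simp

lemma Cm_sum:
  "(\<And>i. i \<in> I \<Longrightarrow> Cm m (f i)) \<Longrightarrow> Cm m (\<lambda>x. \<Sum>i\<in>I. f i x)"
  by (induction I rule: infinite_finite_induct) (auto simp: Cm_const Cm_add)

lemma Cm_bilinear:
  assumes b: "bounded_bilinear b"
  shows "Cm m f \<Longrightarrow> Cm m g \<Longrightarrow> Cm m (\<lambda>x. b (f x) (g x))"
proof (induction m arbitrary: f g)
  case 0
  then show ?case by (auto intro: bounded_bilinear.continuous_on[OF b])
next
  case (Suc m)
  then have "(f has_derivative frechet_derivative f (at x)) (at x)"
    "(g has_derivative frechet_derivative g (at x)) (at x)" for x
    by (simp_all add: frechet_derivative_works)
  then have D: "((\<lambda>x. b (f x) (g x)) has_derivative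
      (\<lambda>h. b (f x) (frechet_derivative g (at x) h) + b (frechet_derivative f (at x) h) (g x))) (at x)" for x
    by (rule bounded_bilinear.FDERIV[OF b])
  have "partial k (\<lambda>x. b (f x) (g x)) = (\<lambda>x. b (f x) (partial k g x) + b (partial k f x) (g x))" for k
    by (rule ext) (simp add: partial_has_derivative[OF D] partial_def[symmetric])
  moreover have "Cm m (\<lambda>x. b (f x) (partial k g x) + b (partial k f x) (g x))" for k
  proof (intro Cm_add Suc.IH)
    show "Cm m f" "Cm m g" using Suc.prems by (blast intro: Cm_Suc_D)+
    show "Cm m (partial k f)" "Cm m (partial k g)" using Suc.prems by simp_all
  qed
  ultimately show ?case using D by (simp add: differentiable_def) blast
qed

lemma axis_expansion: "(\<Sum>i\<in>UNIV. (v $ i) *\<^sub>R axis i 1) = (v :: real^'n)"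
  using basis_expansion[of v] by (simp add: scalar_mult_eq_scaleR)

lemma Cm_compose:
  fixes f :: "real^'n \<Rightarrow> 'b::real_normed_vector" and g :: "real^'m \<Rightarrow> real^'n"
  shows "Cm m f \<Longrightarrow> Cm m g \<Longrightarrow> Cm m (\<lambda>x. f (g x))"
proof (induction m arbitrary: f)
  case 0
  then show ?case by (auto intro: continuous_on_compose2)
next
  case (Suc m)
  then have df: "(f has_derivative frechet_derivative f (at x)) (at x)"
    and dg: "(g has_derivative frechet_derivative g (at y)) (at y)" for x y
    by (simp_all add: frechet_derivative_works)
  have D: "((\<lambda>x. f (g x)) has_derivative
      (\<lambda>h. frechet_derivative f (at (g x)) (frechet_derivative g (at x) h))) (at x)" for x
    using diff_chain_at[OF dg df] by (simp add: o_def)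
  have P: "partial k (\<lambda>x. f (g x)) = (\<lambda>x. \<Sum>i\<in>UNIV. (partial k g x $ i) *\<^sub>R partial i f (g x))" for k
  proof
    fix x
    have lin: "linear (frechet_derivative f (at (g x)))"
      using df has_derivative_linear by blast
    have "partial k (\<lambda>x. f (g x)) x = frechet_derivative f (at (g x)) (partial k g x)"
      by (simp add: partial_has_derivative[OF D] partial_def)
    also have "\<dots> = frechet_derivative f (at (g x)) (\<Sum>i\<in>UNIV. (partial k g x $ i) *\<^sub>R axis i 1)"
      by (simp only: axis_expansion)
    also have "\<dots> = (\<Sum>i\<in>UNIV. (partial k g x $ i) *\<^sub>R partial i f (g x))"
      by (simp add: linear_sum[OF lin] linear_cmul[OF lin] partial_def)
    finally show "partial k (\<lambda>x. f (g x)) x = (\<Sum>i\<in>UNIV. (partial k g x $ i) *\<^sub>R partial i f (g x))" .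
  qed
  have "Cm m (\<lambda>x. \<Sum>i\<in>UNIV. (partial k g x $ i) *\<^sub>R partial i f (g x))" for k
  proof (intro Cm_sum Cm_bilinear[OF bounded_bilinear_scaleR])
    show "Cm m (\<lambda>x. partial k g x $ i)" for i
      using Suc.prems by (auto intro: Cm_linear bounded_linear_vec_nth)
    show "Cm m (\<lambda>x. partial i f (g x))" for i
      using Suc.prems Cm_Suc_D[of m g] by (intro Suc.IH) auto
  qed
  then show ?case using D by (auto simp: P differentiable_def)
qed

lemma smooth_partial: "smooth f \<Longrightarrow> smooth (partial k f)"
  unfolding smooth_def by (metis Cm.simps(2))

lemma smooth_differentiable: "smooth f \<Longrightarrow> f differentiable (at x)"
  unfolding smooth_def by (metis Cm.simps(2))

lemma smooth_add: "smooth f \<Longrightarrow> smooth g \<Longrightarrow> smooth (\<lambda>x. f x + g x)"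
  by (simp add: smooth_def Cm_add)

lemma smooth_mult: "smooth f \<Longrightarrow> smooth g \<Longrightarrow> smooth (\<lambda>x. f x * g x :: complex)"
  by (simp add: smooth_def Cm_bilinear bounded_bilinear_mult)

lemma smooth_const: "smooth (\<lambda>x. c)"
  by (simp add: smooth_def Cm_const)

lemma smooth_compose: "smooth f \<Longrightarrow> smooth g \<Longrightarrow> smooth (\<lambda>x. f (g x))"
  by (simp add: smooth_def Cm_compose)

lemma smooth_ident: "smooth (\<lambda>x :: real^'n. x)"
  unfolding smooth_def
proof
  fix m
  have "partial k (\<lambda>x :: real^'n. x) = (\<lambda>x. axis k 1)" for k
    by (simp add: partial_def fun_eq_iff)
  then show "Cm m (\<lambda>x :: real^'n. x)"
    by (cases m) (auto simp: Cm_const continuous_on_id)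
qed

lemma det_jacobian_compose:
  fixes f g :: "real^'n \<Rightarrow> real^'n"
  assumes "smooth f" "smooth g"
  shows "det (jacobian (f \<circ> g) (at x)) = det (jacobian f (at (g x))) * det (jacobian g (at x))"
proof -
  have "frechet_derivative (f \<circ> g) (at x) =
      frechet_derivative f (at (g x)) \<circ> frechet_derivative g (at x)"
    using assms by (intro frechet_derivative_compose smooth_differentiable)
  then show ?thesis
    using assms by (simp add: jacobian_def matrix_compose linear_frechet_derivative
        smooth_differentiable det_mul)
qed

typedef 'n diffeo =
    "{\<phi> :: real^'n \<Rightarrow> real^'n. bij \<phi> \<and> smooth \<phi> \<and> smooth (inv \<phi>) \<and> (\<forall>x. det (jacobian \<phi> (at x)) > 0)}"
  morphisms diffeo_map Abs_diffeo
proof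
  show "id \<in> {\<phi> :: real^'n \<Rightarrow> real^'n. bij \<phi> \<and> smooth \<phi> \<and> smooth (inv \<phi>) \<and> (\<forall>x. det (jacobian \<phi> (at x)) > 0)}"
    by (simp add: inv_id jacobian_def matrix_id_mat_1 smooth_ident id_def[symmetric])
       (simp add: id_def smooth_ident)
qed

setup_lifting type_definition_diffeo

lift_definition diffeo_id :: "'n::finite diffeo" is "id :: real^'n \<Rightarrow> real^'n"
    by (simp add: inv_id jacobian_def matrix_id_mat_1 smooth_ident id_def[symmetric])
       (simp add: id_def smooth_ident)

lift_definition diffeo_comp :: "'n::finite diffeo \<Rightarrow> 'n diffeo \<Rightarrow> 'n diffeo" is "(\<circ>)"
proof -
  fix f g :: "real^'n \<Rightarrow> real^'n"
  assume f: "bij f \<and> smooth f \<and> smooth (inv f) \<and> (\<forall>x. det (jacobian f (at x)) > 0)"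
    and g: "bij g \<and> smooth g \<and> smooth (inv g) \<and> (\<forall>x. det (jacobian g (at x)) > 0)"
  have "smooth (f \<circ> g)" "smooth (inv g \<circ> inv f)"
    unfolding o_def using f g by (auto intro: smooth_compose)
  with f g show "bij (f \<circ> g) \<and> smooth (f \<circ> g) \<and> smooth (inv (f \<circ> g)) \<and>
      (\<forall>x. det (jacobian (f \<circ> g) (at x)) > 0)"
    by (simp add: bij_comp o_inv_distrib det_jacobian_compose)
qed

lift_definition diffeo_inv :: "'n::finite diffeo \<Rightarrow> 'n diffeo" is inv
proof -
  fix f :: "real^'n \<Rightarrow> real^'n"
  assume f: "bij f \<and> smooth f \<and> smooth (inv f) \<and> (\<forall>x. det (jacobian f (at x)) > 0)"
  have "f \<circ> inv f = id" using f by (simp add: surj_iff[symmetric] bij_is_surj)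
  then have "det (jacobian f (at (inv f x))) * det (jacobian (inv f) (at x)) = 1" for x
    using det_jacobian_compose[of f "inv f" x] f by (simp add: jacobian_def matrix_id_mat_1)
  moreover have "det (jacobian f (at (inv f x))) > 0" for x using f by blast
  ultimately have "det (jacobian (inv f) (at x)) > 0" for x
    by (metis zero_less_mult_pos zero_less_one)
  with f show "bij (inv f) \<and> smooth (inv f) \<and> smooth (inv (inv f)) \<and>
      (\<forall>x. det (jacobian (inv f) (at x)) > 0)"
    by (simp add: bij_imp_bij_inv inv_inv_eq)
qed


section \<open>The crossed product algebra\<close>

typedef 'n test_fun = "{f :: real^'n \<Rightarrow> complex. smooth f \<and> compact (closure {x. f x \<noteq> 0})}"
  morphisms test_fun_app Abs_test_fun
  by (rule exI[of _ "\<lambda>x. 0"]) (simp add: smooth_const)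

setup_lifting type_definition_test_fun

instantiation test_fun :: (finite) "{complex_space, comm_ring}"
begin
lift_definition zero_test_fun :: "'a test_fun" is "\<lambda>x. 0"
  by (simp add: smooth_const)
lift_definition plus_test_fun :: "'a test_fun \<Rightarrow> 'a test_fun \<Rightarrow> 'a test_fun" is "\<lambda>f g x. f x + g x"
proof -
  fix f g :: "real^'a \<Rightarrow> complex"
  assume "smooth f \<and> compact (closure {x. f x \<noteq> 0})" "smooth g \<and> compact (closure {x. g x \<noteq> 0})"
  moreover have "bounded {x. f x + g x \<noteq> 0}" if "bounded {x. f x \<noteq> 0}" "bounded {x. g x \<noteq> 0}"
  proof (rule bounded_subset)
    show "bounded ({x. f x \<noteq> 0} \<union> {x. g x \<noteq> 0})" using that by simp
  qed auto
  ultimately show "smooth (\<lambda>x. f x + g x) \<and> compact (closure {x. f x + g x \<noteq> 0})"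
    by (simp add: smooth_add)
qed
lift_definition times_test_fun :: "'a test_fun \<Rightarrow> 'a test_fun \<Rightarrow> 'a test_fun" is "\<lambda>f g x. f x * g x"
  by (auto simp: smooth_mult elim!: bounded_subset)
lift_definition scaleC_test_fun :: "complex \<Rightarrow> 'a test_fun \<Rightarrow> 'a test_fun" is "\<lambda>c f x. c * f x"
  by (auto simp: smooth_mult smooth_const elim!: bounded_subset)
lift_definition uminus_test_fun :: "'a test_fun \<Rightarrow> 'a test_fun" is "\<lambda>f x. - f x"
proof -
  fix f :: "real^'a \<Rightarrow> complex"
  assume f: "smooth f \<and> compact (closure {x. f x \<noteq> 0})"
  then have "smooth (\<lambda>x. (-1) * f x)" by (intro smooth_mult smooth_const) auto
  with f show "smooth (\<lambda>x. - f x) \<and> compact (closure {x. - f x \<noteq> 0})" by simp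
qed
definition minus_test_fun :: "'a test_fun \<Rightarrow> 'a test_fun \<Rightarrow> 'a test_fun"
  where "minus_test_fun f g = f + (- g)"
instance
proof
  fix a b c :: "'a test_fun" and x y :: complex
  show "a + b + c = a + (b + c)" by transfer (simp add: add.assoc)
  show "a + b = b + a" by transfer (simp add: add.commute)
  show "0 + a = a" by transfer simp
  show "- a + a = 0" by transfer simp
  show "a - b = a + - b" by (simp add: minus_test_fun_def)
  show "x *\<^sub>C (a + b) = x *\<^sub>C a + x *\<^sub>C b" by transfer (simp add: distrib_left)
  show "(x + y) *\<^sub>C a = x *\<^sub>C a + y *\<^sub>C a" by transfer (simp add: distrib_right)
  show "x *\<^sub>C y *\<^sub>C a = (x * y) *\<^sub>C a" by transfer (simp add: mult.assoc)
  show "1 *\<^sub>C a = a" by transfer simp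
  show "a * b * c = a * (b * c)" by transfer (simp add: mult.assoc)
  show "a * b = b * a" by transfer (simp add: mult.commute)
  show "(a + b) * c = a * c + b * c" by transfer (simp add: distrib_right)
qed
end

text \<open>Multiplication by a smooth function; the case distinction only makes the map total.\<close>

lift_definition test_fun_smult :: "(real^'n \<Rightarrow> complex) \<Rightarrow> 'n::finite test_fun \<Rightarrow> 'n test_fun"
  is "\<lambda>h f. if smooth h then (\<lambda>x. h x * f x) else (\<lambda>x. 0)"
  by (auto simp: smooth_mult smooth_const elim!: bounded_subset)

lift_definition test_fun_partial :: "'n \<Rightarrow> 'n::finite test_fun \<Rightarrow> 'n test_fun" is partial
proof -
  fix k and f :: "real^'n \<Rightarrow> complex"
  assume f: "smooth f \<and> compact (closure {x. f x \<noteq> 0})"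
  have "partial k f x = 0" if "x \<notin> closure {x. f x \<noteq> 0}" for x
  proof -
    have "((\<lambda>x. 0) has_derivative (\<lambda>h. 0)) (at x)" by simp
    then have "(f has_derivative (\<lambda>h. 0)) (at x)"
    proof (rule has_derivative_transform_within_open[of _ _ _ _ "- closure {x. f x \<noteq> 0}"])
      show "0 = f y" if "y \<in> - closure {x. f x \<noteq> 0}" for y
        using that closure_subset[of "{x. f x \<noteq> 0}"] by auto
    qed (use that in auto)
    then show ?thesis by (simp add: partial_has_derivative)
  qed
  then have "{x. partial k f x \<noteq> 0} \<subseteq> closure {x. f x \<noteq> 0}" by blast
  then show "smooth (partial k f) \<and> compact (closure {x. partial k f x \<noteq> 0})"
    using f by (metis smooth_partial bounded_subset compact_closure compact_imp_bounded)
qed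

lift_definition test_fun_compose :: "'n::finite test_fun \<Rightarrow> 'n diffeo \<Rightarrow> 'n test_fun" is "(\<circ>)"
proof -
  fix f :: "real^'n \<Rightarrow> complex" and \<phi> :: "real^'n \<Rightarrow> real^'n"
  assume f: "smooth f \<and> compact (closure {x. f x \<noteq> 0})"
    and \<phi>: "bij \<phi> \<and> smooth \<phi> \<and> smooth (inv \<phi>) \<and> (\<forall>x. det (jacobian \<phi> (at x)) > 0)"
  have "continuous_on (closure {x. f x \<noteq> 0}) (inv \<phi>)"
    using \<phi> Cm_continuous continuous_on_subset unfolding smooth_def by blast
  with f have "compact (inv \<phi> ` closure {x. f x \<noteq> 0})"
    by (blast intro: compact_continuous_image)
  moreover have "{x. (f \<circ> \<phi>) x \<noteq> 0} \<subseteq> inv \<phi> ` closure {x. f x \<noteq> 0}"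
  proof
    fix x assume "x \<in> {x. (f \<circ> \<phi>) x \<noteq> 0}"
    then have "\<phi> x \<in> closure {x. f x \<noteq> 0}" using closure_subset[of "{x. f x \<noteq> 0}"] by auto
    moreover have "x = inv \<phi> (\<phi> x)" using \<phi> by (simp add: bij_is_inj)
    ultimately show "x \<in> inv \<phi> ` closure {x. f x \<noteq> 0}" by blast
  qed
  ultimately have "compact (closure {x. (f \<circ> \<phi>) x \<noteq> 0})"
    by (metis bounded_subset compact_closure compact_imp_bounded)
  moreover have "smooth (f \<circ> \<phi>)"
    unfolding o_def using f \<phi> by (auto intro: smooth_compose)
  ultimately show "smooth (f \<circ> \<phi>) \<and> compact (closure {x. (f \<circ> \<phi>) x \<noteq> 0})" by blast
qed

text \<open>The element \<open>\<Sum> f\<^sub>\<phi> U*\<^sub>\<phi>\<close> is the finitely supported family \<open>\<phi> \<mapsto> f\<^sub>\<phi>\<close>. Diffeomorphisms are not a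
  \<open>monoid_add\<close>, so the untwisted convolution product of \<open>\<Rightarrow>\<^sub>0\<close> is not available here.\<close>

type_synonym 'n crossed = "'n diffeo \<Rightarrow>\<^sub>0 'n test_fun"

abbreviation monom :: "'n::finite test_fun \<Rightarrow> 'n diffeo \<Rightarrow> 'n crossed"
  where "monom f \<phi> \<equiv> Poly_Mapping.single \<phi> f"

definition crossed_mult :: "'n::finite crossed \<Rightarrow> 'n crossed \<Rightarrow> 'n crossed"
  where "crossed_mult a b =
    (\<Sum>\<phi> \<in> Poly_Mapping.keys a. \<Sum>\<psi> \<in> Poly_Mapping.keys b.
      monom (Poly_Mapping.lookup a \<phi> * test_fun_compose (Poly_Mapping.lookup b \<psi>) \<phi>) (diffeo_comp \<psi> \<phi>))"


section \<open>The algebras \<open>\<K>\<^sub>n\<close> and \<open>\<K>\<^sub>a\<^sub>b\<close>\<close>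

definition X_op :: "'n \<Rightarrow> 'n::finite crossed \<Rightarrow> 'n crossed"
  where "X_op k = Poly_Mapping.map (test_fun_partial k)"

definition diag_op :: "('n diffeo \<Rightarrow> real^'n \<Rightarrow> complex) \<Rightarrow> 'n::finite crossed \<Rightarrow> 'n crossed"
  where "diag_op d = Poly_Mapping.mapp (\<lambda>\<phi>. test_fun_smult (d \<phi>))"

text \<open>\<open>sigma_op i [j\<^sub>1, \<dots>, j\<^sub>r]\<close> multiplies the coefficient of \<open>U*\<^sub>\<phi>\<close> by \<open>\<partial>\<^bsub>j\<^sub>r\<^esub> \<dots> \<partial>\<^bsub>j\<^sub>1\<^esub> (\<phi>\<^sup>i)\<close>.\<close>

definition sigma_op :: "'n \<Rightarrow> 'n list \<Rightarrow> 'n::finite crossed \<Rightarrow> 'n crossed"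
  where "sigma_op i js = diag_op (\<lambda>\<phi> x. of_real (fold partial js (\<lambda>y. diffeo_map \<phi> y $ i) x))"

definition sigma_inv_op :: "'n::finite crossed \<Rightarrow> 'n crossed"
  where "sigma_inv_op = diag_op (\<lambda>\<phi> x. of_real (inverse (det (jacobian (diffeo_map \<phi>) (at x)))))"

inductive_set op_algebra :: "('a::complex_space \<Rightarrow> 'a) set \<Rightarrow> ('a \<Rightarrow> 'a) set" for G
  where
    op_id: "id \<in> op_algebra G"
  | op_gen: "T \<in> G \<Longrightarrow> T \<in> op_algebra G"
  | op_add: "S \<in> op_algebra G \<Longrightarrow> T \<in> op_algebra G \<Longrightarrow> (\<lambda>a. S a + T a) \<in> op_algebra G"
  | op_scale: "T \<in> op_algebra G \<Longrightarrow> (\<lambda>a. c *\<^sub>C T a) \<in> op_algebra G"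
  | op_comp: "S \<in> op_algebra G \<Longrightarrow> T \<in> op_algebra G \<Longrightarrow> S \<circ> T \<in> op_algebra G"

lemma op_zero: "(\<lambda>a. 0) \<in> op_algebra G"
  using op_scale[OF op_id, of 0 G] by simp

lemma op_neg: "T \<in> op_algebra G \<Longrightarrow> (\<lambda>a. - T a) \<in> op_algebra G"
  using op_scale[of T G "-1"] by simp

lemma op_diff: "S \<in> op_algebra G \<Longrightarrow> T \<in> op_algebra G \<Longrightarrow> (\<lambda>a. S a - T a) \<in> op_algebra G"
  using op_add[OF _ op_neg, of S G T] by simp

lemma op_algebra_linear:
  assumes "T \<in> op_algebra G" "\<And>T. T \<in> G \<Longrightarrow> clinear T"
  shows "clinear T"
  using assms(1)
proof induction
  case op_id
  then show ?case by (simp add: clinearI)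
next
  case (op_gen T)
  then show ?case by (rule assms(2))
next
  case (op_add S T)
  then show ?case
    by (intro clinearI) (auto simp: clinear_add clinear_scale scaleC_add_right)
next
  case (op_scale T c)
  then show ?case
    by (intro clinearI) (auto simp: clinear_add clinear_scale scaleC_add_right scaleC_scaleC mult.commute)
next
  case (op_comp S T)
  then show ?case
    by (intro clinearI) (auto simp: clinear_add clinear_scale)
qed

lemma test_fun_partial_linear:
  "test_fun_partial k (f + g) = test_fun_partial k f + test_fun_partial k g"
  "test_fun_partial k (c *\<^sub>C f) = c *\<^sub>C test_fun_partial k f"
proof -
  show "test_fun_partial k (f + g) = test_fun_partial k f + test_fun_partial k g"
  proof (transfer, rule ext)
    fix k x and f g :: "real^'a \<Rightarrow> complex"
    assume "smooth f \<and> compact (closure {x. f x \<noteq> 0})" "smooth g \<and> compact (closure {x. g x \<noteq> 0})"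
    then have "(f has_derivative frechet_derivative f (at x)) (at x)"
      "(g has_derivative frechet_derivative g (at x)) (at x)"
      by (simp_all add: frechet_derivative_works[symmetric] smooth_differentiable)
    then have D: "((\<lambda>x. f x + g x) has_derivative
        (\<lambda>h. frechet_derivative f (at x) h + frechet_derivative g (at x) h)) (at x)"
      by (intro derivative_intros)
    show "partial k (\<lambda>x. f x + g x) x = partial k f x + partial k g x"
      by (simp add: partial_has_derivative[OF D] partial_def[symmetric])
  qed
  show "test_fun_partial k (c *\<^sub>C f) = c *\<^sub>C test_fun_partial k f"
  proof (transfer, rule ext)
    fix k c x and f :: "real^'a \<Rightarrow> complex"
    assume "smooth f \<and> compact (closure {x. f x \<noteq> 0})"
    then have "(f has_derivative frechet_derivative f (at x)) (at x)"
      by (simp add: frechet_derivative_works[symmetric] smooth_differentiable)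
    then have D: "((\<lambda>x. c * f x) has_derivative (\<lambda>h. c * frechet_derivative f (at x) h)) (at x)"
      by (rule has_derivative_mult_right)
    show "partial k (\<lambda>x. c * f x) x = c * partial k f x"
      by (simp add: partial_has_derivative[OF D] partial_def[symmetric])
  qed
qed

lemma test_fun_partial_0: "test_fun_partial k 0 = 0"
  using test_fun_partial_linear(2)[of k 0 0] by simp

lemma test_fun_smult_linear:
  "test_fun_smult h (f + g) = test_fun_smult h f + test_fun_smult h g"
  "test_fun_smult h (c *\<^sub>C f) = c *\<^sub>C test_fun_smult h f"
  by (transfer, simp add: fun_eq_iff algebra_simps)+

lemma test_fun_smult_0: "test_fun_smult h 0 = 0"
  using test_fun_smult_linear(2)[of h 0 0] by simp

lemma test_fun_smult_commute:
  "test_fun_smult h (test_fun_smult h' f) = test_fun_smult h' (test_fun_smult h f)"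
  by transfer (simp add: fun_eq_iff)

lemma lookup_X_op: "Poly_Mapping.lookup (X_op k a) \<phi> = test_fun_partial k (Poly_Mapping.lookup a \<phi>)"
  by (simp add: X_op_def Poly_Mapping.map.rep_eq when_def test_fun_partial_0)

lemma lookup_diag_op: "Poly_Mapping.lookup (diag_op d a) \<phi> = test_fun_smult (d \<phi>) (Poly_Mapping.lookup a \<phi>)"
  by (simp add: diag_op_def lookup_mapp when_def in_keys_iff test_fun_smult_0)

lemma clinear_X_op: "clinear (X_op k)"
  by (intro clinearI poly_mapping_eqI)
    (simp_all add: lookup_X_op lookup_add lookup_scaleC test_fun_partial_linear)

lemma clinear_diag_op: "clinear (diag_op d)"
  by (intro clinearI poly_mapping_eqI)
    (simp_all add: lookup_diag_op lookup_add lookup_scaleC test_fun_smult_linear)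

lemma diag_op_commute: "diag_op d (diag_op d' a) = diag_op d' (diag_op d a)"
  by (rule poly_mapping_eqI) (simp add: lookup_diag_op test_fun_smult_commute)

definition kn_gens :: "('n::finite crossed \<Rightarrow> 'n crossed) set"
  where "kn_gens = {X_op k | k. True} \<union> {sigma_op i [j] | i j. True} \<union> {sigma_inv_op}"

definition kab_gens :: "('n::finite crossed \<Rightarrow> 'n crossed) set"
  where "kab_gens = {sigma_op i js | i js. js \<noteq> []} \<union> {sigma_inv_op}"

lemma clinear_kn_gens: "T \<in> kn_gens \<Longrightarrow> clinear T"
  by (auto simp: kn_gens_def sigma_op_def sigma_inv_op_def clinear_X_op clinear_diag_op)

lemma clinear_kab_gens: "T \<in> kab_gens \<Longrightarrow> clinear T"
  by (auto simp: kab_gens_def sigma_op_def sigma_inv_op_def clinear_diag_op)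

lemma kab_diag:
  assumes "T \<in> op_algebra kab_gens"
  shows "T (diag_op d a) = diag_op d (T a)"
  using assms
proof (induction arbitrary: a)
  case (op_gen T)
  then show ?case
    by (auto simp: kab_gens_def sigma_op_def sigma_inv_op_def diag_op_commute)
qed (auto simp: clinear_add[OF clinear_diag_op] clinear_scale[OF clinear_diag_op])

lemma kab_commute:
  assumes S: "S \<in> op_algebra kab_gens" and T: "T \<in> op_algebra kab_gens"
  shows "S (T a) = T (S a)"
  using T
proof (induction arbitrary: a)
  case (op_gen T)
  then show ?case
    by (auto simp: kab_gens_def sigma_op_def sigma_inv_op_def kab_diag[OF S])
qed (auto simp: clinear_add[OF op_algebra_linear[OF S clinear_kab_gens]]
    clinear_scale[OF op_algebra_linear[OF S clinear_kab_gens]])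

typedef 'n kn = "op_algebra (kn_gens :: ('n::finite crossed \<Rightarrow> 'n crossed) set)"
  morphisms kn_app Abs_kn
  using op_id by blast

typedef 'n kab = "op_algebra (kab_gens :: ('n::finite crossed \<Rightarrow> 'n crossed) set)"
  morphisms kab_app Abs_kab
  using op_id by blast

setup_lifting type_definition_kn
setup_lifting type_definition_kab

instantiation kn :: (finite) "{complex_space, ring, monoid_mult}"
begin
lift_definition zero_kn :: "'a kn" is "\<lambda>a. 0" by (rule op_zero)
lift_definition one_kn :: "'a kn" is id by (rule op_id)
lift_definition plus_kn :: "'a kn \<Rightarrow> 'a kn \<Rightarrow> 'a kn" is "\<lambda>S T a. S a + T a" by (rule op_add)
lift_definition minus_kn :: "'a kn \<Rightarrow> 'a kn \<Rightarrow> 'a kn" is "\<lambda>S T a. S a - T a" by (rule op_diff)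
lift_definition uminus_kn :: "'a kn \<Rightarrow> 'a kn" is "\<lambda>T a. - T a" by (rule op_neg)
lift_definition scaleC_kn :: "complex \<Rightarrow> 'a kn \<Rightarrow> 'a kn" is "\<lambda>c T a. c *\<^sub>C T a" by (rule op_scale)
lift_definition times_kn :: "'a kn \<Rightarrow> 'a kn \<Rightarrow> 'a kn" is "(\<circ>)" by (rule op_comp)
instance
proof
  fix a b c :: "'a kn"
  show "a * (b + c) = a * b + a * c"
  proof (transfer, rule ext)
    fix a b c :: "'a crossed \<Rightarrow> 'a crossed" and x
    assume "a \<in> op_algebra kn_gens"
    then have "clinear a" by (rule op_algebra_linear) (rule clinear_kn_gens)
    then show "(a \<circ> (\<lambda>x. b x + c x)) x = (a \<circ> b) x + (a \<circ> c) x" by (simp add: clinear_add)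
  qed
qed (transfer, simp add: fun_eq_iff algebra_simps scaleC_add_right scaleC_add_left scaleC_scaleC scaleC_one)+
end

instantiation kab :: (finite) "{complex_space, comm_ring, comm_monoid_mult}"
begin
lift_definition zero_kab :: "'a kab" is "\<lambda>a. 0" by (rule op_zero)
lift_definition one_kab :: "'a kab" is id by (rule op_id)
lift_definition plus_kab :: "'a kab \<Rightarrow> 'a kab \<Rightarrow> 'a kab" is "\<lambda>S T a. S a + T a" by (rule op_add)
lift_definition minus_kab :: "'a kab \<Rightarrow> 'a kab \<Rightarrow> 'a kab" is "\<lambda>S T a. S a - T a" by (rule op_diff)
lift_definition uminus_kab :: "'a kab \<Rightarrow> 'a kab" is "\<lambda>T a. - T a" by (rule op_neg)
lift_definition scaleC_kab :: "complex \<Rightarrow> 'a kab \<Rightarrow> 'a kab" is "\<lambda>c T a. c *\<^sub>C T a" by (rule op_scale)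
lift_definition times_kab :: "'a kab \<Rightarrow> 'a kab \<Rightarrow> 'a kab" is "(\<circ>)" by (rule op_comp)
instance
proof
  fix a b :: "'a kab"
  show "a * b = b * a" by transfer (simp add: fun_eq_iff kab_commute)
qed (transfer, simp add: fun_eq_iff algebra_simps scaleC_add_right scaleC_add_left scaleC_scaleC scaleC_one)+
end

lift_definition kn_X :: "'n \<Rightarrow> 'n::finite kn" is X_op
  by (rule op_gen) (auto simp: kn_gens_def)

lift_definition kab_sigma :: "'n \<Rightarrow> 'n \<Rightarrow> 'n::finite kab" is "\<lambda>i j. sigma_op i [j]"
  by (rule op_gen) (auto simp: kab_gens_def)

text \<open>The Leibniz rule \<open>k (a b) = k\<^sub>1(a) k\<^sub>2(b)\<close> determines the coproduct. The crossed product has no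
  unit; as all operators involved are local, \<open>k(1) = \<epsilon>(k) 1\<close> is expressed on the open sets on which
  a test function is constant 1.\<close>

definition comult_of_action :: "('k \<Rightarrow> 'n::finite crossed \<Rightarrow> 'n crossed) \<Rightarrow> 'k::complex_space \<Rightarrow> ('k, 'k) tensor"
  where "comult_of_action app k = (THE t. \<forall>a b.
    app k (crossed_mult a b) = tensor_lift (\<lambda>k\<^sub>1 k\<^sub>2. crossed_mult (app k\<^sub>1 a) (app k\<^sub>2 b)) t)"

definition counit_of_action :: "('k \<Rightarrow> 'n::finite crossed \<Rightarrow> 'n crossed) \<Rightarrow> 'k \<Rightarrow> complex"
  where "counit_of_action app k = (THE c. \<forall>f W. open W \<and> (\<forall>x\<in>W. test_fun_app f x = 1) \<longrightarrow>
    (\<forall>x\<in>W. \<forall>\<phi>. test_fun_app (Poly_Mapping.lookup (app k (monom f diffeo_id)) \<phi>) x =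
      (if \<phi> = diffeo_id then c else 0)))"

definition Kn :: "'n::finite kn bialgebra_data"
  where "Kn = \<lparr>mult = (*), unit = 1, comult = comult_of_action kn_app, counit = counit_of_action kn_app\<rparr>"

definition Kab :: "'n::finite kab bialgebra_data"
  where "Kab = \<lparr>mult = (*), unit = 1, comult = comult_of_action kab_app, counit = counit_of_action kab_app\<rparr>"

abbreviation FK :: "'n::finite kab bialgebra_data"
  where "FK \<equiv> cop Kab"

definition kab_gamma :: "'n::finite kab \<Rightarrow> 'n diffeo \<Rightarrow> real^'n \<Rightarrow> complex"
  where "kab_gamma f \<psi> =
    (THE h. smooth h \<and> (\<forall>g. kab_app f (monom g \<psi>) = monom (test_fun_smult h g) \<psi>))"

definition kab_antipode :: "'n::finite kab \<Rightarrow> 'n kab"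
  where "kab_antipode f = (THE s. \<forall>g \<psi>. kab_app s (monom g \<psi>) =
    monom (test_fun_smult (kab_gamma f (diffeo_inv \<psi>) \<circ> diffeo_map \<psi>) g) \<psi>)"

text \<open>The operators in \<open>\<K>\<^sub>a\<^sub>b\<close> belong to \<open>\<K>\<^sub>n\<close>, since \<open>\<sigma>\<^sup>i\<^sub>j\<^sub>1\<^sub>\<dots>\<^sub>j\<^sub>r\<^sub>l\<close> is the commutator of
  \<open>X\<^sub>l\<close> and \<open>\<sigma>\<^sup>i\<^sub>j\<^sub>1\<^sub>\<dots>\<^sub>j\<^sub>r\<close>.\<close>

definition kn_of_kab :: "'n::finite kab \<Rightarrow> 'n kn"
  where "kn_of_kab f = Abs_kn (kab_app f)"


section \<open>The bicrossed product\<close>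

typedef 'n vlie = "complex_space.span {kn_X k | k. True} :: 'n::finite kn set"
  morphisms kn_of_V Abs_vlie
  using complex_space.span_zero by blast

setup_lifting type_definition_vlie

instantiation vlie :: (finite) lie_algebra
begin
lift_definition zero_vlie :: "'a vlie" is 0 by (rule complex_space.span_zero)
lift_definition plus_vlie :: "'a vlie \<Rightarrow> 'a vlie \<Rightarrow> 'a vlie" is "(+)" by (rule complex_space.span_add)
lift_definition minus_vlie :: "'a vlie \<Rightarrow> 'a vlie \<Rightarrow> 'a vlie" is "(-)" by (rule complex_space.span_diff)
lift_definition uminus_vlie :: "'a vlie \<Rightarrow> 'a vlie" is uminus by (rule complex_space.span_neg)
lift_definition scaleC_vlie :: "complex \<Rightarrow> 'a vlie \<Rightarrow> 'a vlie" is "(*\<^sub>C)" by (rule complex_space.span_scale)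
definition lie_vlie :: "'a vlie \<Rightarrow> 'a vlie \<Rightarrow> 'a vlie" where "lie_vlie X Y = 0"
instance
  by standard (unfold lie_vlie_def, (transfer, simp add: algebra_simps scaleC_add_right
      scaleC_add_left scaleC_scaleC scaleC_one)+)
end

lift_definition V_X :: "'n \<Rightarrow> 'n::finite vlie" is kn_X
  by (rule complex_space.span_base) auto

type_synonym 'n UV = "'n vlie uea"

definition kn_of_UV :: "'n::finite UV \<Rightarrow> 'n kn"
  where "kn_of_UV u = uea_act (\<lambda>X k. kn_of_V X * k) u 1"

definition V_act :: "'n::finite vlie \<Rightarrow> 'n kab \<Rightarrow> 'n kab"
  where "V_act X f = (THE g. kn_of_kab g = kn_of_V X * kn_of_kab f - kn_of_kab f * kn_of_V X)"

definition UV_act :: "'n::finite UV \<Rightarrow> 'n kab \<Rightarrow> 'n kab"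
  where "UV_act = uea_act V_act"

definition coaction :: "'n::finite UV \<Rightarrow> ('n UV, 'n kab) tensor"
  where "coaction = (THE \<rho>. clinear \<rho> \<and> \<rho> 1 = 1 \<otimes> 1 \<and>
    (\<forall>l. \<rho> (uea_of (V_X l)) = (\<Sum>k\<in>UNIV. uea_of (V_X k) \<otimes> kab_sigma k l)) \<and>
    (\<forall>u v. \<rho> (u * v) =
      tensor_lift (\<lambda>u\<^sub>1 u\<^sub>2. tensor_lift (\<lambda>u\<^sub>1\<^sub>0 u\<^sub>1\<^sub>1. tensor_lift (\<lambda>v\<^sub>0 v\<^sub>1.
        (u\<^sub>1\<^sub>0 * v\<^sub>0) \<otimes> (u\<^sub>1\<^sub>1 * UV_act u\<^sub>2 v\<^sub>1)) (\<rho> v)) (\<rho> u\<^sub>1)) (uea_comult u)))"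

definition bicrossed :: "('n::finite kab, 'n UV) tensor bialgebra_data"
  where "bicrossed = \<lparr>
    mult = (\<lambda>s t. tensor_lift (\<lambda>f u. tensor_lift (\<lambda>g v. tensor_lift (\<lambda>u\<^sub>1 u\<^sub>2.
      (f * UV_act u\<^sub>1 g) \<otimes> (u\<^sub>2 * v)) (uea_comult u)) t) s),
    unit = 1 \<otimes> 1,
    comult = tensor_lift (\<lambda>f u. tensor_lift (\<lambda>f\<^sub>1 f\<^sub>2. tensor_lift (\<lambda>u\<^sub>1 u\<^sub>2. tensor_lift (\<lambda>u\<^sub>1\<^sub>0 u\<^sub>1\<^sub>1.
      (f\<^sub>1 \<otimes> u\<^sub>1\<^sub>0) \<otimes> ((f\<^sub>2 * u\<^sub>1\<^sub>1) \<otimes> u\<^sub>2)) (coaction u\<^sub>1)) (uea_comult u)) (comult FK f)),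
    counit = tensor_lift (\<lambda>f u. counit FK f * uea_counit u)\<rparr>"

definition bicrossed_to_Kn :: "('n::finite kab, 'n UV) tensor \<Rightarrow> 'n kn"
  where "bicrossed_to_Kn = tensor_lift (\<lambda>f u. kn_of_kab f * kn_of_UV u)"

text \<open>On \<open>V\<close> the antipode of \<open>\<K>\<^sub>n\<close> is \<open>u \<mapsto> S\<^sub>F(u\<^sub>1) S\<^sub>U(u\<^sub>0)\<close>, with \<open>u\<^sub>0 \<otimes> u\<^sub>1\<close> the coaction applied to \<open>u\<close>. On all of
  \<open>\<U>(V)\<close> the coaction has to be applied after \<open>S\<^sub>U\<close>, that is, to \<open>S\<^sub>U(u)\<close>; it does not commute with \<open>S\<^sub>U\<close>.
  For \<open>n = 1\<close> the coaction sends \<open>X\<^sup>2\<close> to \<open>X\<^sup>2 \<otimes> \<sigma>\<^sup>2 + X \<otimes> \<sigma>'\<close>, where \<open>\<sigma>' = [X, \<sigma>]\<close> and \<open>S\<^sub>F(\<sigma>') = - \<sigma>'/\<sigma>\<^sup>3\<close>.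
  Applying \<open>S\<^sub>U\<close> last gives \<open>\<sigma>\<^sup>-\<^sup>2 X\<^sup>2 + (\<sigma>'/\<sigma>\<^sup>3) X\<close>, whereas
  \<open>S(X)\<^sup>2 = (\<sigma>\<^sup>-\<^sup>1 X)\<^sup>2 = \<sigma>\<^sup>-\<^sup>2 X\<^sup>2 - (\<sigma>'/\<sigma>\<^sup>3) X\<close>.\<close>

end

theory Submission
  imports Defs
begin

text \<open>
  Operators are recognised by testing them. An operator \<open>k\<close> of \<open>\<K>\<^sub>n\<close> maps each component \<open>C\<^sub>c\<^sup>\<infinity> U*\<^sub>\<phi>\<close> of the
  crossed product to itself, is local, commutes with translations, and does not notice a translation
  composed to \<open>\<phi>\<close> from the left. So the functionals \<open>k \<mapsto> k(f U*\<^sub>\<phi>)(x)\<close> separate \<open>\<K>\<^sub>n\<close>; and since \<open>\<phi>\<close> may be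
  translated until \<open>\<phi>(x) = y\<close>, the Leibniz rule says that the product of the functionals at \<open>(\<phi>, x, f)\<close> and
  \<open>(\<psi>, y, g)\<close>, evaluated on the coproduct of \<open>k\<close>, is the functional at their composition
  (\<open>leibniz_eval_at\<close>). Separation makes the coproduct unique. The composition is associative and has a unit
  up to the values of the functionals, and this gives coassociativity and the counit law, for \<open>\<K>\<^sub>n\<close> and
  for \<open>\<K>\<^sub>n\<^sup>c\<^sup>o\<^sup>p\<close> alike (\<open>coalgebra_if_separating\<close>).

  The map \<open>\<I>\<close> is multiplicative because \<open>u f = (u\<^sub>1 \<triangleright> f) u\<^sub>2\<close> in \<open>\<K>\<^sub>n\<close>; it respects coproducts because the
  coaction and the coproduct of \<open>\<K>\<^sub>n\<close> satisfy the same recursion under \<open>u \<mapsto> X\<^sub>l u\<close>. It is surjective since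
  its image is a subalgebra that contains the generators. It is injective since the value at \<open>x\<close> of \<open>f u\<close>
  applied to \<open>g U*\<^sub>\<phi>\<close> is \<open>\<gamma>(f)(\<phi>)(x) \<cdot> (u g)(x)\<close>, where \<open>g\<close> may have any jet at \<open>x\<close>
  (\<open>inj_bicrossed_to_Kn\<close>); smooth bump functions are needed here. All axioms of the bicrossed product are
  then inherited from \<open>\<K>\<^sub>n\<^sup>c\<^sup>o\<^sup>p\<close>.

  The antipode is a composition of two simple maps. Conjugation with the involution
  \<open>(f U*\<^sub>\<phi>)\<^sup># = (f \<circ> \<phi>\<^sup>-\<^sup>1) U*\<^bsub>\<phi>\<^sup>-\<^sup>1\<^esub>\<close> of the crossed product is an algebra automorphism \<open>k \<mapsto> k\<^sup>#\<close> of \<open>\<K>\<^sub>n\<close> which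
  restricts to the antipode of \<open>\<K>\<^sub>a\<^sub>b\<close> and sends \<open>X\<^sub>l\<close> to \<open>S(\<sigma>\<^sup>k\<^sub>l) X\<^sub>k\<close> by the chain rule. Formal transposition
  \<open>\<theta>(f u) = S\<^sub>\<U>(u) f\<close> is an anti-automorphism, well defined because \<open>\<I>\<close> is bijective. The anti-automorphism
  \<open>S(k) = \<theta>(k)\<^sup>#\<close> satisfies the antipode identities on generators, where they say that the matrices
  \<open>\<sigma>\<^sup>i\<^sub>j\<close> and \<open>S(\<sigma>\<^sup>i\<^sub>j)\<close> are inverse to each other, hence everywhere (\<open>antipode_left_mult\<close>,
  \<open>antipode_right_mult\<close>). The recursion of the coaction turns \<open>v\<^sup>#\<close> into \<open>S(v\<^sub>1) v\<^sub>0\<close> for \<open>v \<in> \<U>(V)\<close>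
  (\<open>kn_sharp_of_UV\<close>), which is the formula for the antipode on \<open>\<U>(V)\<close>. The inverse
  \<open>k \<mapsto> \<theta>(k\<^sup>#)\<close> of \<open>S\<close> is the antipode of \<open>\<K>\<^sub>n\<^sup>c\<^sup>o\<^sup>p\<close>.\<close>

section \<open>Linear maps and tensor products\<close>

named_theorems clinear_intros

lemma clinear_id' [clinear_intros]: "clinear (\<lambda>x. x)"
  by (rule clinearI) auto

lemma clinear_zero [clinear_intros]: "clinear (\<lambda>x. 0)"
  by (rule clinearI) auto

lemma clinear_plus [clinear_intros]:
  "clinear f \<Longrightarrow> clinear g \<Longrightarrow> clinear (\<lambda>x. f x + g x)"
  by (rule clinearI) (auto simp: clinear_add clinear_scale scaleC_add_right)

lemma clinear_minus [clinear_intros]: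
  "clinear f \<Longrightarrow> clinear g \<Longrightarrow> clinear (\<lambda>x. f x - g x)"
  by (rule clinearI)
    (auto simp: clinear_add clinear_scale complex_space.scale_right_diff_distrib)

lemma clinear_uminus [clinear_intros]: "clinear f \<Longrightarrow> clinear (\<lambda>x. - f x)"
  by (rule clinearI) (auto simp: clinear_add clinear_scale)

lemma clinear_scaleC [clinear_intros]: "clinear f \<Longrightarrow> clinear (\<lambda>x. c *\<^sub>C f x)"
  by (rule clinearI)
    (auto simp: clinear_add clinear_scale scaleC_add_right scaleC_scaleC mult.commute)

lemma clinear_scaleC_left [clinear_intros]: "clinear f \<Longrightarrow> clinear (\<lambda>x. f x *\<^sub>C y)"
  by (rule clinearI)
    (auto simp: clinear_add clinear_scale scaleC_add_left scaleC_scaleC scaleC_complex_def)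

lemma clinear_sum [clinear_intros]:
  "(\<And>i. i \<in> I \<Longrightarrow> clinear (f i)) \<Longrightarrow> clinear (\<lambda>x. \<Sum>i\<in>I. f i x)"
  by (rule clinearI)
    (auto simp: clinear_add clinear_scale sum.distrib complex_space.scale_sum_right)

lemma clinear_compose: "clinear f \<Longrightarrow> clinear g \<Longrightarrow> clinear (\<lambda>x. f (g x))"
  by (rule clinearI) (auto simp: clinear_add clinear_scale)

lemma clinear_0: "clinear f \<Longrightarrow> f 0 = 0"
  using clinear_scale[of f 0 0] by simp

lemma clinear_diff: "clinear f \<Longrightarrow> f (x - y) = f x - f y"
  using clinear_add[of f "x - y" y] by (simp add: algebra_simps)

lemma clinear_neg: "clinear f \<Longrightarrow> f (- x) = - f x"
  using clinear_diff[of f 0 x] by (simp add: clinear_0)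

lemma clinear_setsum: "clinear f \<Longrightarrow> f (\<Sum>i\<in>I. g i) = (\<Sum>i\<in>I. f (g i))"
  by (induction I rule: infinite_finite_induct) (auto simp: clinear_0 clinear_add)

text \<open>A map on \<open>\<Rightarrow>\<^sub>0 complex\<close> given on the basis of one-point families; tensor products and
  enveloping algebras are both quotients of such free spaces.\<close>

definition free_lift :: "('k \<Rightarrow> 'v::complex_space) \<Rightarrow> ('k \<Rightarrow>\<^sub>0 complex) \<Rightarrow> 'v"
  where "free_lift g p = (\<Sum>k\<in>Poly_Mapping.keys p. Poly_Mapping.lookup p k *\<^sub>C g k)"

lemma free_lift_superset:
  assumes "finite A" "Poly_Mapping.keys p \<subseteq> A"
  shows "free_lift g p = (\<Sum>k\<in>A. Poly_Mapping.lookup p k *\<^sub>C g k)"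
  unfolding free_lift_def using assms
  by (intro sum.mono_neutral_left) (auto simp: in_keys_iff)

lemma free_lift_single: "free_lift g (Poly_Mapping.single k c) = c *\<^sub>C g k"
  by (subst free_lift_superset[where A = "{k}"]) (auto simp: lookup_single)

lemma clinear_free_lift: "clinear (free_lift g)"
proof (rule clinearI)
  fix p q :: "'a \<Rightarrow>\<^sub>0 complex" and c :: complex
  let ?A = "Poly_Mapping.keys p \<union> Poly_Mapping.keys q"
  have "Poly_Mapping.keys (p + q) \<subseteq> ?A" by (rule keys_add)
  then show "free_lift g (p + q) = free_lift g p + free_lift g q"
    by (subst (1 2 3) free_lift_superset[where A = ?A])
       (auto simp: lookup_add scaleC_add_left sum.distrib)
  have "Poly_Mapping.keys (c *\<^sub>C p) \<subseteq> Poly_Mapping.keys p"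
    by (auto simp: in_keys_iff lookup_scaleC)
  then show "free_lift g (c *\<^sub>C p) = c *\<^sub>C free_lift g p"
    by (subst (1 2) free_lift_superset[where A = "Poly_Mapping.keys p"])
       (auto simp: lookup_scaleC scaleC_scaleC complex_space.scale_sum_right scaleC_complex_def)
qed

lemma clinear_vanish_span:
  assumes "clinear f" "\<And>x. x \<in> S \<Longrightarrow> f x = 0" "p \<in> complex_space.span S"
  shows "f p = 0"
proof -
  have "complex_space.subspace {x. f x = 0}"
    using assms(1) by (auto simp: complex_space.subspace_def clinear_0 clinear_add clinear_scale)
  then show ?thesis
    using complex_space.span_induct[OF assms(3)] assms(2) by blast
qed

lemma free_poly_mapping_induct [case_names add scale single]:
  fixes p :: "'k \<Rightarrow>\<^sub>0 complex"
  assumes add: "\<And>p q. P p \<Longrightarrow> P q \<Longrightarrow> P (p + q)"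
    and scale: "\<And>c p. P p \<Longrightarrow> P (c *\<^sub>C p)"
    and single: "\<And>k. P (Poly_Mapping.single k 1)"
  shows "P p"
proof -
  have z: "P 0" using scale[OF single, of 0] by simp
  have s: "P (\<Sum>k\<in>I. f k)" if "\<And>k. P (f k)" for I and f :: "'k \<Rightarrow> 'k \<Rightarrow>\<^sub>0 complex"
    by (induction I rule: infinite_finite_induct) (auto simp: z add that)
  have sc: "Poly_Mapping.single k c = c *\<^sub>C Poly_Mapping.single k 1" for k :: 'k and c
    by (rule poly_mapping_eqI) (simp add: lookup_single lookup_scaleC scaleC_complex_def when_def)
  have p: "p = (\<Sum>k\<in>Poly_Mapping.keys p. Poly_Mapping.single k (Poly_Mapping.lookup p k))"
    by (rule poly_mapping_eqI)
      (auto simp: lookup_sum lookup_single when_def not_in_keys_iff_lookup_eq_zero)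
  have "P (Poly_Mapping.single k c)" for k c by (subst sc) (intro scale single)
  then have "P (\<Sum>k\<in>Poly_Mapping.keys p. Poly_Mapping.single k (Poly_Mapping.lookup p k))"
    by (rule s)
  with p show ?thesis by simp
qed

lemma tensor_eq_abs_rep: "tensor_eq (rep_tensor (abs_tensor p)) p"
  by (metis Quotient_abs_rep[OF Quotient_tensor] tensor.abs_eq_iff)

lemma tensor_add_left: "(x + x') \<otimes> y = x \<otimes> y + x' \<otimes> y"
  by transfer
    (unfold tensor_eq_def tensor_rels_def diff_diff_eq[symmetric],
      rule complex_space.span_base, blast)

lemma tensor_add_right: "x \<otimes> (y + y') = x \<otimes> y + x \<otimes> y'"
  by transfer
    (unfold tensor_eq_def tensor_rels_def diff_diff_eq[symmetric],
      rule complex_space.span_base, blast)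

lemma tensor_scale_left: "(c *\<^sub>C x) \<otimes> y = c *\<^sub>C (x \<otimes> y)"
  by transfer (unfold tensor_eq_def tensor_rels_def, rule complex_space.span_base, blast)

lemma tensor_scale_right: "x \<otimes> (c *\<^sub>C y) = c *\<^sub>C (x \<otimes> y)"
  by transfer (unfold tensor_eq_def tensor_rels_def, rule complex_space.span_base, blast)

lemma clinear_tensor_left [clinear_intros]: "clinear f \<Longrightarrow> clinear (\<lambda>x. f x \<otimes> y)"
  by (rule clinearI) (auto simp: clinear_add clinear_scale tensor_add_left tensor_scale_left)

lemma clinear_tensor_right [clinear_intros]: "clinear f \<Longrightarrow> clinear (\<lambda>x. y \<otimes> f x)"
  by (rule clinearI) (auto simp: clinear_add clinear_scale tensor_add_right tensor_scale_right)

text \<open>Scalars can be absorbed into the left factor, so sums of pure tensors are enough.\<close>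

lemma tensor_induct [case_names pure add, induct type: tensor]:
  fixes t :: "('a::complex_space, 'b::complex_space) tensor"
  assumes pure: "\<And>x y. P (x \<otimes> y)" and add: "\<And>s t. P s \<Longrightarrow> P t \<Longrightarrow> P (s + t)"
  shows "P t"
proof -
  have "\<forall>c. P (c *\<^sub>C abs_tensor p)" for p :: "'a \<times> 'b \<Rightarrow>\<^sub>0 complex"
  proof (induction p rule: free_poly_mapping_induct)
    case (add p q)
    then show ?case
      by (simp add: plus_tensor.abs_eq[symmetric] scaleC_add_right assms(2))
  next
    case (scale c p)
    then show ?case by (simp add: scaleC_tensor.abs_eq[symmetric] scaleC_scaleC)
  next
    case (single k)
    obtain x y where k: "k = (x, y)" by (cases k)
    have "abs_tensor (Poly_Mapping.single k 1) = x \<otimes> y"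
      by (simp add: k tensor.abs_eq)
    then show ?case by (metis pure tensor_scale_left)
  qed
  then show ?thesis by (metis Quotient_abs_rep[OF Quotient_tensor] scaleC_one)
qed

text \<open>For bilinear \<open>h\<close> the sum in \<open>tensor_lift\<close> vanishes on the relations, so it can be evaluated on any
  representative.\<close>

lemma tensor_lift_abs:
  assumes "\<And>x. clinear (h x)" "\<And>y. clinear (\<lambda>x. h x y)"
  shows "tensor_lift h (abs_tensor p) = free_lift (\<lambda>k. h (fst k) (snd k)) p"
proof -
  let ?F = "free_lift (\<lambda>k. h (fst k) (snd k))"
  have lift: "tensor_lift h t = ?F (rep_tensor t)" for t
    by (simp add: tensor_lift_def free_lift_def)
  have "?F r = 0" if "r \<in> tensor_rels" for r
    using that unfolding tensor_rels_def
    by (auto simp: clinear_diff[OF clinear_free_lift] clinear_scale[OF clinear_free_lift]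
        free_lift_single scaleC_one clinear_add[OF assms(1)] clinear_add[OF assms(2)]
        clinear_scale[OF assms(1)] clinear_scale[OF assms(2)])
  then have "?F (rep_tensor (abs_tensor p) - p) = 0"
    using clinear_vanish_span[OF clinear_free_lift] tensor_eq_abs_rep[unfolded tensor_eq_def]
    by blast
  then show ?thesis by (simp add: lift clinear_diff[OF clinear_free_lift])
qed

lemma clinear_tensor_lift:
  assumes "\<And>x. clinear (h x)" "\<And>y. clinear (\<lambda>x. h x y)"
  shows "clinear (tensor_lift h)"
proof (rule clinearI)
  fix s t :: "('a, 'b) tensor" and c
  obtain p q where s: "s = abs_tensor p" and t: "t = abs_tensor q"
    by (metis Quotient_abs_rep[OF Quotient_tensor])
  show "tensor_lift h (s + t) = tensor_lift h s + tensor_lift h t"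
    by (simp add: s t plus_tensor.abs_eq tensor_lift_abs[OF assms] clinear_add[OF clinear_free_lift])
  show "tensor_lift h (c *\<^sub>C s) = c *\<^sub>C tensor_lift h s"
    by (simp add: s scaleC_tensor.abs_eq tensor_lift_abs[OF assms] clinear_scale[OF clinear_free_lift])
qed

lemma tensor_lift_pure:
  assumes "\<And>x. clinear (h x)" "\<And>y. clinear (\<lambda>x. h x y)"
  shows "tensor_lift h (x \<otimes> y) = h x y"
  by (simp add: tensor.abs_eq tensor_lift_abs[OF assms] free_lift_single scaleC_one)

lemma clinear_lift [clinear_intros]:
  assumes "clinear f" "\<And>x. clinear (\<lambda>y. h x y)" "\<And>y. clinear (\<lambda>x. h x y)"
  shows "clinear (\<lambda>z. tensor_lift h (f z))"
  by (rule clinear_compose[OF clinear_tensor_lift assms(1)]) (use assms in auto)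

text \<open>Since \<open>tensor_lift\<close> evaluates on a representative that does not depend on the parameter, only
  linearity of \<open>h\<close> in the parameter matters here.\<close>

lemma clinear_lift_param [clinear_intros]:
  assumes "\<And>x y. clinear (\<lambda>z. h z x y)"
  shows "clinear (\<lambda>z. tensor_lift (\<lambda>x y. h z x y) t)"
  unfolding tensor_lift_def by (intro clinear_sum clinear_scaleC assms)

lemma tensor_ext:
  assumes "clinear f" "clinear g" "\<And>x y. f (x \<otimes> y) = g (x \<otimes> y)"
  shows "f = g"
proof
  show "f t = g t" for t
    by (induction t) (auto simp: assms(3) clinear_add[OF assms(1)] clinear_add[OF assms(2)])
qed

lemma tensor_eqI:
  "clinear f \<Longrightarrow> clinear g \<Longrightarrow> (\<And>x y. f (x \<otimes> y) = g (x \<otimes> y)) \<Longrightarrow> f t = g t"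
  using tensor_ext[of f g] by simp

lemma tensor_lift_cong: "(\<And>x y. h x y = h' x y) \<Longrightarrow> tensor_lift h t = tensor_lift h' t"
  by (simp add: tensor_lift_def)

lemma clinear_tensor_lift_apply:
  assumes "clinear f" "\<And>x. clinear (\<lambda>y. h x y)" "\<And>y. clinear (\<lambda>x. h x y)"
  shows "f (tensor_lift h t) = tensor_lift (\<lambda>x y. f (h x y)) t"
  using assms(1) by (simp add: tensor_lift_def clinear_setsum clinear_scale)

lemma clinear_tensor_map [clinear_intros]:
  "clinear f \<Longrightarrow> clinear g \<Longrightarrow> clinear k \<Longrightarrow> clinear (\<lambda>z. tensor_map f g (k z))"
  unfolding tensor_map_def by (intro clinear_intros)

lemma tensor_map_pure: "clinear f \<Longrightarrow> clinear g \<Longrightarrow> tensor_map f g (x \<otimes> y) = f x \<otimes> g y"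
  unfolding tensor_map_def by (subst tensor_lift_pure) (auto intro: clinear_intros)

lemma clinear_tensor_flip [clinear_intros]: "clinear k \<Longrightarrow> clinear (\<lambda>z. tensor_flip (k z))"
  unfolding tensor_flip_def by (intro clinear_intros)

lemma tensor_flip_pure [simp]: "tensor_flip (x \<otimes> y) = y \<otimes> x"
  unfolding tensor_flip_def by (subst tensor_lift_pure) (auto intro: clinear_intros)

lemma clinear_tensor_assoc [clinear_intros]: "clinear k \<Longrightarrow> clinear (\<lambda>z. tensor_assoc (k z))"
  unfolding tensor_assoc_def by (intro clinear_intros)

lemma tensor_assoc_pure [simp]: "tensor_assoc ((x \<otimes> y) \<otimes> z) = x \<otimes> (y \<otimes> z)"
  unfolding tensor_assoc_def
  by (simp add: tensor_lift_pure clinear_intros)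

text \<open>A tensor is a finite sum \<open>\<Sum> x\<^sub>b \<otimes> b\<close> over elements \<open>b\<close> of a basis of the right factor. So once
  functionals on the right factor vanish on it, linear independence makes all \<open>L(x\<^sub>b)\<close> vanish.\<close>

lemma tensor_basis_expansion:
  fixes t :: "('a::complex_space, 'b::complex_space) tensor"
  assumes "complex_space.span B = (UNIV :: 'b set)"
  shows "\<exists>S x. finite S \<and> S \<subseteq> B \<and> t = (\<Sum>b\<in>S. x b \<otimes> b)"
proof (induction t)
  case (pure x y)
  from assms have "y \<in> complex_space.span B" by simp
  then obtain S r where S: "finite S" "S \<subseteq> B" "y = (\<Sum>b\<in>S. r b *\<^sub>C b)"
    unfolding complex_space.span_explicit by blast
  have "x \<otimes> y = (\<Sum>b\<in>S. (r b *\<^sub>C x) \<otimes> b)"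
    unfolding S(3) by (simp add: clinear_setsum[OF clinear_tensor_right[OF clinear_id']]
        tensor_scale_left tensor_scale_right)
  with S show ?case by (intro exI[of _ S] exI[of _ "\<lambda>b. r b *\<^sub>C x"]) simp
next
  case (add s t)
  then obtain S x T y where S: "finite S" "S \<subseteq> B" "s = (\<Sum>b\<in>S. x b \<otimes> b)"
    and T: "finite T" "T \<subseteq> B" "t = (\<Sum>b\<in>T. y b \<otimes> b)" by blast
  let ?x = "\<lambda>b. if b \<in> S then x b else 0" and ?y = "\<lambda>b. if b \<in> T then y b else 0"
  have z: "(0::'a) \<otimes> b = 0" for b :: 'b using tensor_scale_left[of 0 0 b] by simp
  have "s = (\<Sum>b\<in>S \<union> T. ?x b \<otimes> b)" "t = (\<Sum>b\<in>S \<union> T. ?y b \<otimes> b)"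
    unfolding S(3) T(3) using S T by (auto intro!: sum.mono_neutral_cong_left simp: z)
  then have "s + t = (\<Sum>b\<in>S \<union> T. (?x b + ?y b) \<otimes> b)"
    by (simp only: tensor_add_left sum.distrib)
  with S T show ?case
    by (intro exI[of _ "S \<union> T"] exI[of _ "\<lambda>b. ?x b + ?y b"]) simp
qed

definition separating :: "('p \<Rightarrow> 'v::complex_space \<Rightarrow> complex) \<Rightarrow> bool"
  where "separating L \<longleftrightarrow> (\<forall>p. clinear (L p)) \<and> (\<forall>v. (\<forall>p. L p v = 0) \<longrightarrow> v = 0)"

definition tensor_functional ::
    "('v::complex_space \<Rightarrow> complex) \<Rightarrow> ('w::complex_space \<Rightarrow> complex) \<Rightarrow> ('v, 'w) tensor \<Rightarrow> complex"
  where "tensor_functional l m = tensor_lift (\<lambda>x y. l x *\<^sub>C m y)"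

lemma clinear_tensor_functional:
  "clinear l \<Longrightarrow> clinear m \<Longrightarrow> clinear (tensor_functional l m)"
  unfolding tensor_functional_def
  by (rule clinear_tensor_lift) (auto intro: clinear_intros)

lemma tensor_functional_pure:
  "clinear l \<Longrightarrow> clinear m \<Longrightarrow> tensor_functional l m (x \<otimes> y) = l x * m y"
  unfolding tensor_functional_def
  by (subst tensor_lift_pure) (intro clinear_intros | simp add: scaleC_complex_def)+

lemma separating_tensor_vanish:
  fixes L :: "'p \<Rightarrow> 'v::complex_space \<Rightarrow> complex" and M :: "'q \<Rightarrow> 'w::complex_space \<Rightarrow> complex"
  assumes L: "separating L" and M: "separating M"
    and 0: "\<And>p q. tensor_functional (L p) (M q) t = 0"
  shows "t = 0"
proof -
  have lin: "clinear (L p)" "clinear (M q)" for p q using L M by (auto simp: separating_def)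
  obtain B :: "'w set" where B: "complex_space.independent B" "UNIV \<subseteq> complex_space.span B"
    using complex_space.maximal_independent_subset[of UNIV] by metis
  then obtain S x where S: "finite S" "S \<subseteq> B" "t = (\<Sum>b\<in>S. x b \<otimes> b)"
    using tensor_basis_expansion[of B t] by blast
  have "L p (x b) = 0" if b: "b \<in> S" for p b
  proof -
    have "M q (\<Sum>b\<in>S. L p (x b) *\<^sub>C b) = 0" for q
      using 0[of p q] unfolding S(3)
      by (simp add: clinear_setsum lin clinear_tensor_functional tensor_functional_pure
          clinear_scale scaleC_complex_def)
    then have "(\<Sum>b\<in>S. L p (x b) *\<^sub>C b) = 0" using M by (auto simp: separating_def)
    from complex_space.independentD[OF B(1) S(1,2) this b] show ?thesis .
  qed
  then have "x b = 0" if "b \<in> S" for b using L that by (auto simp: separating_def)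
  moreover have "(0::'v) \<otimes> b = 0" for b :: 'w using tensor_scale_left[of 0 0 b] by simp
  ultimately show ?thesis by (simp add: S(3))
qed

lemma separating_tensor:
  assumes "separating L" "separating M"
  shows "separating (\<lambda>(p, q). tensor_functional (L p) (M q))"
  using assms separating_tensor_vanish[OF assms]
  by (auto simp: separating_def intro: clinear_tensor_functional)

lemma separating_eqI: "separating L \<Longrightarrow> (\<And>p. L p x = L p y) \<Longrightarrow> x = y"
  unfolding separating_def by (metis clinear_diff eq_iff_diff_eq_0)


section \<open>Algebras and their tensor products\<close>

class complex_algebra = complex_space + ring +
  assumes mult_scaleC_left: "(c *\<^sub>C x) * y = c *\<^sub>C (x * y)"
    and mult_scaleC_right: "x * (c *\<^sub>C y) = c *\<^sub>C (x * y)"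

instance complex :: complex_algebra
  by standard (auto simp: scaleC_complex_def)

lemma clinear_mult_left [clinear_intros]:
  "clinear f \<Longrightarrow> clinear (\<lambda>x. f x * y)" for y :: "'a::complex_algebra"
  by (rule clinearI) (auto simp: clinear_add clinear_scale distrib_right mult_scaleC_left)

lemma clinear_mult_right [clinear_intros]:
  "clinear f \<Longrightarrow> clinear (\<lambda>x. y * f x)" for y :: "'a::complex_algebra"
  by (rule clinearI) (auto simp: clinear_add clinear_scale distrib_left mult_scaleC_right)

instantiation tensor :: (complex_algebra, complex_algebra) complex_algebra
begin

definition times_tensor :: "('a, 'b) tensor \<Rightarrow> ('a, 'b) tensor \<Rightarrow> ('a, 'b) tensor"
  where "times_tensor = tensor_mult (*) (*)"

lemma clinear_times_tensor: "clinear ((*) s)" "clinear (\<lambda>s. s * t)" for s t :: "('a, 'b) tensor"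
  unfolding times_tensor_def tensor_mult_def by (intro clinear_intros)+

lemma times_tensor_pure [simp]: "(x \<otimes> y) * (x' \<otimes> y') = (x * x') \<otimes> (y * y')"
  for x x' :: 'a and y y' :: 'b
  unfolding times_tensor_def tensor_mult_def
  by (simp add: tensor_lift_pure clinear_intros)

instance
proof
  fix r s t :: "('a, 'b) tensor" and c
  note [simp] = clinear_add[OF clinear_times_tensor(1)] clinear_add[OF clinear_times_tensor(2)]
    clinear_scale[OF clinear_times_tensor(1)] clinear_scale[OF clinear_times_tensor(2)]
  show "(r + s) * t = r * t + s * t" "r * (s + t) = r * s + r * t" by simp_all
  show "(c *\<^sub>C s) * t = c *\<^sub>C (s * t)" "s * (c *\<^sub>C t) = c *\<^sub>C (s * t)" by simp_all
  show "r * s * t = r * (s * t)"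
  proof (induction r)
    case (pure x y)
    show ?case
    proof (induction s)
      case (pure x' y')
      show ?case by (induction t) (simp_all add: mult.assoc)
    qed simp
  qed simp
qed
end

instantiation tensor :: ("{complex_algebra, monoid_mult}", "{complex_algebra, monoid_mult}") monoid_mult
begin
definition one_tensor :: "('a, 'b) tensor" where "one_tensor = 1 \<otimes> 1"
instance
proof
  fix t :: "('a, 'b) tensor"
  show "1 * t = t" by (induction t) (simp_all add: one_tensor_def distrib_left)
  show "t * 1 = t" by (induction t) (simp_all add: one_tensor_def distrib_right)
qed
end

lemma tensor_flip_mult: "tensor_flip (s * t) = tensor_flip s * tensor_flip t"
  for s t :: "('a::complex_algebra, 'b::complex_algebra) tensor"
proof (induction s)
  case (pure x y)
  show ?case
    by (induction t) (simp_all add: clinear_add[OF clinear_tensor_flip[OF clinear_id']] distrib_left)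
qed (simp add: clinear_add[OF clinear_tensor_flip[OF clinear_id']] distrib_right)


section \<open>Representations of enveloping algebras\<close>

definition lie_rep :: "('a::lie_algebra \<Rightarrow> 'm::complex_space \<Rightarrow> 'm) \<Rightarrow> bool"
  where "lie_rep h \<longleftrightarrow> (\<forall>x. clinear (h x)) \<and> (\<forall>m. clinear (\<lambda>x. h x m)) \<and>
    (\<forall>x y m. h (lie x y) m = h x (h y m) - h y (h x m))"

lemma single_list_times: "Poly_Mapping.single v (1::complex) * Poly_Mapping.single w 1 = Poly_Mapping.single (v @ w) 1"
  by (simp add: mult_single plus_list_def)

lemma clinear_free_algebra_mult:
  "clinear (\<lambda>p. p * q)" "clinear (\<lambda>q. p * q)" for p q :: "'a::monoid_add \<Rightarrow>\<^sub>0 complex"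
proof -
  have "p * (c *\<^sub>C q) = c *\<^sub>C (p * q)" for c and q :: "'a \<Rightarrow>\<^sub>0 complex"
    unfolding scaleC_eq_times by (metis mult.assoc single_0_commute)
  moreover have "(c *\<^sub>C p) * q = c *\<^sub>C (p * q)" for c and p q :: "'a \<Rightarrow>\<^sub>0 complex"
    unfolding scaleC_eq_times by (rule mult.assoc)
  ultimately show "clinear (\<lambda>p. p * q)" "clinear (\<lambda>q. p * q)"
    by (intro clinearI; simp add: distrib_left distrib_right)+
qed

lemma clinear_foldr: "(\<And>x. clinear (h x)) \<Longrightarrow> clinear (foldr h w)"
  by (induction w) (auto intro: clinearI simp: clinear_add clinear_scale)

lemma free_lift_foldr_mult:
  assumes "\<And>x. clinear (h x)"
  shows "free_lift (\<lambda>w. foldr h w m) (p * q) = free_lift (\<lambda>w. foldr h w (free_lift (\<lambda>w. foldr h w m) q)) p"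
proof (induction p rule: free_poly_mapping_induct)
  case (add p p')
  then show ?case by (simp add: distrib_right clinear_add[OF clinear_free_lift])
next
  case (scale c p)
  then show ?case
    by (simp add: clinear_scale[OF clinear_free_algebra_mult(1)] clinear_scale[OF clinear_free_lift])
next
  case (single v)
  show ?case
  proof (induction q rule: free_poly_mapping_induct)
    case (add p q)
    then show ?case
      by (simp add: distrib_left clinear_add[OF clinear_free_lift] free_lift_single scaleC_one
          clinear_add[OF clinear_foldr[OF assms]])
  next
    case (scale c p)
    then show ?case
      by (simp add: clinear_scale[OF clinear_free_algebra_mult(2)] clinear_scale[OF clinear_free_lift]
          free_lift_single scaleC_one clinear_scale[OF clinear_foldr[OF assms]])
  next
    case (single w)
    then show ?case by (simp add: single_list_times free_lift_single scaleC_one)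
  qed
qed

text \<open>Words act by composition; so a representation, which respects the defining relations, also kills
  a relation placed between two words.\<close>

lemma free_lift_uea_ideal:
  assumes h: "lie_rep h" and p: "p \<in> uea_ideal"
  shows "free_lift (\<lambda>w. foldr h w m) p = 0"
proof -
  have lin: "clinear (h x)" "clinear (\<lambda>x. h x m)" for x m using h by (auto simp: lie_rep_def)
  have lt: "free_lift (\<lambda>w. foldr h w m) (letter x) = h x m" for x m
    by (simp add: letter_def free_lift_single scaleC_one)
  have rel: "free_lift (\<lambda>w. foldr h w m) r = 0" if "r \<in> uea_rels" for r m
    using that h unfolding uea_rels_def lie_rep_def
    by (auto simp: clinear_diff[OF clinear_free_lift] clinear_scale[OF clinear_free_lift] lt
        free_lift_foldr_mult lin clinear_add[OF lin(2)] clinear_scale[OF lin(2)])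
  have "free_lift (\<lambda>w. foldr h w m) r = 0" if "r \<in> {p * r * q |p r q. r \<in> uea_rels}" for r
  proof -
    from that obtain p r' q where r: "r = p * (r' * q)" "r' \<in> uea_rels" by (auto simp: mult.assoc)
    have "free_lift (\<lambda>w. foldr h w 0) p = 0"
      by (simp add: free_lift_def clinear_0[OF clinear_foldr[OF lin(1)]])
    then show ?thesis by (simp add: r free_lift_foldr_mult lin rel)
  qed
  from clinear_vanish_span[OF clinear_free_lift this p[unfolded uea_ideal_def]] show ?thesis .
qed

lemma uea_act_abs:
  assumes "lie_rep h"
  shows "uea_act h (abs_uea p) m = free_lift (\<lambda>w. foldr h w m) p"
proof -
  have "uea_eq (rep_uea (abs_uea p)) p"
    by (metis Quotient_abs_rep[OF Quotient_uea] uea.abs_eq_iff)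
  then have "free_lift (\<lambda>w. foldr h w m) (rep_uea (abs_uea p) - p) = 0"
    unfolding uea_eq_def by (rule free_lift_uea_ideal[OF assms])
  then show ?thesis
    by (simp add: uea_act_def clinear_diff[OF clinear_free_lift]) (simp add: free_lift_def)
qed

lemma abs_uea_cases: obtains p where "u = abs_uea p"
  by (metis Quotient_abs_rep[OF Quotient_uea])

lemma lie_rep_clinear: "lie_rep h \<Longrightarrow> clinear (h x)"
  by (simp add: lie_rep_def)

lemma uea_act_clinear_left: "lie_rep h \<Longrightarrow> clinear (\<lambda>u. uea_act h u m)"
proof (rule clinearI)
  fix u v :: "'a uea" and c assume h: "lie_rep h"
  obtain p q where "u = abs_uea p" "v = abs_uea q" by (meson abs_uea_cases)
  then show "uea_act h (u + v) m = uea_act h u m + uea_act h v m"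
    "uea_act h (c *\<^sub>C u) m = c *\<^sub>C uea_act h u m"
    using clinear_add[OF clinear_free_lift] clinear_scale[OF clinear_free_lift]
    by (auto simp: uea_act_abs[OF h] plus_uea.abs_eq scaleC_uea.abs_eq)
qed

lemma uea_act_clinear_right: "lie_rep h \<Longrightarrow> clinear (uea_act h u)"
  unfolding uea_act_def by (intro clinear_sum clinear_scaleC clinear_foldr lie_rep_clinear)

lemma uea_act_mult: "lie_rep h \<Longrightarrow> uea_act h (u * v) m = uea_act h u (uea_act h v m)"
  by (cases u rule: abs_uea_cases, cases v rule: abs_uea_cases)
    (simp add: times_uea.abs_eq uea_act_abs free_lift_foldr_mult lie_rep_clinear)

lemma uea_act_one: "lie_rep h \<Longrightarrow> uea_act h 1 m = m"
  by (simp add: one_uea.abs_eq uea_act_abs zero_list_def free_lift_single scaleC_one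
      flip: single_one)

lemma uea_act_of: "lie_rep h \<Longrightarrow> uea_act h (uea_of x) m = h x m"
  by (simp add: uea_of.abs_eq uea_act_abs letter_def free_lift_single scaleC_one)

lemma uea_induct [case_names one add scale mult, induct type: uea]:
  fixes u :: "'a::lie_algebra uea"
  assumes one: "P 1" and add: "\<And>u v. P u \<Longrightarrow> P v \<Longrightarrow> P (u + v)"
    and scale: "\<And>c u. P u \<Longrightarrow> P (c *\<^sub>C u)" and mult: "\<And>x u. P u \<Longrightarrow> P (uea_of x * u)"
  shows "P u"
proof -
  have word: "P (abs_uea (Poly_Mapping.single w 1))" for w :: "'a list"
  proof (induction w)
    case Nil
    then show ?case using one by (simp add: one_uea.abs_eq zero_list_def flip: single_one)
  next
    case (Cons x w)
    have "abs_uea (Poly_Mapping.single (x # w) 1) = uea_of x * abs_uea (Poly_Mapping.single w 1)"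
      by (simp add: uea_of.abs_eq times_uea.abs_eq letter_def single_list_times)
    with mult[OF Cons] show ?case by simp
  qed
  have "P (abs_uea p)" for p :: "'a list \<Rightarrow>\<^sub>0 complex"
    by (induction p rule: free_poly_mapping_induct)
      (auto simp: word plus_uea.abs_eq[symmetric] scaleC_uea.abs_eq[symmetric] intro: add scale)
  then show ?thesis by (metis abs_uea_cases)
qed

lemma clinear_uea_of [clinear_intros]: "clinear f \<Longrightarrow> clinear (\<lambda>x. uea_of (f x))"
proof -
  have "uea_of (x + y) = uea_of x + uea_of y" for x y :: 'b
  proof transfer
    fix x y :: 'b
    have "1 * (letter (x + y) - letter x - letter y) * 1 \<in> uea_ideal"
      unfolding uea_ideal_def uea_rels_def by (rule complex_space.span_base) blast
    then show "uea_eq (letter (x + y)) (letter x + letter y)" by (simp add: uea_eq_def diff_diff_eq)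
  qed
  moreover have "uea_of (c *\<^sub>C x) = c *\<^sub>C uea_of x" for c and x :: 'b
  proof transfer
    fix c and x :: 'b
    have "1 * (letter (c *\<^sub>C x) - c *\<^sub>C letter x) * 1 \<in> uea_ideal"
      unfolding uea_ideal_def uea_rels_def by (rule complex_space.span_base) blast
    then show "uea_eq (letter (c *\<^sub>C x)) (c *\<^sub>C letter x)" by (simp add: uea_eq_def)
  qed
  ultimately show "clinear f \<Longrightarrow> clinear (\<lambda>x. uea_of (f x))"
    by (intro clinearI) (simp_all add: clinear_add clinear_scale)
qed

lemma uea_of_commutator: "uea_of x * uea_of y - uea_of y * uea_of x = uea_of (lie x y)"
proof transfer
  fix x y :: 'a
  have "1 * (letter x * letter y - letter y * letter x - letter (lie x y)) * 1 \<in> uea_ideal"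
    unfolding uea_ideal_def uea_rels_def by (rule complex_space.span_base) blast
  then show "uea_eq (letter x * letter y - letter y * letter x) (letter (lie x y))"
    by (simp add: uea_eq_def)
qed

instance uea :: (lie_algebra) complex_algebra
proof
  fix u v :: "'a uea" and c
  obtain p q where "u = abs_uea p" "v = abs_uea q" by (meson abs_uea_cases)
  then show "(c *\<^sub>C u) * v = c *\<^sub>C (u * v)" "u * (c *\<^sub>C v) = c *\<^sub>C (u * v)"
    by (simp_all add: scaleC_uea.abs_eq times_uea.abs_eq clinear_scale[OF clinear_free_algebra_mult(1)]
        clinear_scale[OF clinear_free_algebra_mult(2)])
qed

lemma lie_rep_uea_comult:
  "lie_rep (\<lambda>x. tensor_mult (*) (*) (uea_of x \<otimes> 1 + 1 \<otimes> uea_of x))"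
proof -
  have "uea_of (lie x y) \<otimes> 1 + 1 \<otimes> uea_of (lie x y)
      = (uea_of x \<otimes> 1 + 1 \<otimes> uea_of x) * (uea_of y \<otimes> 1 + 1 \<otimes> uea_of y)
      - (uea_of y \<otimes> 1 + 1 \<otimes> uea_of y) * (uea_of x \<otimes> 1 + 1 \<otimes> uea_of x)" for x y :: 'a
    by (simp add: distrib_left distrib_right clinear_diff[OF clinear_tensor_left[OF clinear_id']]
        clinear_diff[OF clinear_tensor_right[OF clinear_id']] flip: uea_of_commutator)
  then show ?thesis
    unfolding lie_rep_def times_tensor_def[symmetric]
    by (auto intro!: clinear_intros simp: left_diff_distrib mult.assoc)
qed

lemma lie_rep_uea_counit: "lie_rep (\<lambda>x c. 0)"
  by (auto simp: lie_rep_def intro: clinear_intros)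

lemma lie_rep_uea_antipode: "lie_rep (\<lambda>x v. v * (- uea_of x))"
  unfolding lie_rep_def
  by (auto intro!: clinear_intros simp: algebra_simps simp flip: uea_of_commutator)

lemma clinear_uea_comult [clinear_intros]: "clinear f \<Longrightarrow> clinear (\<lambda>x. uea_comult (f x))"
  unfolding uea_comult_def
  by (rule clinear_compose[OF uea_act_clinear_left[OF lie_rep_uea_comult]])

lemma uea_comult_one [simp]: "uea_comult 1 = 1 \<otimes> 1"
  by (simp add: uea_comult_def uea_act_one lie_rep_uea_comult)

lemma uea_comult_of_mult:
  "uea_comult (uea_of x * u) = (uea_of x \<otimes> 1 + 1 \<otimes> uea_of x) * uea_comult u"
  by (simp add: uea_comult_def uea_act_mult uea_act_of lie_rep_uea_comult times_tensor_def)

lemma clinear_uea_counit [clinear_intros]: "clinear f \<Longrightarrow> clinear (\<lambda>x. uea_counit (f x))"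
  unfolding uea_counit_def
  by (rule clinear_compose[OF uea_act_clinear_left[OF lie_rep_uea_counit]])

lemma uea_counit_one [simp]: "uea_counit 1 = 1"
  by (simp add: uea_counit_def uea_act_one lie_rep_uea_counit)

lemma uea_counit_of_mult [simp]: "uea_counit (uea_of x * u) = 0"
  by (simp add: uea_counit_def uea_act_mult uea_act_of lie_rep_uea_counit)

lemma clinear_uea_antipode [clinear_intros]: "clinear f \<Longrightarrow> clinear (\<lambda>x. uea_antipode (f x))"
  unfolding uea_antipode_def
  by (rule clinear_compose[OF uea_act_clinear_left[OF lie_rep_uea_antipode]])

lemma uea_antipode_one [simp]: "uea_antipode 1 = 1"
  by (simp only: uea_antipode_def uea_act_one[OF lie_rep_uea_antipode])

lemma uea_antipode_of_mult: "uea_antipode (uea_of x * u) = uea_antipode u * (- uea_of x)"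
  by (simp only: uea_antipode_def uea_act_mult[OF lie_rep_uea_antipode] uea_act_of[OF lie_rep_uea_antipode])


section \<open>Smooth functions\<close>

lemma smooth_bilinear: "bounded_bilinear b \<Longrightarrow> smooth f \<Longrightarrow> smooth g \<Longrightarrow> smooth (\<lambda>x. b (f x) (g x))"
  by (simp add: smooth_def Cm_bilinear)

lemma smooth_linear: "bounded_linear L \<Longrightarrow> smooth f \<Longrightarrow> smooth (\<lambda>x. L (f x))"
  by (simp add: smooth_def Cm_linear)

lemma smooth_sum: "(\<And>i. i \<in> I \<Longrightarrow> smooth (f i)) \<Longrightarrow> smooth (\<lambda>x. \<Sum>i\<in>I. f i x)"
  by (simp add: smooth_def Cm_sum)

lemma smooth_times: "smooth f \<Longrightarrow> smooth g \<Longrightarrow> smooth (\<lambda>x. f x * g x :: 'b::real_normed_algebra)"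
  by (rule smooth_bilinear[OF bounded_bilinear_mult])

lemma smooth_uminus: "smooth f \<Longrightarrow> smooth (\<lambda>x. - f x)"
  by (rule smooth_linear[of uminus]) (simp_all add: bounded_linear_minus bounded_linear_ident)

lemma smooth_diff: "smooth f \<Longrightarrow> smooth g \<Longrightarrow> smooth (\<lambda>x. f x - g x)"
  using smooth_add[OF _ smooth_uminus, of f g] by simp

lemma smooth_prod: "(\<And>i. i \<in> I \<Longrightarrow> smooth (f i)) \<Longrightarrow> smooth (\<lambda>x. \<Prod>i\<in>I. f i x :: 'b::real_normed_field)"
  by (induction I rule: infinite_finite_induct) (auto intro: smooth_const smooth_times)

lemma smooth_of_real: "smooth f \<Longrightarrow> smooth (\<lambda>x. of_real (f x) :: 'b::real_normed_algebra_1)"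
  by (rule smooth_linear[OF bounded_linear_of_real])

lemma smooth_nth: "smooth f \<Longrightarrow> smooth (\<lambda>x. f x $ i)"
  by (rule smooth_linear[OF bounded_linear_vec_nth])

lemma smooth_continuous: "smooth f \<Longrightarrow> isCont f x"
  using differentiable_imp_continuous_within[OF smooth_differentiable, of f x] by blast

lemma smooth_has_derivative: "smooth f \<Longrightarrow> (f has_derivative frechet_derivative f (at x)) (at x)"
  by (simp add: smooth_differentiable frechet_derivative_works[symmetric])

lemma partial_linear_map:
  "bounded_linear L \<Longrightarrow> smooth f \<Longrightarrow> partial k (\<lambda>x. L (f x)) = (\<lambda>x. L (partial k f x))"
  by (rule ext) (simp add: partial_has_derivative[OF bounded_linear.has_derivative[OF _ smooth_has_derivative]]
      partial_def[symmetric])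

lemma partial_const: "partial k (\<lambda>x. c) = (\<lambda>x. 0)"
  by (simp add: partial_def fun_eq_iff)

lemma partial_add:
  "smooth f \<Longrightarrow> smooth g \<Longrightarrow> partial k (\<lambda>x. f x + g x) = (\<lambda>x. partial k f x + partial k g x)"
  by (rule ext) (simp add: partial_has_derivative[OF has_derivative_add[OF smooth_has_derivative smooth_has_derivative]]
      partial_def[symmetric])

lemma partial_mult:
  fixes f g :: "real^'n \<Rightarrow> 'b::real_normed_algebra"
  shows "smooth f \<Longrightarrow> smooth g \<Longrightarrow> partial k (\<lambda>x. f x * g x) = (\<lambda>x. f x * partial k g x + partial k f x * g x)"
  by (rule ext) (simp add: partial_has_derivative[OF has_derivative_mult[OF smooth_has_derivative smooth_has_derivative]]
      partial_def[symmetric])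

lemma partial_compose:
  fixes f :: "real^'n \<Rightarrow> 'b::real_normed_vector" and g :: "real^'m \<Rightarrow> real^'n"
  assumes "smooth f" "smooth g"
  shows "partial k (\<lambda>x. f (g x)) = (\<lambda>x. \<Sum>i\<in>UNIV. partial k (\<lambda>y. g y $ i) x *\<^sub>R partial i f (g x))"
proof
  fix x
  have lin: "linear (frechet_derivative f (at (g x)))"
    using smooth_has_derivative[OF assms(1)] has_derivative_linear by blast
  have D: "((\<lambda>x. f (g x)) has_derivative
      (\<lambda>h. frechet_derivative f (at (g x)) (frechet_derivative g (at x) h))) (at x)"
    using diff_chain_at[OF smooth_has_derivative[OF assms(2)] smooth_has_derivative[OF assms(1)]]
    by (simp add: o_def)
  have "partial k (\<lambda>x. f (g x)) x = frechet_derivative f (at (g x)) (partial k g x)"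
    by (subst partial_has_derivative[OF D]) (simp add: partial_def)
  also have "\<dots> = frechet_derivative f (at (g x)) (\<Sum>i\<in>UNIV. (partial k g x $ i) *\<^sub>R axis i 1)"
    by (simp only: axis_expansion)
  also have "\<dots> = (\<Sum>i\<in>UNIV. (partial k g x $ i) *\<^sub>R partial i f (g x))"
    by (simp add: linear_sum[OF lin] linear_cmul[OF lin] partial_def)
  also have "\<dots> = (\<Sum>i\<in>UNIV. partial k (\<lambda>y. g y $ i) x *\<^sub>R partial i f (g x))"
    by (simp add: partial_linear_map[OF bounded_linear_vec_nth assms(2)])
  finally show "partial k (\<lambda>x. f (g x)) x = (\<Sum>i\<in>UNIV. partial k (\<lambda>y. g y $ i) x *\<^sub>R partial i f (g x))" .
qed

lemma partial_nth: "partial k (\<lambda>x. x $ i) = (\<lambda>x. if i = k then 1 else 0)"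
  by (rule ext)
    (simp add: partial_has_derivative[OF bounded_linear_imp_has_derivative[OF bounded_linear_vec_nth]] axis_def)

lemma partial_local:
  assumes "open W" "x \<in> W" "\<And>y. y \<in> W \<Longrightarrow> f y = g y"
  shows "partial k f x = partial k g x"
proof -
  have "(f has_derivative D) (at x) \<longleftrightarrow> (g has_derivative D) (at x)" for D
    using has_derivative_transform_within_open[OF _ assms(1,2), of f D UNIV g]
      has_derivative_transform_within_open[OF _ assms(1,2), of g D UNIV f] assms(3) by metis
  then show ?thesis by (simp add: partial_def frechet_derivative_def)
qed

text \<open>The partial derivatives of \<open>1/w\<close> are products of \<open>- \<partial>w\<close> with two copies of \<open>1/w\<close>; this gives
  smoothness by induction on the order.\<close>

lemma smooth_inverse:
  fixes w :: "real^'n \<Rightarrow> real"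
  assumes w: "smooth w" and nz: "\<And>x. w x \<noteq> 0"
  shows "smooth (\<lambda>x. inverse (w x))"
  unfolding smooth_def
proof
  have D: "((\<lambda>x. inverse (w x)) has_derivative
      (\<lambda>h. - (inverse (w x) * frechet_derivative w (at x) h * inverse (w x)))) (at x)" for x
    by (rule Deriv.has_derivative_inverse[OF nz smooth_has_derivative[OF w]])
  then have df: "(\<lambda>x. inverse (w x)) differentiable (at x)" for x
    unfolding differentiable_def by blast
  have P: "partial k (\<lambda>x. inverse (w x)) = (\<lambda>x. (- partial k w x) * (inverse (w x) * inverse (w x)))" for k
    by (rule ext) (simp add: partial_has_derivative[OF D] partial_def)
  have smp: "Cm m (\<lambda>x. - partial k w x)" for m k
    using smooth_uminus[OF smooth_partial[OF w]] by (simp add: smooth_def)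
  show "Cm m (\<lambda>x. inverse (w x))" for m
  proof (induction m)
    case 0
    then show ?case
      using df by (auto intro!: differentiable_imp_continuous_on simp: differentiable_on_def)
  next
    case (Suc m)
    show ?case unfolding Cm.simps P
      by (intro conjI allI Cm_bilinear[OF bounded_bilinear_mult] smp Suc df)
  qed
qed

lemma line_has_derivative:
  fixes f :: "real^'n \<Rightarrow> real"
  assumes "smooth f"
  shows "((\<lambda>s. f (x + s *\<^sub>R axis k 1)) has_real_derivative partial k f (x + s *\<^sub>R axis k 1)) (at s)"
proof -
  have "((\<lambda>s. x + s *\<^sub>R axis k 1) has_derivative (\<lambda>h. h *\<^sub>R axis k 1)) (at s)"
    by (auto intro!: derivative_eq_intros)
  from diff_chain_at[OF this smooth_has_derivative[OF assms]]
  have "((\<lambda>s. f (x + s *\<^sub>R axis k 1)) has_derivative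
      (\<lambda>h. frechet_derivative f (at (x + s *\<^sub>R axis k 1)) (h *\<^sub>R axis k 1))) (at s)"
    by (simp add: o_def)
  moreover have "frechet_derivative f (at y) (h *\<^sub>R axis k 1) = h *\<^sub>R partial k f y" for h y
    using has_derivative_linear[OF smooth_has_derivative[OF assms]]
    by (simp add: partial_def linear_cmul)
  moreover have "(\<lambda>h. h * c) = (*) c" for c :: real by (simp add: fun_eq_iff)
  ultimately show ?thesis by (simp add: has_field_derivative_def)
qed

text \<open>The second difference of \<open>f\<close> over a small parallelogram is, by the mean value theorem applied
  twice, a value of either iterated partial derivative; these are continuous.\<close>

lemma second_difference:
  fixes f :: "real^'n \<Rightarrow> real"
  assumes f: "smooth f" and h: "h > 0"
  obtains s t where "0 < s" "s < h" "0 < t" "t < h"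
    "f (x + h *\<^sub>R axis k 1 + h *\<^sub>R axis l 1) - f (x + h *\<^sub>R axis k 1) - f (x + h *\<^sub>R axis l 1) + f x
      = h * (h * partial l (partial k f) (x + s *\<^sub>R axis k 1 + t *\<^sub>R axis l 1))"
proof -
  let ?u = "\<lambda>s. f (x + h *\<^sub>R axis l 1 + s *\<^sub>R axis k 1) - f (x + s *\<^sub>R axis k 1)"
  let ?v = "\<lambda>s. partial k f (x + h *\<^sub>R axis l 1 + s *\<^sub>R axis k 1) - partial k f (x + s *\<^sub>R axis k 1)"
  have "(?u has_real_derivative ?v s) (at s)" for s
    by (intro DERIV_diff line_has_derivative f)
  then obtain s where s: "0 < s" "s < h" "?u h - ?u 0 = (h - 0) * ?v s"
    using MVT2[of 0 h ?u ?v] h by blast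
  let ?w = "\<lambda>t. partial k f ((x + s *\<^sub>R axis k 1) + t *\<^sub>R axis l 1)"
  have "(?w has_real_derivative partial l (partial k f) ((x + s *\<^sub>R axis k 1) + t *\<^sub>R axis l 1)) (at t)" for t
    by (intro line_has_derivative smooth_partial f)
  then obtain t where t: "0 < t" "t < h"
    "?w h - ?w 0 = (h - 0) * partial l (partial k f) ((x + s *\<^sub>R axis k 1) + t *\<^sub>R axis l 1)"
    using MVT2[of 0 h ?w "\<lambda>t. partial l (partial k f) ((x + s *\<^sub>R axis k 1) + t *\<^sub>R axis l 1)"] h by blast
  have "?v s = ?w h - ?w 0" by (simp add: ac_simps)
  with s t show thesis by (intro that[of s t]) (simp_all add: ac_simps)
qed

lemma partial_commute_real:
  fixes f :: "real^'n \<Rightarrow> real"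
  assumes f: "smooth f"
  shows "partial k (partial l f) = partial l (partial k f)"
proof (rule ext, rule ccontr)
  fix x
  let ?A = "partial l (partial k f)" and ?B = "partial k (partial l f)"
  assume ne: "?B x \<noteq> ?A x"
  define e where "e = \<bar>?A x - ?B x\<bar> / 2"
  have e: "e > 0" using ne by (simp add: e_def)
  have cont: "isCont ?A x" "isCont ?B x" by (intro smooth_continuous smooth_partial f)+
  obtain d1 where d1: "d1 > 0" "\<And>y. dist y x < d1 \<Longrightarrow> dist (?A y) (?A x) < e"
    using cont(1) e unfolding continuous_at by (auto simp: LIM_def dist_commute) (metis dist_self)
  obtain d2 where d2: "d2 > 0" "\<And>y. dist y x < d2 \<Longrightarrow> dist (?B y) (?B x) < e"
    using cont(2) e unfolding continuous_at by (auto simp: LIM_def dist_commute) (metis dist_self)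
  \<comment> \<open>both mean value points then have distance less than \<open>2h\<close> from \<open>x\<close>\<close>
  define h where "h = min d1 d2 / 2"
  have h: "h > 0" using d1 d2 by (simp add: h_def)
  obtain s t where st: "0 < s" "s < h" "0 < t" "t < h"
    "f (x + h *\<^sub>R axis k 1 + h *\<^sub>R axis l 1) - f (x + h *\<^sub>R axis k 1) - f (x + h *\<^sub>R axis l 1) + f x
      = h * (h * ?A (x + s *\<^sub>R axis k 1 + t *\<^sub>R axis l 1))"
    by (rule second_difference[OF f h])
  obtain s' t' where st': "0 < s'" "s' < h" "0 < t'" "t' < h"
    "f (x + h *\<^sub>R axis l 1 + h *\<^sub>R axis k 1) - f (x + h *\<^sub>R axis l 1) - f (x + h *\<^sub>R axis k 1) + f x
      = h * (h * ?B (x + s' *\<^sub>R axis l 1 + t' *\<^sub>R axis k 1))"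
    by (rule second_difference[OF f h])
  have near: "dist (x + a *\<^sub>R axis i 1 + b *\<^sub>R axis j 1) x < min d1 d2"
    if "0 < a" "a < h" "0 < b" "b < h" for a b and i j :: 'n
  proof -
    have "dist (x + a *\<^sub>R axis i 1 + b *\<^sub>R axis j 1) x = norm (a *\<^sub>R axis i 1 + b *\<^sub>R axis j (1::real) :: real^'n)"
      by (simp add: dist_norm algebra_simps)
    also have "\<dots> \<le> a + b" using norm_triangle_ineq[of "a *\<^sub>R axis i 1" "b *\<^sub>R axis j (1::real) :: real^'n"] that
      by simp
    finally show ?thesis using that by (simp add: h_def)
  qed
  have sw: "x + h *\<^sub>R axis l 1 + h *\<^sub>R axis k 1 = x + h *\<^sub>R axis k 1 + h *\<^sub>R axis l 1"
    by (simp add: add.assoc add.commute[of "h *\<^sub>R axis l 1"])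
  have "h * (h * ?A (x + s *\<^sub>R axis k 1 + t *\<^sub>R axis l 1)) =
      h * (h * ?B (x + s' *\<^sub>R axis l 1 + t' *\<^sub>R axis k 1))"
    using st(5) st'(5)[unfolded sw] by linarith
  then have "?A (x + s *\<^sub>R axis k 1 + t *\<^sub>R axis l 1) = ?B (x + s' *\<^sub>R axis l 1 + t' *\<^sub>R axis k 1)"
    using h by simp
  moreover have "dist (?A (x + s *\<^sub>R axis k 1 + t *\<^sub>R axis l 1)) (?A x) < e"
    using near[OF st(1-4)] by (intro d1) simp
  moreover have "dist (?B (x + s' *\<^sub>R axis l 1 + t' *\<^sub>R axis k 1)) (?B x) < e"
    using near[OF st'(1-4)] by (intro d2) simp
  ultimately show False unfolding e_def dist_real_def by argo
qed

lemma partial_commute: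
  fixes f :: "real^'n \<Rightarrow> 'b::euclidean_space"
  assumes f: "smooth f"
  shows "partial k (partial l f) = partial l (partial k f)"
proof
  fix x
  have "partial k (partial l f) x \<bullet> b = partial l (partial k f) x \<bullet> b" for b
  proof -
    have L: "bounded_linear (\<lambda>y. y \<bullet> b)" by (rule bounded_linear_inner_left)
    have "partial k (partial l (\<lambda>x. f x \<bullet> b)) = partial l (partial k (\<lambda>x. f x \<bullet> b))"
      by (intro partial_commute_real smooth_linear[OF L] f)
    then show ?thesis
      by (simp add: partial_linear_map[OF L] f smooth_partial fun_eq_iff)
  qed
  then show "partial k (partial l f) x = partial l (partial k f) x"
    by (rule euclidean_eqI)
qed

text \<open>The functions \<open>t\<^sup>-\<^sup>k exp(-1/t)\<close>, extended by 0 to \<open>t \<le> 0\<close>, span a space closed under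
  differentiation; so all of them are smooth.\<close>

definition flat_exp :: "nat \<Rightarrow> real \<Rightarrow> real"
  where "flat_exp k t = (if t > 0 then inverse t ^ k * exp (- inverse t) else 0)"

text \<open>The right-hand side comes from a single term of the exponential series. Applied to \<open>k + 1\<close>, the bound
  shows that the difference quotient of \<open>flat_exp k\<close> at 0 tends to 0.\<close>

lemma flat_exp_bound: "\<bar>flat_exp k t\<bar> \<le> fact (Suc k) * \<bar>t\<bar>"
proof (cases "t > 0")
  case True
  have "inverse t ^ Suc k / fact (Suc k) \<le> exp (inverse t)"
  proof -
    have "(\<Sum>n\<in>{Suc k}. inverse (fact n) *\<^sub>R inverse t ^ n) \<le> exp (inverse t)"
      unfolding exp_def using True by (intro sum_le_suminf summable_exp_generic) auto
    then show ?thesis by (simp add: divide_inverse mult.commute)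
  qed
  then have "inverse t ^ Suc k \<le> fact (Suc k) * exp (inverse t)"
    by (simp add: divide_le_eq mult.commute del: fact_Suc)
  then have "(t * exp (- inverse t)) * inverse t ^ Suc k \<le> (t * exp (- inverse t)) * (fact (Suc k) * exp (inverse t))"
    using True by (intro mult_left_mono) auto
  moreover have "(t * exp (- inverse t)) * inverse t ^ Suc k = inverse t ^ k * exp (- inverse t)"
    using True by simp
  moreover have "(t * exp (- inverse t)) * (fact (Suc k) * exp (inverse t)) = fact (Suc k) * t"
    by (simp add: exp_minus del: fact_Suc)
  ultimately have "inverse t ^ k * exp (- inverse t) \<le> fact (Suc k) * t" by linarith
  with True show ?thesis by (simp add: flat_exp_def)
next
  case False
  have "0 \<le> fact (Suc k) * \<bar>t\<bar>" by (intro mult_nonneg_nonneg) auto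
  with False show ?thesis by (simp only: flat_exp_def if_False abs_zero)
qed

lemma flat_exp_derivative:
  "(flat_exp k has_real_derivative (flat_exp (k + 2) t - real k * flat_exp (k + 1) t)) (at t)"
proof -
  consider "t > 0" | "t < 0" | "t = 0" by linarith
  then show ?thesis
  proof cases
    case 1
    have "((\<lambda>t. inverse t ^ k * exp (- inverse t)) has_real_derivative
        (flat_exp (k + 2) t - real k * flat_exp (k + 1) t)) (at t)"
    proof -
      have p: "((\<lambda>t. inverse t ^ k) has_real_derivative - (real k * inverse t ^ (k + 1))) (at t)"
        using DERIV_power[OF DERIV_inverse, of t k UNIV] 1 by (cases k) (simp_all add: mult_ac)
      have "((\<lambda>t. exp (- inverse t)) has_real_derivative exp (- inverse t) * inverse t ^ 2) (at t)"
        using 1 by (auto intro!: derivative_eq_intros simp: power2_eq_square)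
      from DERIV_mult[OF p this] show ?thesis
        using 1 by (simp add: flat_exp_def power2_eq_square algebra_simps)
    qed
    then show ?thesis
      by (rule has_field_derivative_transform_within_open[of _ _ _ "{0<..}"])
        (use 1 in \<open>auto simp: flat_exp_def\<close>)
  next
    case 2
    have "((\<lambda>t. 0) has_real_derivative 0) (at t)" by simp
    then have "(flat_exp k has_real_derivative 0) (at t)"
      by (rule has_field_derivative_transform_within_open[of _ _ _ "{..<0}"])
        (use 2 in \<open>auto simp: flat_exp_def\<close>)
    with 2 show ?thesis by (simp add: flat_exp_def)
  next
    case 3
    have lim: "((\<lambda>h. flat_exp (Suc k) h) \<longlongrightarrow> 0) (at 0)"
    proof (rule Lim_null_comparison)
      show "\<forall>\<^sub>F h in at 0. norm (flat_exp (Suc k) h) \<le> fact (Suc (Suc k)) * \<bar>h\<bar>"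
        using flat_exp_bound[of "Suc k"] by (simp only: real_norm_def eventually_True)
      show "((\<lambda>h::real. fact (Suc (Suc k)) * \<bar>h\<bar>) \<longlongrightarrow> 0) (at 0)"
        by (auto intro!: tendsto_eq_intros)
    qed
    have "(flat_exp k (0 + h) - flat_exp k 0) / h = flat_exp (Suc k) h" for h
      by (simp add: flat_exp_def field_simps)
    with lim have "(flat_exp k has_real_derivative 0) (at 0)"
      unfolding DERIV_def by (simp only:)
    with 3 show ?thesis by (simp add: flat_exp_def)
  qed
qed

lemma smooth_flat_exp:
  fixes g :: "real^'n \<Rightarrow> real"
  assumes g: "smooth g"
  shows "smooth (\<lambda>x. flat_exp k (g x))"
proof -
  have D: "((\<lambda>x. flat_exp k (g x)) has_derivative
      (\<lambda>h. (flat_exp (k + 2) (g x) - real k * flat_exp (k + 1) (g x)) * frechet_derivative g (at x) h)) (at x)" for k x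
    using diff_chain_at[OF smooth_has_derivative[OF g] flat_exp_derivative[unfolded has_field_derivative_def]]
    by (simp add: o_def)
  then have df: "(\<lambda>x. flat_exp k (g x)) differentiable (at x)" for k x
    unfolding differentiable_def by blast
  have P: "partial j (\<lambda>x. flat_exp k (g x)) =
      (\<lambda>x. (flat_exp (k + 2) (g x) + (- real k) * flat_exp (k + 1) (g x)) * partial j g x)" for j k
    by (rule ext) (simp add: partial_has_derivative[OF D] partial_def)
  have "\<forall>k. Cm m (\<lambda>x. flat_exp k (g x))" for m
  proof (induction m)
    case 0
    then show ?case
      using df by (auto intro!: differentiable_imp_continuous_on simp: differentiable_on_def)
  next
    case (Suc m)
    have "Cm m (partial j g)" for j using smooth_partial[OF g] by (simp add: smooth_def)
    with Suc df show ?case unfolding Cm.simps P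
      by (intro conjI allI Cm_bilinear[OF bounded_bilinear_mult] Cm_add Cm_const) auto
  qed
  then show ?thesis by (simp add: smooth_def)
qed

text \<open>The quotient \<open>\<rho>(s)/(\<rho>(s) + \<rho>(1-s))\<close> with \<open>s = 2 - \<bar>x-a\<bar>\<^sup>2\<close> and \<open>\<rho>(t) = exp(-1/t)\<close> equals 1 where
  \<open>\<bar>x-a\<bar> \<le> 1\<close> and 0 where \<open>\<bar>x-a\<bar>\<^sup>2 \<ge> 2\<close>.\<close>

lift_definition plateau :: "real^'n \<Rightarrow> 'n::finite test_fun"
  is "\<lambda>a x. of_real (flat_exp 0 (2 - (x - a) \<bullet> (x - a)) *
        inverse (flat_exp 0 (2 - (x - a) \<bullet> (x - a)) + flat_exp 0 ((x - a) \<bullet> (x - a) - 1)))"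
proof -
  fix a :: "real^'n"
  let ?q = "\<lambda>x. (x - a) \<bullet> (x - a)"
  let ?p = "\<lambda>x. of_real (flat_exp 0 (2 - ?q x) * inverse (flat_exp 0 (2 - ?q x) + flat_exp 0 (?q x - 1))) :: complex"
  have q: "smooth ?q"
    by (intro smooth_bilinear[OF bounded_bilinear_inner] smooth_diff smooth_ident smooth_const)
  have "flat_exp 0 (2 - s) + flat_exp 0 (s - 1) > 0" for s
    by (auto simp: flat_exp_def add_pos_pos)
  then have "flat_exp 0 (2 - s) + flat_exp 0 (s - 1) \<noteq> 0" for s by (metis less_irrefl)
  then have "smooth ?p"
    by (intro smooth_of_real smooth_times smooth_inverse smooth_add smooth_flat_exp smooth_diff smooth_const q)
  moreover have "{x. ?p x \<noteq> 0} \<subseteq> cball a 2"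
  proof
    fix x assume "x \<in> {x. ?p x \<noteq> 0}"
    then have "?q x \<le> 2" by (auto simp: flat_exp_def split: if_splits)
    then have "norm (x - a) ^ 2 \<le> 2 ^ 2" by (simp add: power2_norm_eq_inner)
    then have "norm (x - a) \<le> 2" by (rule power2_le_imp_le) simp
    then show "x \<in> cball a 2" by (simp add: dist_norm norm_minus_commute)
  qed
  then have "compact (closure {x. ?p x \<noteq> 0})" by (meson bounded_cball bounded_subset compact_closure)
  ultimately show "smooth ?p \<and> compact (closure {x. ?p x \<noteq> 0})" ..
qed

lemma plateau_eq_1: "x \<in> ball a 1 \<Longrightarrow> test_fun_app (plateau a) x = 1"
proof -
  assume "x \<in> ball a 1"
  then have "norm (x - a) ^ 2 < 1 ^ 2" by (intro power_strict_mono) (auto simp: dist_norm norm_minus_commute)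
  then have "(x - a) \<bullet> (x - a) < 1" by (simp add: power2_norm_eq_inner)
  then show ?thesis by transfer (simp add: flat_exp_def)
qed

lemma test_fun_app_simps [simp]:
  "test_fun_app 0 x = 0" "test_fun_app (f + g) x = test_fun_app f x + test_fun_app g x"
  "test_fun_app (c *\<^sub>C f) x = c * test_fun_app f x" "test_fun_app (f * g) x = test_fun_app f x * test_fun_app g x"
  "test_fun_app (- f) x = - test_fun_app f x"
  "test_fun_app (test_fun_compose f \<phi>) x = test_fun_app f (diffeo_map \<phi> x)"
  by (simp_all add: zero_test_fun.rep_eq plus_test_fun.rep_eq scaleC_test_fun.rep_eq
      times_test_fun.rep_eq uminus_test_fun.rep_eq test_fun_compose.rep_eq)

lemma test_fun_app_diff [simp]: "test_fun_app (f - g) x = test_fun_app f x - test_fun_app g x"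
  using test_fun_app_simps(2)[of f "- g" x] by (simp only: minus_test_fun_def test_fun_app_simps(5)) simp

lemma test_fun_app_sum: "test_fun_app (\<Sum>i\<in>I. f i) x = (\<Sum>i\<in>I. test_fun_app (f i) x)"
  by (induction I rule: infinite_finite_induct) auto

lemma test_fun_app_partial: "test_fun_app (test_fun_partial k f) = partial k (test_fun_app f)"
  by transfer simp

lemma test_fun_app_smult: "smooth h \<Longrightarrow> test_fun_app (test_fun_smult h f) x = h x * test_fun_app f x"
  by transfer simp

lemma smooth_test_fun: "smooth (test_fun_app f)"
  by transfer simp

lemma test_fun_eqI: "(\<And>x. test_fun_app f x = test_fun_app g x) \<Longrightarrow> f = g"
  by (metis ext test_fun_app_inject)

instance test_fun :: (finite) complex_algebra
  by standard (rule test_fun_eqI, simp)+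


section \<open>Diffeomorphisms\<close>

lemma smooth_diffeo: "smooth (diffeo_map \<phi>)"
  by transfer simp

lemma diffeo_eqI: "(\<And>x. diffeo_map \<phi> x = diffeo_map \<psi> x) \<Longrightarrow> \<phi> = \<psi>"
  by (metis ext diffeo_map_inject)

lemma diffeo_map_simps [simp]:
  "diffeo_map diffeo_id x = x"
  "diffeo_map (diffeo_comp \<phi> \<psi>) x = diffeo_map \<phi> (diffeo_map \<psi> x)"
  "diffeo_map (diffeo_inv \<phi>) (diffeo_map \<phi> x) = x"
  "diffeo_map \<phi> (diffeo_map (diffeo_inv \<phi>) x) = x"
proof -
  have b: "bij (diffeo_map \<phi>)" by transfer simp
  show "diffeo_map diffeo_id x = x" "diffeo_map (diffeo_comp \<phi> \<psi>) x = diffeo_map \<phi> (diffeo_map \<psi> x)"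
    by (simp_all add: diffeo_id.rep_eq diffeo_comp.rep_eq)
  show "diffeo_map (diffeo_inv \<phi>) (diffeo_map \<phi> x) = x" "diffeo_map \<phi> (diffeo_map (diffeo_inv \<phi>) x) = x"
    using b by (simp_all add: diffeo_inv.rep_eq bij_is_inj bij_is_surj surj_f_inv_f)
qed

lemma diffeo_inv_eqI:
  assumes "\<And>x. diffeo_map \<psi> (diffeo_map \<phi> x) = x"
  shows "diffeo_inv \<phi> = \<psi>"
proof (rule diffeo_eqI)
  show "diffeo_map (diffeo_inv \<phi>) x = diffeo_map \<psi> x" for x
    using assms[of "diffeo_map (diffeo_inv \<phi>) x"] by simp
qed

lemma diffeo_inv_inv [simp]: "diffeo_inv (diffeo_inv \<phi>) = \<phi>"
  by (rule diffeo_inv_eqI) simp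

lemma diffeo_comp_id [simp]: "diffeo_comp \<phi> diffeo_id = \<phi>" "diffeo_comp diffeo_id \<phi> = \<phi>"
  by (rule diffeo_eqI, simp)+

lift_definition translation :: "real^'n \<Rightarrow> 'n::finite diffeo" is "\<lambda>v x. x + v"
proof -
  fix v :: "real^'n"
  have inv: "inv (\<lambda>x. x + v) = (\<lambda>x. x + (- v))" by (rule inv_equality) auto
  have sm: "smooth (\<lambda>x. x + w)" for w :: "real^'n" by (intro smooth_add smooth_ident smooth_const)
  have "frechet_derivative (\<lambda>x. x + v) (at x) = id" for x
    by (rule frechet_derivative_at[symmetric]) (auto intro!: derivative_eq_intros simp: id_def)
  then have "det (jacobian (\<lambda>x. x + v) (at x)) > 0" for x
    by (simp add: jacobian_def matrix_id_mat_1)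
  moreover have "bij (\<lambda>x. x + v)" by (rule bij_plus_right)
  ultimately show "bij (\<lambda>x. x + v) \<and> smooth (\<lambda>x. x + v) \<and> smooth (inv (\<lambda>x. x + v)) \<and>
      (\<forall>x. det (jacobian (\<lambda>x. x + v) (at x)) > 0)"
    unfolding inv using sm by blast
qed

lemma translation_apply [simp]: "diffeo_map (translation v) x = x + v"
  by transfer simp

lemma partial_translate: "partial k (\<lambda>x. f (x + v)) x = partial k f (x + v)"
proof -
  have "(f has_derivative D) (at (x + v)) \<longleftrightarrow> ((\<lambda>x. f (x + v)) has_derivative D) (at x)" for D
    using has_derivative_compose[OF has_derivative_add_const[OF has_derivative_ident], of f D x v UNIV]
      has_derivative_compose[OF has_derivative_add_const[OF has_derivative_ident], of "\<lambda>x. f (x + v)" D "x + v" "- v" UNIV]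
    by auto
  then show ?thesis by (simp add: partial_def frechet_derivative_def)
qed


section \<open>Operators on the crossed product\<close>

lemma crossed_induct [case_names monom add]:
  fixes a :: "'n::finite crossed"
  assumes "\<And>f \<phi>. P (monom f \<phi>)" "\<And>a b. P a \<Longrightarrow> P b \<Longrightarrow> P (a + b)"
  shows "P a"
proof -
  have "P 0" using assms(1)[of undefined 0] by simp
  then have s: "P (\<Sum>\<phi>\<in>I. monom (f \<phi>) \<phi>)" for I and f :: "'n diffeo \<Rightarrow> 'n test_fun"
    by (induction I rule: infinite_finite_induct) (auto intro: assms)
  have "a = (\<Sum>\<phi>\<in>Poly_Mapping.keys a. monom (Poly_Mapping.lookup a \<phi>) \<phi>)"
    by (rule poly_mapping_eqI)
      (auto simp: lookup_sum lookup_single when_def not_in_keys_iff_lookup_eq_zero)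
  then show ?thesis using s by metis
qed

lemma monom_add: "monom (f + g) \<phi> = monom f \<phi> + monom g \<phi>"
  by (rule single_add)

lemma monom_scale: "monom (c *\<^sub>C f) \<phi> = c *\<^sub>C monom f \<phi>"
  by (rule poly_mapping_eqI) (simp add: lookup_scaleC lookup_single when_def)

lemma test_fun_compose_linear:
  "test_fun_compose (f + g) \<phi> = test_fun_compose f \<phi> + test_fun_compose g \<phi>"
  "test_fun_compose (c *\<^sub>C f) \<phi> = c *\<^sub>C test_fun_compose f \<phi>"
  by (rule test_fun_eqI, simp)+

lemma test_fun_compose_0 [simp]: "test_fun_compose 0 \<phi> = 0"
  by (rule test_fun_eqI) simp

lemma crossed_mult_superset:
  assumes "finite A" "Poly_Mapping.keys a \<subseteq> A" "finite B" "Poly_Mapping.keys b \<subseteq> B"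
  shows "crossed_mult a b = (\<Sum>\<phi>\<in>A. \<Sum>\<psi>\<in>B.
      monom (Poly_Mapping.lookup a \<phi> * test_fun_compose (Poly_Mapping.lookup b \<psi>) \<phi>) (diffeo_comp \<psi> \<phi>))"
  unfolding crossed_mult_def
  by (rule sum.mono_neutral_cong_left[OF assms(1,2)])
    (auto simp: in_keys_iff intro!: sum.mono_neutral_left assms)

lemma crossed_mult_monom [simp]:
  "crossed_mult (monom f \<phi>) (monom g \<psi>) = monom (f * test_fun_compose g \<phi>) (diffeo_comp \<psi> \<phi>)"
  by (subst crossed_mult_superset[where A = "{\<phi>}" and B = "{\<psi>}"]) (auto simp: lookup_single)

lemma clinear_crossed_mult_left [clinear_intros]:
  assumes "clinear F"
  shows "clinear (\<lambda>x. crossed_mult (F x) b)"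
proof -
  have "clinear (\<lambda>a. crossed_mult a b)"
  proof (rule clinearI)
    fix a a' :: "'b crossed" and c :: complex
    let ?A = "Poly_Mapping.keys a \<union> Poly_Mapping.keys a'"
    have "Poly_Mapping.keys (a + a') \<subseteq> ?A" by (rule keys_add)
    then show "crossed_mult (a + a') b = crossed_mult a b + crossed_mult a' b"
      by (subst (1 2 3) crossed_mult_superset[where A = ?A and B = "Poly_Mapping.keys b"])
        (auto simp: lookup_add distrib_right monom_add sum.distrib)
    have "Poly_Mapping.keys (c *\<^sub>C a) \<subseteq> Poly_Mapping.keys a"
      by (auto simp: in_keys_iff lookup_scaleC)
    then show "crossed_mult (c *\<^sub>C a) b = c *\<^sub>C crossed_mult a b"
      by (subst (1 2) crossed_mult_superset[where A = "Poly_Mapping.keys a" and B = "Poly_Mapping.keys b"])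
        (auto simp: lookup_scaleC mult_scaleC_left monom_scale complex_space.scale_sum_right)
  qed
  from clinear_compose[OF this assms] show ?thesis .
qed

lemma clinear_crossed_mult_right [clinear_intros]:
  assumes "clinear F"
  shows "clinear (\<lambda>x. crossed_mult a (F x))"
proof -
  have "clinear (crossed_mult a)"
  proof (rule clinearI)
    fix b b' :: "'b crossed" and c :: complex
    let ?B = "Poly_Mapping.keys b \<union> Poly_Mapping.keys b'"
    have "Poly_Mapping.keys (b + b') \<subseteq> ?B" by (rule keys_add)
    then show "crossed_mult a (b + b') = crossed_mult a b + crossed_mult a b'"
      by (subst (1 2 3) crossed_mult_superset[where A = "Poly_Mapping.keys a" and B = ?B])
        (auto simp: lookup_add distrib_left monom_add sum.distrib test_fun_compose_linear)
    have "Poly_Mapping.keys (c *\<^sub>C b) \<subseteq> Poly_Mapping.keys b"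
      by (auto simp: in_keys_iff lookup_scaleC)
    then show "crossed_mult a (c *\<^sub>C b) = c *\<^sub>C crossed_mult a b"
      by (subst (1 2) crossed_mult_superset[where A = "Poly_Mapping.keys a" and B = "Poly_Mapping.keys b"])
        (auto simp: lookup_scaleC mult_scaleC_right monom_scale complex_space.scale_sum_right test_fun_compose_linear)
  qed
  from clinear_compose[OF this assms] show ?thesis .
qed

lemma X_op_monom [simp]: "X_op k (monom f \<phi>) = monom (test_fun_partial k f) \<phi>"
  by (rule poly_mapping_eqI) (simp add: lookup_X_op lookup_single when_def test_fun_partial_0)

lemma diag_op_monom [simp]: "diag_op d (monom f \<phi>) = monom (test_fun_smult (d \<phi>) f) \<phi>"
  by (rule poly_mapping_eqI) (simp add: lookup_diag_op lookup_single when_def test_fun_smult_0)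

definition component :: "('n::finite crossed \<Rightarrow> 'n crossed) \<Rightarrow> 'n diffeo \<Rightarrow> 'n test_fun \<Rightarrow> 'n test_fun"
  where "component T \<phi> f = Poly_Mapping.lookup (T (monom f \<phi>)) \<phi>"

definition sigma_symbol :: "'n \<Rightarrow> 'n list \<Rightarrow> 'n::finite diffeo \<Rightarrow> real^'n \<Rightarrow> complex"
  where "sigma_symbol i js \<phi> x = of_real (fold partial js (\<lambda>y. diffeo_map \<phi> y $ i) x)"

definition sigma_inv_symbol :: "'n::finite diffeo \<Rightarrow> real^'n \<Rightarrow> complex"
  where "sigma_inv_symbol \<phi> x = of_real (inverse (det (jacobian (diffeo_map \<phi>) (at x))))"

lemma sigma_op_alt: "sigma_op i js = diag_op (sigma_symbol i js)"
  by (simp add: sigma_op_def sigma_symbol_def[abs_def])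

lemma sigma_inv_op_alt: "sigma_inv_op = diag_op sigma_inv_symbol"
  by (simp add: sigma_inv_op_def sigma_inv_symbol_def[abs_def])

lemma smooth_fold_partial: "smooth f \<Longrightarrow> smooth (fold partial js f)"
  by (induction js arbitrary: f) (auto intro: smooth_partial)

lemma smooth_sigma_symbol: "smooth (sigma_symbol i js \<phi>)"
  unfolding sigma_symbol_def[abs_def]
  by (intro smooth_of_real smooth_fold_partial smooth_nth smooth_diffeo)

lemma jacobian_entry:
  assumes "smooth g"
  shows "jacobian g (at x) $ i $ j = partial j (\<lambda>y. g y $ i) x"
  using fun_cong[OF partial_linear_map[OF bounded_linear_vec_nth assms, of j i], of x]
  by (simp add: jacobian_def matrix_def partial_def)

lemma jacobian_det_pos: "det (jacobian (diffeo_map \<phi>) (at x)) > 0"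
  by transfer simp

lemma jacobian_det:
  "det (jacobian (diffeo_map \<phi>) (at x)) = (\<Sum>p | p permutes UNIV.
      of_int (sign p) * (\<Prod>i\<in>UNIV. partial (p i) (\<lambda>y. diffeo_map \<phi> y $ i) x))"
  by (simp add: det_def jacobian_entry smooth_diffeo)

lemma smooth_jacobian_det: "smooth (\<lambda>x. det (jacobian (diffeo_map \<phi>) (at x)))"
  unfolding jacobian_det
  by (intro smooth_sum smooth_times smooth_const smooth_prod smooth_partial smooth_nth smooth_diffeo)

lemma smooth_sigma_inv_symbol: "smooth (sigma_inv_symbol \<phi>)"
  unfolding sigma_inv_symbol_def[abs_def]
  by (intro smooth_of_real smooth_inverse smooth_jacobian_det) (metis jacobian_det_pos less_irrefl)

lemma kn_gens_cases [consumes 1]: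
  assumes "T \<in> kn_gens"
  obtains k where "T = X_op k" | i j where "T = diag_op (sigma_symbol i [j])" | "T = diag_op sigma_inv_symbol"
  using assms by (auto simp: kn_gens_def sigma_op_alt sigma_inv_op_alt)

lemma kn_op_linear: "T \<in> op_algebra kn_gens \<Longrightarrow> clinear T"
  by (erule op_algebra_linear) (rule clinear_kn_gens)

text \<open>Neither the generators nor, therefore, the other operators of \<open>\<K>\<^sub>n\<close> mix the components \<open>C\<^sub>c\<^sup>\<infinity> U*\<^sub>\<phi>\<close> of the
  crossed product.\<close>

lemma kn_op_monom:
  assumes "T \<in> op_algebra kn_gens"
  shows "T (monom f \<phi>) = monom (component T \<phi> f) \<phi>"
proof -
  have "\<exists>g. T (monom f \<phi>) = monom g \<phi>"
    using assms
  proof (induction arbitrary: f rule: op_algebra.induct)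
    case (op_gen T)
    then show ?case by (cases rule: kn_gens_cases) (auto simp: sigma_op_alt)
  next
    case (op_add S T)
    then obtain g h where "S (monom f \<phi>) = monom g \<phi>" "T (monom f \<phi>) = monom h \<phi>" by blast
    then show ?case by (intro exI[of _ "g + h"]) (simp add: monom_add)
  next
    case (op_scale T c)
    then obtain g where "T (monom f \<phi>) = monom g \<phi>" by blast
    then show ?case by (intro exI[of _ "c *\<^sub>C g"]) (simp add: monom_scale)
  next
    case (op_comp S T)
    then show ?case by (metis comp_apply)
  qed auto
  then show ?thesis by (auto simp: component_def)
qed

lemma component_comp:
  assumes "T \<in> op_algebra kn_gens"
  shows "component (S \<circ> T) \<phi> f = component S \<phi> (component T \<phi> f)"
    and "component (\<lambda>a. S (T a)) \<phi> f = component S \<phi> (component T \<phi> f)"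
  unfolding component_def[of S] kn_op_monom[OF assms, symmetric] by (simp_all add: component_def)

lemma component_simps [simp]:
  "component id \<phi> f = f" "component (\<lambda>a. a) \<phi> f = f" "component (\<lambda>a. S a + T a) \<phi> f = component S \<phi> f + component T \<phi> f"
  "component (\<lambda>a. c *\<^sub>C T a) \<phi> f = c *\<^sub>C component T \<phi> f"
  "component (X_op k) \<phi> f = test_fun_partial k f"
  "component (diag_op d) \<phi> f = test_fun_smult (d \<phi>) f"
  by (simp_all add: component_def lookup_add lookup_scaleC)

lemma kn_op_eqI:
  assumes S: "S \<in> op_algebra kn_gens" and T: "T \<in> op_algebra kn_gens"
    and eq: "\<And>\<phi> f x. test_fun_app (component S \<phi> f) x = test_fun_app (component T \<phi> f) x"
  shows "S = T"
proof
  fix a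
  show "S a = T a"
  proof (induction a rule: crossed_induct)
    case (monom f \<phi>)
    have "component S \<phi> f = component T \<phi> f" by (rule test_fun_eqI) (rule eq)
    then show ?case by (simp add: kn_op_monom S T)
  next
    case (add a b)
    then show ?case by (simp add: clinear_add[OF kn_op_linear[OF S]] clinear_add[OF kn_op_linear[OF T]])
  qed
qed

lemma sigma_symbol_left_translation:
  "sigma_symbol i [j] (diffeo_comp (translation v) \<phi>) = sigma_symbol i [j] \<phi>"
  by (simp add: sigma_symbol_def fun_eq_iff partial_add smooth_const smooth_nth smooth_diffeo partial_const)

lemma sigma_symbol_right_translation:
  "sigma_symbol i [j] (diffeo_comp \<phi> (translation v)) x = sigma_symbol i [j] \<phi> (x + v)"
  using partial_translate[of j "\<lambda>y. diffeo_map \<phi> y $ i" v x] by (simp add: sigma_symbol_def)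

lemma sigma_inv_symbol_left_translation:
  "sigma_inv_symbol (diffeo_comp (translation v) \<phi>) = sigma_inv_symbol \<phi>"
  by (simp add: sigma_inv_symbol_def fun_eq_iff jacobian_det partial_add smooth_const smooth_nth
      smooth_diffeo partial_const)

lemma sigma_inv_symbol_right_translation:
  "sigma_inv_symbol (diffeo_comp \<phi> (translation v)) x = sigma_inv_symbol \<phi> (x + v)"
  using partial_translate[of _ "\<lambda>y. diffeo_map \<phi> y $ _" v x] by (simp add: sigma_inv_symbol_def jacobian_det)

text \<open>A translation after \<open>\<phi>\<close> changes neither the partial derivatives of \<open>\<phi>\<close> nor its Jacobian determinant.\<close>

lemma component_left_translation:
  assumes "T \<in> op_algebra kn_gens"
  shows "component T (diffeo_comp (translation v) \<phi>) f = component T \<phi> f"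
  using assms
proof (induction arbitrary: f rule: op_algebra.induct)
  case (op_gen T)
  then show ?case
    by (cases rule: kn_gens_cases)
      (simp_all add: sigma_symbol_left_translation sigma_inv_symbol_left_translation)
qed (simp_all add: component_comp)

lemma component_right_translation:
  assumes "T \<in> op_algebra kn_gens"
  shows "component T (diffeo_comp \<phi> (translation v)) (test_fun_compose f (translation v)) =
    test_fun_compose (component T \<phi> f) (translation v)"
  using assms
proof (induction arbitrary: f rule: op_algebra.induct)
  case (op_gen T)
  then show ?case
  proof (cases rule: kn_gens_cases)
    case (1 k)
    have "test_fun_app (test_fun_compose f (translation v)) = (\<lambda>x. test_fun_app f (x + v))" by (rule ext) simp
    with 1 show ?thesis
      by (intro test_fun_eqI) (simp add: test_fun_app_partial partial_translate)
  qed (auto intro!: test_fun_eqI simp: test_fun_app_smult smooth_sigma_symbol smooth_sigma_inv_symbol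
      sigma_symbol_right_translation sigma_inv_symbol_right_translation)
qed (simp_all add: component_comp test_fun_compose_linear)

lemma component_local:
  assumes "T \<in> op_algebra kn_gens" "open W" "x \<in> W"
    and "\<And>y. y \<in> W \<Longrightarrow> test_fun_app f y = test_fun_app g y"
  shows "test_fun_app (component T \<phi> f) x = test_fun_app (component T \<phi> g) x"
  using assms(1,3,4)
proof (induction arbitrary: f g x rule: op_algebra.induct)
  case (op_gen T)
  from op_gen(1) show ?case
  proof (cases rule: kn_gens_cases)
    case (1 k)
    then show ?thesis using partial_local[OF assms(2), of x "test_fun_app f" "test_fun_app g" k] op_gen
      by (simp add: test_fun_app_partial)
  qed (use op_gen in \<open>simp_all add: test_fun_app_smult smooth_sigma_symbol smooth_sigma_inv_symbol\<close>)
next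
  case (op_add S T)
  have "test_fun_app (component S \<phi> f) x = test_fun_app (component S \<phi> g) x"
    "test_fun_app (component T \<phi> f) x = test_fun_app (component T \<phi> g) x"
    using op_add.prems by (blast intro: op_add.IH)+
  then show ?case by simp
next
  case (op_scale T c)
  have "test_fun_app (component T \<phi> f) x = test_fun_app (component T \<phi> g) x"
    using op_scale.prems by (blast intro: op_scale.IH)
  then show ?case by simp
next
  case (op_comp S T)
  have "test_fun_app (component T \<phi> f) y = test_fun_app (component T \<phi> g) y" if "y \<in> W" for y
    by (rule op_comp.IH(2)[OF that op_comp.prems(2)])
  from op_comp.IH(1)[OF op_comp.prems(1) this] show ?case
    by (simp add: component_comp op_comp.hyps)
qed simp

text \<open>On the component of the identity diffeomorphism an operator \<open>k\<close> acts on a locally constant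
  function as a scalar, the counit of \<open>k\<close>.\<close>

definition acts_by_scalar :: "('n::finite crossed \<Rightarrow> 'n crossed) \<Rightarrow> complex \<Rightarrow> bool"
  where "acts_by_scalar T c \<longleftrightarrow> (\<forall>f W a. open W \<and> (\<forall>x\<in>W. test_fun_app f x = a) \<longrightarrow>
    (\<forall>x\<in>W. test_fun_app (component T diffeo_id f) x = c * a))"

lemma acts_by_scalarI:
  assumes "\<And>f W a x. open W \<Longrightarrow> (\<And>x. x \<in> W \<Longrightarrow> test_fun_app f x = a) \<Longrightarrow> x \<in> W
    \<Longrightarrow> test_fun_app (component T diffeo_id f) x = c * a"
  shows "acts_by_scalar T c"
  using assms unfolding acts_by_scalar_def by blast

lemma acts_by_scalarD:
  "acts_by_scalar T c \<Longrightarrow> open W \<Longrightarrow> (\<And>x. x \<in> W \<Longrightarrow> test_fun_app f x = a) \<Longrightarrow> x \<in> W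
    \<Longrightarrow> test_fun_app (component T diffeo_id f) x = c * a"
  unfolding acts_by_scalar_def by blast

lemma ex_acts_by_scalar:
  assumes "T \<in> op_algebra kn_gens"
  shows "\<exists>c. acts_by_scalar T c"
  using assms
proof (induction rule: op_algebra.induct)
  case op_id
  have "acts_by_scalar id 1" by (rule acts_by_scalarI) simp
  then show ?case by (auto simp: id_def)
next
  case (op_gen T)
  have idp: "partial j (\<lambda>y. y $ i) = (\<lambda>x. if i = j then 1 else 0 :: real)" for i j :: 'a
    by (rule partial_nth)
  from op_gen show ?case
  proof (cases rule: kn_gens_cases)
    case (1 k)
    have "acts_by_scalar T 0"
    proof (rule acts_by_scalarI)
      fix f :: "'a test_fun" and W a x
      assume W: "open W" "\<And>x. x \<in> W \<Longrightarrow> test_fun_app f x = a" "x \<in> W"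
      show "test_fun_app (component T diffeo_id f) x = 0 * a"
        using partial_local[OF W(1,3), of "test_fun_app f" "\<lambda>_. a" k] W(2) 1
        by (simp add: test_fun_app_partial partial_const)
    qed
    then show ?thesis ..
  next
    case (2 i j)
    have "acts_by_scalar T (if i = j then 1 else 0)"
      by (rule acts_by_scalarI)
        (simp add: 2 test_fun_app_smult smooth_sigma_symbol sigma_symbol_def idp)
    then show ?thesis ..
  next
    case 3
    have "jacobian (diffeo_map diffeo_id) (at x) = mat 1" for x :: "real^'a"
      by (simp add: vec_eq_iff jacobian_entry smooth_diffeo idp mat_def)
    then have "acts_by_scalar T 1"
      by (intro acts_by_scalarI)
        (simp add: 3 test_fun_app_smult smooth_sigma_inv_symbol sigma_inv_symbol_def)
    then show ?thesis ..
  qed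
next
  case (op_add S T)
  then obtain c d where c: "acts_by_scalar S c" and d: "acts_by_scalar T d" by blast
  have "acts_by_scalar (\<lambda>a. S a + T a) (c + d)"
    by (rule acts_by_scalarI) (simp add: acts_by_scalarD[OF c] acts_by_scalarD[OF d] distrib_right)
  then show ?case ..
next
  case (op_scale T c)
  then obtain d where d: "acts_by_scalar T d" by blast
  have "acts_by_scalar (\<lambda>a. c *\<^sub>C T a) (c * d)"
    by (rule acts_by_scalarI) (simp add: acts_by_scalarD[OF d] mult.assoc)
  then show ?case ..
next
  case (op_comp S T)
  then obtain c d where c: "acts_by_scalar S c" and d: "acts_by_scalar T d" by blast
  have "acts_by_scalar (S \<circ> T) (c * d)"
  proof (rule acts_by_scalarI)
    fix f :: "'a test_fun" and W a x
    assume W: "open W" "\<And>x. x \<in> W \<Longrightarrow> test_fun_app f x = a" "x \<in> W"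
    show "test_fun_app (component (S \<circ> T) diffeo_id f) x = c * d * a"
      using acts_by_scalarD[OF c W(1) acts_by_scalarD[OF d W(1,2)] W(3)]
      by (simp only: component_comp op_comp.hyps mult.assoc)
  qed
  then show ?case by (auto simp: o_def)
qed


section \<open>Bialgebras given by separating functionals\<close>

lemma tensor_functional_flip:
  assumes "clinear l" "clinear m"
  shows "tensor_functional l m (tensor_flip t) = tensor_functional m l t"
proof (rule tensor_eqI)
  show "clinear (\<lambda>t. tensor_functional l m (tensor_flip t))" "clinear (tensor_functional m l)"
    by (intro clinear_compose[OF clinear_tensor_functional] clinear_tensor_functional clinear_intros assms)+
qed (simp add: tensor_functional_pure assms)

text \<open>This lemma and the next compute what functionals see of the two sides of the coassociativity law.\<close>

lemma tensor_functional_comult_left: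
  assumes l: "clinear l" "clinear m" "clinear n" and D: "clinear D"
  shows "tensor_functional l (tensor_functional m n) (tensor_assoc (tensor_map D id t)) =
    tensor_functional (\<lambda>x. tensor_functional l m (D x)) n t"
proof (rule tensor_eqI)
  have id: "clinear id" unfolding id_def by (rule clinear_id')
  have lmD: "clinear (\<lambda>x. tensor_functional l m (D x))"
    by (rule clinear_compose[OF clinear_tensor_functional[OF l(1,2)] D])
  show "clinear (\<lambda>t. tensor_functional l (tensor_functional m n) (tensor_assoc (tensor_map D id t)))"
    by (intro clinear_compose[OF clinear_tensor_functional] clinear_tensor_functional clinear_intros l D id)
  show "clinear (tensor_functional (\<lambda>x. tensor_functional l m (D x)) n)"
    by (intro clinear_tensor_functional lmD l)
  fix x y
  have "tensor_functional l (tensor_functional m n) (tensor_assoc (s \<otimes> y)) = tensor_functional l m s * n y" for s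
  proof (rule tensor_eqI)
    show "clinear (\<lambda>s. tensor_functional l (tensor_functional m n) (tensor_assoc (s \<otimes> y)))"
      by (intro clinear_compose[OF clinear_tensor_functional] clinear_tensor_functional clinear_intros l)
    show "clinear (\<lambda>s. tensor_functional l m s * n y)"
      by (intro clinear_intros clinear_tensor_functional l)
  qed (simp add: tensor_functional_pure l clinear_tensor_functional)
  then show "tensor_functional l (tensor_functional m n) (tensor_assoc (tensor_map D id (x \<otimes> y))) =
      tensor_functional (\<lambda>x. tensor_functional l m (D x)) n (x \<otimes> y)"
    by (simp add: tensor_map_pure D id tensor_functional_pure lmD l)
qed

lemma tensor_functional_comult_right:
  assumes l: "clinear l" "clinear m" "clinear n" and D: "clinear D"
  shows "tensor_functional l (tensor_functional m n) (tensor_map id D t) =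
    tensor_functional l (\<lambda>x. tensor_functional m n (D x)) t"
proof (rule tensor_eqI)
  have id: "clinear id" unfolding id_def by (rule clinear_id')
  have mnD: "clinear (\<lambda>x. tensor_functional m n (D x))"
    by (rule clinear_compose[OF clinear_tensor_functional[OF l(2,3)] D])
  show "clinear (\<lambda>t. tensor_functional l (tensor_functional m n) (tensor_map id D t))"
    by (intro clinear_compose[OF clinear_tensor_functional] clinear_tensor_functional clinear_intros l D id)
  show "clinear (tensor_functional l (\<lambda>x. tensor_functional m n (D x)))"
    by (intro clinear_tensor_functional mnD l)
  show "tensor_functional l (tensor_functional m n) (tensor_map id D (x \<otimes> y)) =
    tensor_functional l (\<lambda>x. tensor_functional m n (D x)) (x \<otimes> y)" for x y
    by (simp add: tensor_map_pure id D tensor_functional_pure l clinear_tensor_functional mnD)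
qed

text \<open>If the comultiplication is dual to a monoid structure on a separating family of functionals,
  then coassociativity and the counit law are dual to associativity and the unit law.\<close>

lemma coalgebra_if_separating:
  fixes B :: "('a::complex_space, 'm) bialgebra_data_scheme" and L :: "'p \<Rightarrow> 'a \<Rightarrow> complex"
  assumes sep: "separating L" and D: "clinear (comult B)"
    and mul: "\<And>p q x. tensor_functional (L p) (L q) (comult B x) = L (m p q) x"
    and assoc: "\<And>p q r x. L (m (m p q) r) x = L (m p (m q r)) x"
    and unit: "\<And>x. counit B x = L e x" "\<And>p x. L (m e p) x = L p x" "\<And>p x. L (m p e) x = L p x"
  shows "coalgebra B"
  unfolding coalgebra_def
proof (intro conjI allI)
  have L: "clinear (L p)" for p using sep by (simp add: separating_def)
  show "clinear (comult B)" by (rule D)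
  have "counit B = L e" using unit(1) by (rule ext)
  with L show e: "clinear (counit B)" by simp
  fix x
  show "tensor_assoc (tensor_map (comult B) id (comult B x)) = tensor_map id (comult B) (comult B x)"
  proof (rule separating_eqI[OF separating_tensor[OF sep separating_tensor[OF sep sep]]])
    fix s :: "'p \<times> 'p \<times> 'p"
    obtain p q r where s: "s = (p, q, r)" by (cases s)
    show "(case s of (p, q) \<Rightarrow> tensor_functional (L p) (case q of (p, q) \<Rightarrow> tensor_functional (L p) (L q)))
          (tensor_assoc (tensor_map (comult B) id (comult B x))) =
      (case s of (p, q) \<Rightarrow> tensor_functional (L p) (case q of (p, q) \<Rightarrow> tensor_functional (L p) (L q)))
          (tensor_map id (comult B) (comult B x))"
      using assoc by (simp add: s tensor_functional_comult_left tensor_functional_comult_right L D mul)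
  qed
  show "tensor_lift (\<lambda>x\<^sub>1 x\<^sub>2. counit B x\<^sub>1 *\<^sub>C x\<^sub>2) (comult B x) = x"
  proof (rule separating_eqI[OF sep])
    fix p
    have "L p (tensor_lift (\<lambda>x\<^sub>1 x\<^sub>2. counit B x\<^sub>1 *\<^sub>C x\<^sub>2) (comult B x)) =
        tensor_lift (\<lambda>x\<^sub>1 x\<^sub>2. L p (counit B x\<^sub>1 *\<^sub>C x\<^sub>2)) (comult B x)"
      by (rule clinear_tensor_lift_apply[OF L]) (intro clinear_intros e)+
    also have "\<dots> = tensor_functional (L e) (L p) (comult B x)"
      by (simp add: tensor_functional_def clinear_scale[OF L] unit(1))
    finally show "L p (tensor_lift (\<lambda>x\<^sub>1 x\<^sub>2. counit B x\<^sub>1 *\<^sub>C x\<^sub>2) (comult B x)) = L p x"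
      by (simp add: mul unit(2))
  qed
  show "tensor_lift (\<lambda>x\<^sub>1 x\<^sub>2. counit B x\<^sub>2 *\<^sub>C x\<^sub>1) (comult B x) = x"
  proof (rule separating_eqI[OF sep])
    fix p
    have "L p (tensor_lift (\<lambda>x\<^sub>1 x\<^sub>2. counit B x\<^sub>2 *\<^sub>C x\<^sub>1) (comult B x)) =
        tensor_lift (\<lambda>x\<^sub>1 x\<^sub>2. L p (counit B x\<^sub>2 *\<^sub>C x\<^sub>1)) (comult B x)"
      by (rule clinear_tensor_lift_apply[OF L]) (intro clinear_intros e)+
    also have "\<dots> = tensor_functional (L p) (L e) (comult B x)"
      by (simp add: tensor_functional_def clinear_scale[OF L] unit(1) scaleC_complex_def mult.commute)
    finally show "L p (tensor_lift (\<lambda>x\<^sub>1 x\<^sub>2. counit B x\<^sub>2 *\<^sub>C x\<^sub>1) (comult B x)) = L p x"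
      by (simp add: mul unit(3))
  qed
qed

lemma algebra_times_one:
  fixes B :: "('a::{complex_algebra, monoid_mult}, 'm) bialgebra_data_scheme"
  assumes "mult B = (*)" "unit B = 1"
  shows "algebra B"
  unfolding algebra_def assms by (auto intro!: clinear_intros simp: mult.assoc)


section \<open>Algebras of operators on the crossed product\<close>

locale operator_action =
  fixes app :: "'k::{complex_algebra, monoid_mult} \<Rightarrow> 'n::finite crossed \<Rightarrow> 'n crossed"
  assumes app_mem: "app k \<in> op_algebra kn_gens"
    and app_add: "app (k + l) a = app k a + app l a"
    and app_scale: "app (c *\<^sub>C k) a = c *\<^sub>C app k a"
    and app_mult: "app (k * l) a = app k (app l a)"
    and app_one: "app 1 a = a"
    and app_inject: "app k = app l \<Longrightarrow> k = l"
begin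

lemma clinear_app_left: "clinear F \<Longrightarrow> clinear (\<lambda>x. app (F x) a)"
  by (rule clinearI) (simp_all add: clinear_add clinear_scale app_add app_scale)

lemma clinear_app_right: "clinear F \<Longrightarrow> clinear (\<lambda>x. app k (F x))"
  by (rule clinear_compose[OF kn_op_linear[OF app_mem]])

text \<open>The functional \<open>k \<mapsto> k(f U*\<^sub>\<phi>)(x)\<close>.\<close>

definition eval_at :: "'n diffeo \<times> (real^'n) \<times> 'n test_fun \<Rightarrow> 'k \<Rightarrow> complex"
  where "eval_at = (\<lambda>(\<phi>, x, f) k. test_fun_app (component (app k) \<phi> f) x)"

lemma eval_at_apply: "eval_at (\<phi>, x, f) k = test_fun_app (component (app k) \<phi> f) x"
  by (simp add: eval_at_def)

lemma clinear_eval_at: "clinear (eval_at p)"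
  by (cases p, rule clinearI)
    (simp_all add: eval_at_apply component_def app_add app_scale lookup_add lookup_scaleC scaleC_complex_def)

lemma separating_eval_at: "separating eval_at"
  unfolding separating_def
proof (intro conjI allI impI clinear_eval_at)
  fix k assume k: "\<forall>p. eval_at p k = 0"
  have z: "eval_at p 0 = 0" for p by (rule clinear_0[OF clinear_eval_at])
  have "app k = app 0"
    by (rule kn_op_eqI) (use k z in \<open>simp_all add: app_mem eval_at_apply[symmetric]\<close>)
  then show "k = 0" by (rule app_inject)
qed

definition leibniz :: "'k \<Rightarrow> ('k, 'k) tensor \<Rightarrow> bool"
  where "leibniz k t \<longleftrightarrow> (\<forall>a b.
    app k (crossed_mult a b) = tensor_lift (\<lambda>k\<^sub>1 k\<^sub>2. crossed_mult (app k\<^sub>1 a) (app k\<^sub>2 b)) t)"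

lemma clinear_leibniz_rhs:
  "clinear (tensor_lift (\<lambda>k\<^sub>1 k\<^sub>2. crossed_mult (app k\<^sub>1 a) (app k\<^sub>2 b)))"
  by (intro clinear_tensor_lift clinear_crossed_mult_right clinear_crossed_mult_left
      clinear_app_left clinear_id')

lemma leibniz_rhs_pure:
  "tensor_lift (\<lambda>k\<^sub>1 k\<^sub>2. crossed_mult (app k\<^sub>1 a) (app k\<^sub>2 b)) (k \<otimes> l) = crossed_mult (app k a) (app l b)"
  by (intro tensor_lift_pure clinear_crossed_mult_right clinear_crossed_mult_left
      clinear_app_left clinear_id')

text \<open>Replacing \<open>\<phi>\<close> by a translate, which no operator notices, makes \<open>p\<close> and \<open>q\<close> composable.\<close>

definition point_mult (infixl "\<bullet>p" 70)
  where "point_mult = (\<lambda>(\<phi>, x, f) (\<psi>, y, g).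
    let \<theta> = diffeo_comp (translation (y - diffeo_map \<phi> x)) \<phi>
    in (diffeo_comp \<psi> \<theta>, x, f * test_fun_compose g \<theta>))"

text \<open>The Leibniz rule is applied to monomials whose base points fit together; left translation
  invariance then replaces the translate of \<open>\<phi>\<close> by \<open>\<phi>\<close> again.\<close>

lemma leibniz_eval_at:
  assumes "leibniz k t"
  shows "tensor_functional (eval_at p) (eval_at q) t = eval_at (p \<bullet>p q) k"
proof -
  obtain \<phi> x f \<psi> y g where p: "p = (\<phi>, x, f)" and q: "q = (\<psi>, y, g)" by (cases p, cases q)
  define \<theta> where "\<theta> = diffeo_comp (translation (y - diffeo_map \<phi> x)) \<phi>"
  have \<theta>: "diffeo_map \<theta> x = y" by (simp add: \<theta>_def)
  let ?E = "\<lambda>a. test_fun_app (Poly_Mapping.lookup a (diffeo_comp \<psi> \<theta>)) x"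
  have E: "clinear ?E"
    by (rule clinearI) (simp_all add: lookup_add lookup_scaleC scaleC_complex_def)
  have "eval_at (p \<bullet>p q) k = ?E (app k (crossed_mult (monom f \<theta>) (monom g \<psi>)))"
    by (simp add: p q point_mult_def Let_def \<theta>_def[symmetric] eval_at_apply component_def)
  also have "\<dots> = ?E (tensor_lift (\<lambda>k\<^sub>1 k\<^sub>2. crossed_mult (app k\<^sub>1 (monom f \<theta>)) (app k\<^sub>2 (monom g \<psi>))) t)"
    using assms by (simp only: leibniz_def)
  also have "\<dots> = tensor_functional (eval_at p) (eval_at q) t"
  proof (rule tensor_eqI)
    show "clinear (\<lambda>t. ?E (tensor_lift (\<lambda>k\<^sub>1 k\<^sub>2. crossed_mult (app k\<^sub>1 (monom f \<theta>)) (app k\<^sub>2 (monom g \<psi>))) t))"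
      by (rule clinear_compose[OF E clinear_leibniz_rhs])
    show "clinear (tensor_functional (eval_at p) (eval_at q))"
      by (intro clinear_tensor_functional clinear_eval_at)
    fix k l
    show "?E (tensor_lift (\<lambda>k\<^sub>1 k\<^sub>2. crossed_mult (app k\<^sub>1 (monom f \<theta>)) (app k\<^sub>2 (monom g \<psi>))) (k \<otimes> l)) =
        tensor_functional (eval_at p) (eval_at q) (k \<otimes> l)"
      unfolding leibniz_rhs_pure
      by (simp add: tensor_functional_pure clinear_eval_at kn_op_monom[OF app_mem]
          \<theta> p q eval_at_apply)
        (simp add: \<theta>_def component_left_translation[OF app_mem])
  qed
  finally show ?thesis by simp
qed

text \<open>The products of functionals separate the tensors, so the Leibniz rule leaves no choice.\<close>

lemma leibniz_unique: "leibniz k s \<Longrightarrow> leibniz k t \<Longrightarrow> s = t"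
  by (rule separating_eqI[OF separating_tensor[OF separating_eval_at separating_eval_at]])
    (auto simp: leibniz_eval_at)

lemma comult_of_action_eqI: "leibniz k t \<Longrightarrow> comult_of_action app k = t"
  unfolding comult_of_action_def leibniz_def[symmetric]
  by (rule the_equality) (auto intro: leibniz_unique)

lemma leibniz_one: "leibniz 1 (1 \<otimes> 1)"
  by (simp add: leibniz_def leibniz_rhs_pure app_one)

lemma leibniz_add: "leibniz k s \<Longrightarrow> leibniz l t \<Longrightarrow> leibniz (k + l) (s + t)"
  by (simp add: leibniz_def app_add clinear_add[OF clinear_leibniz_rhs])

lemma leibniz_scale: "leibniz k s \<Longrightarrow> leibniz (c *\<^sub>C k) (c *\<^sub>C s)"
  by (simp add: leibniz_def app_scale clinear_scale[OF clinear_leibniz_rhs])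

lemma leibniz_mult:
  assumes s: "leibniz k s" and t: "leibniz l t"
  shows "leibniz (k * l) (s * t)"
  unfolding leibniz_def
proof (intro allI)
  fix a b
  let ?A = "\<lambda>a b. tensor_lift (\<lambda>k\<^sub>1 k\<^sub>2. crossed_mult (app k\<^sub>1 a) (app k\<^sub>2 b))"
  have 1: "?A (app k\<^sub>1 a) (app k\<^sub>2 b) s = ?A a b (s * (k\<^sub>1 \<otimes> k\<^sub>2))" for k\<^sub>1 k\<^sub>2
  proof (rule tensor_eqI[where t = s])
    show "clinear (\<lambda>s. ?A a b (s * (k\<^sub>1 \<otimes> k\<^sub>2)))"
      by (intro clinear_compose[OF clinear_leibniz_rhs] clinear_intros)
  qed (simp_all add: clinear_leibniz_rhs leibniz_rhs_pure app_mult)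
  have 2: "app k (?A a b t) = ?A a b (s * t)"
  proof (rule tensor_eqI[where t = t])
    show "clinear (\<lambda>t. app k (?A a b t))" by (intro clinear_app_right clinear_leibniz_rhs)
    show "clinear (\<lambda>t. ?A a b (s * t))"
      by (intro clinear_compose[OF clinear_leibniz_rhs] clinear_intros)
    show "app k (?A a b (k\<^sub>1 \<otimes> k\<^sub>2)) = ?A a b (s * (k\<^sub>1 \<otimes> k\<^sub>2))" for k\<^sub>1 k\<^sub>2
      using s 1 by (simp add: leibniz_rhs_pure leibniz_def)
  qed
  show "app (k * l) (crossed_mult a b) = ?A a b (s * t)"
    using t 2 by (simp add: app_mult leibniz_def)
qed

definition base_point :: "'n diffeo \<times> (real^'n) \<times> 'n test_fun"
  where "base_point = (diffeo_id, 0, plateau 0)"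

text \<open>A test function that equals 1 near the origin determines the scalar.\<close>

lemma counit_of_action_eq:
  shows "counit_of_action app k = eval_at base_point k" (is ?eq)
    and "acts_by_scalar (app k) (counit_of_action app k)" (is ?scalar)
proof -
  obtain c where c: "acts_by_scalar (app k) c" using ex_acts_by_scalar[OF app_mem] by blast
  have b: "eval_at base_point k = c"
    using acts_by_scalarD[OF c, of "ball 0 1" "plateau 0" 1 0] plateau_eq_1[of _ 0]
    by (auto simp: base_point_def eval_at_apply)
  have look: "Poly_Mapping.lookup (app k (monom f diffeo_id)) \<phi> =
      (if \<phi> = diffeo_id then component (app k) diffeo_id f else 0)" for f \<phi>
    unfolding kn_op_monom[OF app_mem] by (simp add: lookup_single when_def)
  have "counit_of_action app k = c"
    unfolding counit_of_action_def
  proof (rule the_equality)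
    show "\<forall>f W. open W \<and> (\<forall>x\<in>W. test_fun_app f x = 1) \<longrightarrow>
      (\<forall>x\<in>W. \<forall>\<phi>. test_fun_app (Poly_Mapping.lookup (app k (monom f diffeo_id)) \<phi>) x =
        (if \<phi> = diffeo_id then c else 0))"
      using acts_by_scalarD[OF c, of _ _ 1] by (auto simp: look)
    fix d
    assume d: "\<forall>f W. open W \<and> (\<forall>x\<in>W. test_fun_app f x = 1) \<longrightarrow>
      (\<forall>x\<in>W. \<forall>\<phi>. test_fun_app (Poly_Mapping.lookup (app k (monom f diffeo_id)) \<phi>) x =
        (if \<phi> = diffeo_id then d else 0))"
    have pl: "\<forall>x\<in>ball 0 1. test_fun_app (plateau (0 :: real^'n)) x = 1"
      using plateau_eq_1[of _ 0] by blast
    have "test_fun_app (Poly_Mapping.lookup (app k (monom (plateau 0) diffeo_id)) diffeo_id) 0 =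
        (if (diffeo_id :: 'n diffeo) = diffeo_id then d else 0)"
      by (rule mp[OF spec[OF spec[OF d]], OF conjI[OF open_ball pl], THEN bspec, THEN spec]) simp
    then have "eval_at base_point k = d"
      by (simp add: look base_point_def eval_at_apply)
    with b show "d = c" by simp
  qed
  with b c show ?eq ?scalar by auto
qed

lemma counit_mult: "counit_of_action app (k * l) = counit_of_action app k * counit_of_action app l"
proof -
  have l: "test_fun_app (component (app l) diffeo_id (plateau 0)) x = counit_of_action app l" if "x \<in> ball 0 1" for x
    using acts_by_scalarD[OF counit_of_action_eq(2), of "ball 0 1" "plateau 0" 1 x l] that plateau_eq_1[of _ 0]
    by auto
  have kl: "app (k * l) = app k \<circ> app l" by (simp add: fun_eq_iff app_mult)
  have "eval_at base_point (k * l) = test_fun_app (component (app k) diffeo_id (component (app l) diffeo_id (plateau 0))) 0"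
    by (simp only: base_point_def eval_at_apply kl component_comp app_mem)
  also have "\<dots> = counit_of_action app k * counit_of_action app l"
    using acts_by_scalarD[OF counit_of_action_eq(2), of "ball 0 1" "component (app l) diffeo_id (plateau 0)" _ 0 k] l
    by simp
  finally show ?thesis by (simp add: counit_of_action_eq(1))
qed

lemma counit_one: "counit_of_action app 1 = 1"
proof -
  have "app 1 = id" by (simp add: fun_eq_iff app_one)
  then show ?thesis
    using plateau_eq_1[of 0 0] by (simp add: counit_of_action_eq(1) base_point_def eval_at_apply)
qed

lemma point_mult_assoc: "(p \<bullet>p q) \<bullet>p r = p \<bullet>p (q \<bullet>p r)"
proof -
  obtain \<phi> x f \<psi> y g \<theta> z h where p: "p = (\<phi>, x, f)" and q: "q = (\<psi>, y, g)" and r: "r = (\<theta>, z, h)"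
    by (cases p, cases q, cases r)
  show ?thesis
    unfolding p q r point_mult_def Let_def
    by (auto intro!: diffeo_eqI test_fun_eqI simp: mult.assoc)
qed

text \<open>The extra factor of the composition with the base point equals 1 near the point of evaluation, so
  locality removes it.\<close>

lemma eval_at_base_point_left: "eval_at (base_point \<bullet>p p) k = eval_at p k"
proof -
  obtain \<phi> y f where p: "p = (\<phi>, y, f)" by (cases p)
  let ?\<tau> = "translation y"
  have "base_point \<bullet>p p = (diffeo_comp \<phi> ?\<tau>, 0, plateau 0 * test_fun_compose f ?\<tau>)"
    by (simp add: p base_point_def point_mult_def Let_def)
  moreover have "test_fun_app (component (app k) (diffeo_comp \<phi> ?\<tau>) (plateau 0 * test_fun_compose f ?\<tau>)) 0 =
      test_fun_app (component (app k) (diffeo_comp \<phi> ?\<tau>) (test_fun_compose f ?\<tau>)) 0"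
    by (rule component_local[OF app_mem, of "ball 0 1"]) (auto simp: plateau_eq_1)
  ultimately show ?thesis
    by (simp add: p eval_at_apply component_right_translation[OF app_mem])
qed

lemma eval_at_base_point_right: "eval_at (p \<bullet>p base_point) k = eval_at p k"
proof -
  obtain \<phi> x f where p: "p = (\<phi>, x, f)" by (cases p)
  define \<theta> where "\<theta> = diffeo_comp (translation (0 - diffeo_map \<phi> x)) \<phi>"
  have \<theta>: "diffeo_map \<theta> x = 0" by (simp add: \<theta>_def)
  have pb: "p \<bullet>p base_point = (\<theta>, x, f * test_fun_compose (plateau 0) \<theta>)"
    by (simp add: p base_point_def point_mult_def \<theta>_def Let_def)
  have "open (diffeo_map \<theta> -` ball 0 1)"
    using smooth_continuous[OF smooth_diffeo] by (intro open_vimage continuous_at_imp_continuous_on) auto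
  then have "test_fun_app (component (app k) \<theta> (f * test_fun_compose (plateau 0) \<theta>)) x =
      test_fun_app (component (app k) \<theta> f) x"
    by (rule component_local[OF app_mem]) (auto simp: plateau_eq_1 \<theta>)
  then show ?thesis
    unfolding pb by (simp add: p eval_at_apply) (simp add: \<theta>_def component_left_translation[OF app_mem])
qed

definition action_data :: "'k bialgebra_data"
  where "action_data = \<lparr>mult = (*), unit = 1, comult = comult_of_action app, counit = counit_of_action app\<rparr>"

context
  assumes ex_leibniz: "\<And>k. \<exists>t. leibniz k t"
begin

lemma leibniz_comult: "leibniz k (comult_of_action app k)"
  using ex_leibniz[of k] comult_of_action_eqI by blast

lemma clinear_comult: "clinear (comult_of_action app)"
  by (rule clinearI; rule comult_of_action_eqI)
    (intro leibniz_add leibniz_scale leibniz_comult)+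

lemma comult_mult: "comult_of_action app (k * l) = comult_of_action app k * comult_of_action app l"
  by (intro comult_of_action_eqI leibniz_mult leibniz_comult)

lemma comult_one: "comult_of_action app 1 = 1 \<otimes> 1"
  by (intro comult_of_action_eqI leibniz_one)

lemma bialgebra_action_data: "bialgebra action_data"
  unfolding bialgebra_def
proof (intro conjI)
  show "algebra action_data" by (rule algebra_times_one) (simp_all add: action_data_def)
  show "coalgebra action_data"
    by (rule coalgebra_if_separating[OF separating_eval_at, of _ point_mult base_point])
      (simp_all add: action_data_def clinear_comult leibniz_eval_at[OF leibniz_comult] point_mult_assoc
        counit_of_action_eq(1) eval_at_base_point_left eval_at_base_point_right)
qed (simp_all add: action_data_def comult_mult comult_one counit_mult counit_one flip: times_tensor_def)

lemma bialgebra_cop_action_data: "bialgebra (cop action_data)"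
  unfolding bialgebra_def
proof (intro conjI)
  show "algebra (cop action_data)" by (rule algebra_times_one) (simp_all add: action_data_def cop_def)
  show "coalgebra (cop action_data)"
    by (rule coalgebra_if_separating[OF separating_eval_at, of _ "\<lambda>p q. point_mult q p" base_point])
      (simp_all add: action_data_def cop_def clinear_comult leibniz_eval_at[OF leibniz_comult] point_mult_assoc
        counit_of_action_eq(1) eval_at_base_point_left eval_at_base_point_right
        clinear_tensor_flip tensor_functional_flip clinear_eval_at)
qed (simp_all add: action_data_def cop_def comult_mult comult_one counit_mult counit_one tensor_flip_mult
    flip: times_tensor_def)

end

end


section \<open>The algebras \<open>\<K>\<^sub>n\<close> and \<open>\<K>\<^sub>a\<^sub>b\<close>\<close>

lemma op_sum: "(\<And>i. i \<in> I \<Longrightarrow> T i \<in> op_algebra G) \<Longrightarrow> (\<lambda>a. \<Sum>i\<in>I. T i a) \<in> op_algebra G"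
  by (induction I rule: infinite_finite_induct) (simp_all add: op_zero op_add)

instance kn :: (finite) complex_algebra
proof
  fix k l :: "'a kn" and c
  show "(c *\<^sub>C k) * l = c *\<^sub>C (k * l)" by transfer (simp add: fun_eq_iff)
  show "k * (c *\<^sub>C l) = c *\<^sub>C (k * l)"
    by transfer (simp add: fun_eq_iff clinear_scale[OF kn_op_linear])
qed

instance kab :: (finite) complex_algebra
proof
  fix k l :: "'a kab" and c
  show "(c *\<^sub>C k) * l = c *\<^sub>C (k * l)" by transfer (simp add: fun_eq_iff)
  show "k * (c *\<^sub>C l) = c *\<^sub>C (k * l)"
    by transfer (simp add: fun_eq_iff clinear_scale[OF op_algebra_linear[OF _ clinear_kab_gens]])
qed

interpretation kn: operator_action "kn_app :: 'n::finite kn \<Rightarrow> _"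
  by unfold_locales
    (use kn_app kn_app_inject in \<open>auto simp: plus_kn.rep_eq scaleC_kn.rep_eq times_kn.rep_eq one_kn.rep_eq\<close>)

lemma diag_op_apply:
  "(\<And>\<phi>. smooth (d \<phi>)) \<Longrightarrow>
    test_fun_app (Poly_Mapping.lookup (diag_op d a) \<phi>) x = d \<phi> x * test_fun_app (Poly_Mapping.lookup a \<phi>) x"
  by (simp add: lookup_diag_op test_fun_app_smult)

lemma crossed_eqI:
  "(\<And>\<phi> x. test_fun_app (Poly_Mapping.lookup a \<phi>) x = test_fun_app (Poly_Mapping.lookup b \<phi>) x) \<Longrightarrow> a = b"
  by (intro poly_mapping_eqI test_fun_eqI)

lemma diag_op_one: "diag_op (\<lambda>_ _. 1) = id"
  by (rule ext, rule crossed_eqI) (simp add: diag_op_apply smooth_const)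

lemma diag_op_add:
  "(\<And>\<phi>. smooth (d \<phi>)) \<Longrightarrow> (\<And>\<phi>. smooth (d' \<phi>)) \<Longrightarrow>
    diag_op (\<lambda>\<phi> x. d \<phi> x + d' \<phi> x) = (\<lambda>a. diag_op d a + diag_op d' a)"
  by (rule ext, rule crossed_eqI) (simp add: diag_op_apply smooth_add lookup_add distrib_right)

lemma diag_op_mult:
  "(\<And>\<phi>. smooth (d \<phi>)) \<Longrightarrow> (\<And>\<phi>. smooth (d' \<phi>)) \<Longrightarrow>
    diag_op (\<lambda>\<phi> x. d \<phi> x * d' \<phi> x) = diag_op d \<circ> diag_op d'"
  by (rule ext, rule crossed_eqI) (simp add: diag_op_apply smooth_times mult.assoc)

lemma diag_op_scale:
  "(\<And>\<phi>. smooth (d \<phi>)) \<Longrightarrow> diag_op (\<lambda>\<phi> x. c * d \<phi> x) = (\<lambda>a. c *\<^sub>C diag_op d a)"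
  by (rule ext, rule crossed_eqI)
    (simp add: diag_op_apply smooth_times smooth_const lookup_scaleC mult.assoc)

text \<open>By the product rule, the commutator with \<open>X\<^sub>l\<close> differentiates the symbol of a diagonal operator.\<close>

lemma commutator_X_diag_op:
  assumes "\<And>\<phi>. smooth (d \<phi>)"
  shows "diag_op (\<lambda>\<phi>. partial l (d \<phi>)) = (\<lambda>a. X_op l (diag_op d a) - diag_op d (X_op l a))"
proof (rule ext, rule crossed_eqI)
  fix a \<phi> x
  have "test_fun_app (test_fun_smult (d \<phi>) f) = (\<lambda>x. d \<phi> x * test_fun_app f x)" for f
    by (rule ext) (simp add: test_fun_app_smult assms)
  then show "test_fun_app (Poly_Mapping.lookup (diag_op (\<lambda>\<phi>. partial l (d \<phi>)) a) \<phi>) x =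
    test_fun_app (Poly_Mapping.lookup (X_op l (diag_op d a) - diag_op d (X_op l a)) \<phi>) x"
    by (simp add: diag_op_apply assms smooth_partial lookup_minus lookup_X_op lookup_diag_op
        test_fun_app_smult test_fun_app_partial partial_mult smooth_test_fun)
qed

lemma sigma_symbol_snoc: "sigma_symbol i (js @ [l]) \<phi> = partial l (sigma_symbol i js \<phi>)"
  unfolding sigma_symbol_def[abs_def]
  by (subst partial_linear_map[OF bounded_linear_of_real])
    (simp_all add: smooth_fold_partial smooth_nth smooth_diffeo)

lemma sigma_op_snoc: "sigma_op i (js @ [l]) = (\<lambda>a. X_op l (sigma_op i js a) - sigma_op i js (X_op l a))"
  unfolding sigma_op_alt commutator_X_diag_op[OF smooth_sigma_symbol, symmetric]
  by (simp add: sigma_symbol_snoc[abs_def])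

text \<open>Every further index is a commutator with some \<open>X\<^sub>l\<close>.\<close>

lemma sigma_op_in_kn: "js \<noteq> [] \<Longrightarrow> sigma_op i js \<in> op_algebra kn_gens"
proof (induction js rule: rev_induct)
  case (snoc l js)
  show ?case
  proof (cases "js = []")
    case True
    then show ?thesis by (auto intro!: op_gen simp: kn_gens_def)
  next
    case False
    have X: "X_op l \<in> op_algebra kn_gens" by (auto intro!: op_gen simp: kn_gens_def)
    note s = snoc.IH[OF False]
    show ?thesis unfolding sigma_op_snoc using op_diff[OF op_comp[OF X s] op_comp[OF s X]] by (simp add: o_def)
  qed
qed simp

lemma kab_op_in_kn: "T \<in> op_algebra kab_gens \<Longrightarrow> T \<in> op_algebra kn_gens"
proof (induction rule: op_algebra.induct)
  case (op_gen T)
  then consider i js where "js \<noteq> []" "T = sigma_op i js" | "T = sigma_inv_op"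
    by (auto simp: kab_gens_def)
  then show ?case
  proof cases
    case 1
    then show ?thesis by (simp add: sigma_op_in_kn)
  next
    case 2
    then show ?thesis by (auto simp: kn_gens_def intro!: op_algebra.op_gen)
  qed
qed (use op_id op_comp op_add op_scale in \<open>auto simp: id_def o_def\<close>)

interpretation kab: operator_action "kab_app :: 'n::finite kab \<Rightarrow> _"
  by unfold_locales
    (use kab_app kab_app_inject kab_op_in_kn in
      \<open>auto simp: plus_kab.rep_eq scaleC_kab.rep_eq times_kab.rep_eq one_kab.rep_eq\<close>)

lemma kn_app_kn_of_kab [simp]: "kn_app (kn_of_kab f) = kab_app f"
  by (simp add: kn_of_kab_def Abs_kn_inverse kab_op_in_kn kab_app)

lemma kn_of_kab_hom:
  "kn_of_kab (f + g) = kn_of_kab f + kn_of_kab g" "kn_of_kab (c *\<^sub>C f) = c *\<^sub>C kn_of_kab f"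
  "kn_of_kab (f * g) = kn_of_kab f * kn_of_kab g" "kn_of_kab 1 = 1"
  by (rule kn_app_inject[THEN iffD1], simp add: plus_kn.rep_eq plus_kab.rep_eq scaleC_kn.rep_eq
      scaleC_kab.rep_eq times_kn.rep_eq times_kab.rep_eq one_kn.rep_eq one_kab.rep_eq)+

lemma kn_of_kab_inject: "kn_of_kab f = kn_of_kab g \<longleftrightarrow> f = g"
  by (metis kn_app_kn_of_kab kab_app_inject)

lemma clinear_kn_of_kab [clinear_intros]: "clinear F \<Longrightarrow> clinear (\<lambda>x. kn_of_kab (F x))"
  by (rule clinearI) (simp_all add: clinear_add clinear_scale kn_of_kab_hom)

text \<open>Multiplication by \<open>\<phi>\<^sup>i\<close> itself does not belong to \<open>\<K>\<^sub>a\<^sub>b\<close>; the identity is the default value for the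
  empty list.\<close>

lift_definition kab_sigma_list :: "'n \<Rightarrow> 'n list \<Rightarrow> 'n::finite kab"
  is "\<lambda>i js. if js = [] then id else sigma_op i js"
  by (auto intro: op_id op_gen simp: kab_gens_def)

lift_definition kab_sigma_inv :: "'n::finite kab" is sigma_inv_op
  by (auto intro: op_gen simp: kab_gens_def)

lemma kab_induct [case_names one add scale mult sigma sigma_inv]:
  assumes "P 1" "\<And>f g. P f \<Longrightarrow> P g \<Longrightarrow> P (f + g)" "\<And>c f. P f \<Longrightarrow> P (c *\<^sub>C f)"
    "\<And>f g. P f \<Longrightarrow> P g \<Longrightarrow> P (f * g)"
    "\<And>i js. js \<noteq> [] \<Longrightarrow> P (kab_sigma_list i js)" "P kab_sigma_inv"
  shows "P (f :: 'n::finite kab)"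
proof -
  have "\<exists>f. kab_app f = T \<and> P f" if "T \<in> op_algebra kab_gens" for T
    using that
  proof (induction rule: op_algebra.induct)
    case op_id
    then show ?case using assms(1) one_kab.rep_eq by (auto simp: id_def)
  next
    case (op_gen T)
    then consider i js where "js \<noteq> []" "T = sigma_op i js" | "T = sigma_inv_op" by (auto simp: kab_gens_def)
    then show ?case
    proof cases
      case 1
      then show ?thesis using assms(5)[of js i] by (intro exI[of _ "kab_sigma_list i js"]) (simp add: kab_sigma_list.rep_eq)
    next
      case 2
      then show ?thesis using assms(6) kab_sigma_inv.rep_eq by blast
    qed
  next
    case (op_add S T)
    then show ?case using assms(2) plus_kab.rep_eq by metis
  next
    case (op_scale T c)
    then show ?case using assms(3) scaleC_kab.rep_eq by metis
  next
    case (op_comp S T)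
    then obtain f g where "kab_app f = S" "P f" "kab_app g = T" "P g" by blast
    then show ?case using assms(4) by (intro exI[of _ "f * g"]) (auto simp: times_kab.rep_eq)
  qed
  then show ?thesis using kab_app kab_app_inject by metis
qed

lemma kab_sigma_list_single: "kab_sigma_list i [j] = kab_sigma i j"
  by transfer simp

lemma kn_induct [case_names one add scale mult X sigma sigma_inv]:
  assumes "P 1" "\<And>f g. P f \<Longrightarrow> P g \<Longrightarrow> P (f + g)" "\<And>c f. P f \<Longrightarrow> P (c *\<^sub>C f)"
    "\<And>f g. P f \<Longrightarrow> P g \<Longrightarrow> P (f * g)"
    "\<And>k. P (kn_X k)" "\<And>i j. P (kn_of_kab (kab_sigma i j))" "P (kn_of_kab kab_sigma_inv)"
  shows "P (k :: 'n::finite kn)"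
proof -
  have "\<exists>k. kn_app k = T \<and> P k" if "T \<in> op_algebra kn_gens" for T
    using that
  proof (induction rule: op_algebra.induct)
    case op_id
    then show ?case using assms(1) one_kn.rep_eq by (auto simp: id_def)
  next
    case (op_gen T)
    then consider k where "T = X_op k" | i j where "T = sigma_op i [j]" | "T = sigma_inv_op"
      by (auto simp: kn_gens_def)
    then show ?case
    proof cases
      case (1 k)
      then show ?thesis using assms(5) kn_X.rep_eq by blast
    next
      case (2 i j)
      then show ?thesis using assms(6)[of i j] kab_sigma.rep_eq kn_app_kn_of_kab by metis
    next
      case 3
      then show ?thesis using assms(7) kab_sigma_inv.rep_eq kn_app_kn_of_kab by metis
    qed
  next
    case (op_add S T)
    then show ?case using assms(2) plus_kn.rep_eq by metis
  next
    case (op_scale T c)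
    then show ?case using assms(3) scaleC_kn.rep_eq by metis
  next
    case (op_comp S T)
    then obtain f g where "kn_app f = S" "P f" "kn_app g = T" "P g" by blast
    then show ?case using assms(4) by (intro exI[of _ "f * g"]) (auto simp: times_kn.rep_eq)
  qed
  then show ?thesis using kn_app kn_app_inject by metis
qed


section \<open>Symbols\<close>

text \<open>The functions \<open>\<gamma>(f)\<close>, \<open>f \<in> \<K>\<^sub>a\<^sub>b\<close>.\<close>

definition is_symbol :: "('n::finite diffeo \<Rightarrow> real^'n \<Rightarrow> complex) \<Rightarrow> bool"
  where "is_symbol d \<longleftrightarrow> (\<forall>\<phi>. smooth (d \<phi>)) \<and> diag_op d \<in> op_algebra kab_gens"

lemma is_symbol_const: "is_symbol (\<lambda>(_ :: 'n::finite diffeo) _. c)"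
proof -
  have "diag_op (\<lambda>(_ :: 'n diffeo) _. c) = (\<lambda>a. c *\<^sub>C id a)"
    using diag_op_scale[of "\<lambda>_ _. 1" c] by (simp add: smooth_const diag_op_one)
  then show ?thesis unfolding is_symbol_def by (simp only: op_scale[OF op_id] smooth_const simp_thms)
qed

lemma is_symbol_add: "is_symbol d \<Longrightarrow> is_symbol d' \<Longrightarrow> is_symbol (\<lambda>\<phi> x. d \<phi> x + d' \<phi> x)"
  by (simp add: is_symbol_def smooth_add diag_op_add op_add)

lemma is_symbol_mult: "is_symbol d \<Longrightarrow> is_symbol d' \<Longrightarrow> is_symbol (\<lambda>\<phi> x. d \<phi> x * d' \<phi> x)"
  by (simp add: is_symbol_def smooth_times diag_op_mult op_comp)

lemma is_symbol_sum: "(\<And>i. i \<in> I \<Longrightarrow> is_symbol (d i)) \<Longrightarrow> is_symbol (\<lambda>\<phi> x. \<Sum>i\<in>I. d i \<phi> x)"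
  by (induction I rule: infinite_finite_induct) (simp_all add: is_symbol_const is_symbol_add)

lemma is_symbol_prod: "(\<And>i. i \<in> I \<Longrightarrow> is_symbol (d i)) \<Longrightarrow> is_symbol (\<lambda>\<phi> x. \<Prod>i\<in>I. d i \<phi> x)"
  by (induction I rule: infinite_finite_induct) (simp_all add: is_symbol_const is_symbol_mult)

lemma is_symbol_sigma: "js \<noteq> [] \<Longrightarrow> is_symbol (sigma_symbol i js)"
  by (auto simp: is_symbol_def smooth_sigma_symbol kab_gens_def sigma_op_alt[symmetric] intro!: op_gen)

lemma is_symbol_sigma_inv: "is_symbol sigma_inv_symbol"
  by (auto simp: is_symbol_def smooth_sigma_inv_symbol kab_gens_def sigma_inv_op_alt[symmetric] intro!: op_gen)

lemma is_symbol_smooth: "is_symbol d \<Longrightarrow> smooth (d \<phi>)"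
  by (simp add: is_symbol_def)

definition det_symbol :: "'n::finite diffeo \<Rightarrow> real^'n \<Rightarrow> complex"
  where "det_symbol \<phi> x = of_real (det (jacobian (diffeo_map \<phi>) (at x)))"

lemma sigma_symbol_single: "sigma_symbol i [j] \<phi> x = of_real (jacobian (diffeo_map \<phi>) (at x) $ i $ j)"
  by (simp add: sigma_symbol_def jacobian_entry smooth_diffeo)

lemma det_symbol_eq:
  "det_symbol \<phi> x = (\<Sum>p | p permutes UNIV. of_int (sign p) * (\<Prod>i\<in>UNIV. sigma_symbol i [p i] \<phi> x))"
  by (simp add: det_symbol_def det_def sigma_symbol_single)

lemma det_sigma_inv_symbol: "det_symbol \<phi> x * sigma_inv_symbol \<phi> x = 1"
  using jacobian_det_pos[of \<phi> x] by (simp add: det_symbol_def sigma_inv_symbol_def flip: of_real_mult)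

lemma kab_app_eq_diag_op: "\<exists>d. is_symbol d \<and> kab_app f = diag_op d"
proof (induction f rule: kab_induct)
  case one
  show ?case using is_symbol_const[of 1] diag_op_one one_kab.rep_eq by metis
next
  case (add f g)
  then obtain d e where "is_symbol d" "kab_app f = diag_op d" "is_symbol e" "kab_app g = diag_op e" by blast
  then show ?case
    by (intro exI[of _ "\<lambda>\<phi> x. d \<phi> x + e \<phi> x"])
      (simp add: is_symbol_add diag_op_add is_symbol_smooth plus_kab.rep_eq)
next
  case (scale c f)
  then obtain d where "is_symbol d" "kab_app f = diag_op d" by blast
  then show ?case
    by (intro exI[of _ "\<lambda>\<phi> x. c * d \<phi> x"])
      (simp add: is_symbol_mult is_symbol_const diag_op_scale is_symbol_smooth scaleC_kab.rep_eq)
next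
  case (mult f g)
  then obtain d e where "is_symbol d" "kab_app f = diag_op d" "is_symbol e" "kab_app g = diag_op e" by blast
  then show ?case
    by (intro exI[of _ "\<lambda>\<phi> x. d \<phi> x * e \<phi> x"])
      (simp add: is_symbol_mult diag_op_mult is_symbol_smooth times_kab.rep_eq)
next
  case (sigma i js)
  then show ?case
    by (intro exI[of _ "sigma_symbol i js"]) (simp add: is_symbol_sigma kab_sigma_list.rep_eq sigma_op_alt)
next
  case sigma_inv
  then show ?case
    by (intro exI[of _ sigma_inv_symbol]) (simp add: is_symbol_sigma_inv kab_sigma_inv.rep_eq sigma_inv_op_alt)
qed

lemma kab_gamma_eqI:
  assumes "kab_app f = diag_op d" "\<And>\<phi>. smooth (d \<phi>)"
  shows "kab_gamma f = d"
proof
  fix \<psi>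
  show "kab_gamma f \<psi> = d \<psi>"
    unfolding kab_gamma_def
  proof (rule the_equality)
    show "smooth (d \<psi>) \<and> (\<forall>g. kab_app f (monom g \<psi>) = monom (test_fun_smult (d \<psi>) g) \<psi>)"
      by (simp add: assms)
    fix h assume h: "smooth h \<and> (\<forall>g. kab_app f (monom g \<psi>) = monom (test_fun_smult h g) \<psi>)"
    show "h = d \<psi>"
    proof
      fix x
      have "test_fun_smult h (plateau x) = test_fun_smult (d \<psi>) (plateau x)"
        using h by (metis assms(1) diag_op_monom lookup_single_eq)
      then have "h x * test_fun_app (plateau x) x = d \<psi> x * test_fun_app (plateau x) x"
        using h assms(2) by (metis test_fun_app_smult)
      then show "h x = d \<psi> x" by (simp add: plateau_eq_1)
    qed
  qed
qed

lemma is_symbol_gamma: "is_symbol (kab_gamma f)" and kab_app_gamma: "kab_app f = diag_op (kab_gamma f)"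
  using kab_app_eq_diag_op[of f] kab_gamma_eqI is_symbol_smooth by metis+

lemma smooth_gamma: "smooth (kab_gamma f \<phi>)"
  using is_symbol_gamma by (rule is_symbol_smooth)

lemma kab_eqI: "(\<And>\<phi> x. kab_gamma f \<phi> x = kab_gamma g \<phi> x) \<Longrightarrow> f = g"
  by (metis ext kab_app_gamma kab_app_inject)

definition kab_of_symbol :: "('n::finite diffeo \<Rightarrow> real^'n \<Rightarrow> complex) \<Rightarrow> 'n kab"
  where "kab_of_symbol d = Abs_kab (diag_op d)"

lemma kab_gamma_of_symbol: "is_symbol d \<Longrightarrow> kab_gamma (kab_of_symbol d) = d"
  by (rule kab_gamma_eqI) (simp_all add: kab_of_symbol_def Abs_kab_inverse is_symbol_def)

lemma kab_gamma_simps [simp]: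
  fixes \<phi> :: "'n::finite diffeo"
  shows "kab_gamma 1 \<phi> x = 1" "kab_gamma (f + g) \<phi> x = kab_gamma f \<phi> x + kab_gamma g \<phi> x"
  "kab_gamma (f * g) \<phi> x = kab_gamma f \<phi> x * kab_gamma g \<phi> x"
  "kab_gamma (c *\<^sub>C f) \<phi> x = c * kab_gamma f \<phi> x"
  "kab_gamma (kab_sigma i j) = sigma_symbol i [j]"
  "kab_gamma kab_sigma_inv = sigma_inv_symbol"
proof -
  have "kab_gamma (1 :: 'n kab) = (\<lambda>_ _. 1)"
    by (rule kab_gamma_eqI) (simp_all add: one_kab.rep_eq diag_op_one smooth_const)
  then show "kab_gamma 1 \<phi> x = 1" by simp
  have "kab_gamma (f + g) = (\<lambda>\<phi> x. kab_gamma f \<phi> x + kab_gamma g \<phi> x)"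
    by (rule kab_gamma_eqI)
      (simp_all add: plus_kab.rep_eq kab_app_gamma[of f] kab_app_gamma[of g] diag_op_add smooth_gamma smooth_add)
  then show "kab_gamma (f + g) \<phi> x = kab_gamma f \<phi> x + kab_gamma g \<phi> x" by simp
  have "kab_gamma (f * g) = (\<lambda>\<phi> x. kab_gamma f \<phi> x * kab_gamma g \<phi> x)"
    by (rule kab_gamma_eqI)
      (simp_all add: times_kab.rep_eq kab_app_gamma[of f] kab_app_gamma[of g] diag_op_mult smooth_gamma smooth_times)
  then show "kab_gamma (f * g) \<phi> x = kab_gamma f \<phi> x * kab_gamma g \<phi> x" by simp
  have "kab_gamma (c *\<^sub>C f) = (\<lambda>\<phi> x. c * kab_gamma f \<phi> x)"
    by (rule kab_gamma_eqI)
      (simp_all add: scaleC_kab.rep_eq kab_app_gamma[of f] diag_op_scale smooth_gamma smooth_times smooth_const)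
  then show "kab_gamma (c *\<^sub>C f) \<phi> x = c * kab_gamma f \<phi> x" by simp
  show "kab_gamma (kab_sigma i j) = sigma_symbol i [j]"
    by (rule kab_gamma_eqI) (simp_all add: kab_sigma.rep_eq sigma_op_alt smooth_sigma_symbol)
  show "kab_gamma kab_sigma_inv = sigma_inv_symbol"
    by (rule kab_gamma_eqI) (simp_all add: kab_sigma_inv.rep_eq sigma_inv_op_alt smooth_sigma_inv_symbol)
qed

lemma kab_gamma_zero [simp]: "kab_gamma 0 \<phi> x = 0"
  using kab_gamma_simps(4)[of 0 0 \<phi> x] by simp

lemma kab_gamma_sum: "kab_gamma (\<Sum>i\<in>I. f i) \<phi> x = (\<Sum>i\<in>I. kab_gamma (f i) \<phi> x)"
proof -
  have "clinear (\<lambda>f. kab_gamma f \<phi> x)" by (rule clinearI) (simp_all add: scaleC_complex_def)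
  from clinear_setsum[OF this] show ?thesis .
qed

lemma kab_gamma_sigma_list: "js \<noteq> [] \<Longrightarrow> kab_gamma (kab_sigma_list i js) = sigma_symbol i js"
  by (rule kab_gamma_eqI) (simp_all add: kab_sigma_list.rep_eq sigma_op_alt smooth_sigma_symbol)

lemma is_symbol_partial_mult:
  assumes "is_symbol d" "is_symbol e" "\<And>l. is_symbol (\<lambda>\<phi>. partial l (d \<phi>))" "\<And>l. is_symbol (\<lambda>\<phi>. partial l (e \<phi>))"
  shows "is_symbol (\<lambda>\<phi>. partial l (\<lambda>x. d \<phi> x * e \<phi> x))"
  by (simp add: partial_mult assms is_symbol_smooth is_symbol_add is_symbol_mult)

lemma is_symbol_partial_add:
  assumes "is_symbol d" "is_symbol e" "\<And>l. is_symbol (\<lambda>\<phi>. partial l (d \<phi>))" "\<And>l. is_symbol (\<lambda>\<phi>. partial l (e \<phi>))"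
  shows "is_symbol (\<lambda>\<phi>. partial l (\<lambda>x. d \<phi> x + e \<phi> x))"
  by (simp add: partial_add assms is_symbol_smooth is_symbol_add)

lemma is_symbol_partial_sigma: "js \<noteq> [] \<Longrightarrow> is_symbol (\<lambda>\<phi>. partial l (sigma_symbol i js \<phi>))"
  using is_symbol_sigma[of "js @ [l]" i] by (simp add: sigma_symbol_snoc[abs_def])

lemma is_symbol_partial_det: "is_symbol (\<lambda>\<phi>. partial l (det_symbol \<phi>))"
proof -
  have prod: "is_symbol (\<lambda>\<phi>. partial l (\<lambda>x. \<Prod>i\<in>I. sigma_symbol i [p i] \<phi> x))" for I :: "'a set" and p l
  proof (induction I arbitrary: l rule: infinite_finite_induct)
    case (insert i I)
    then show ?case
      by (simp add: is_symbol_partial_mult is_symbol_sigma is_symbol_prod is_symbol_partial_sigma)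
  qed (simp_all add: partial_const is_symbol_const)
  have sum: "is_symbol (\<lambda>\<phi>. partial l (\<lambda>x. \<Sum>p\<in>A. of_int (sign p) * (\<Prod>i\<in>UNIV. sigma_symbol i [p i] \<phi> x)))"
    for A :: "('a \<Rightarrow> 'a) set" and l
  proof (induction A arbitrary: l rule: infinite_finite_induct)
    case (insert p A)
    then show ?case
      by (simp add: is_symbol_partial_add is_symbol_partial_mult is_symbol_sigma is_symbol_prod
          is_symbol_sum is_symbol_mult is_symbol_const prod partial_const)
  qed (simp_all add: partial_const is_symbol_const)
  then show ?thesis using sum[of l "{p. p permutes UNIV}"] by (simp add: det_symbol_eq[abs_def])
qed

lemma is_symbol_det: "is_symbol det_symbol"
  unfolding det_symbol_eq[abs_def]
  by (intro is_symbol_sum is_symbol_mult is_symbol_const is_symbol_prod is_symbol_sigma) simp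

text \<open>The Jacobian determinant is a polynomial in the \<open>\<sigma>\<^sup>i\<^sub>j\<close>, so its derivatives are symbols; differentiating
  the product with its inverse carries this over to the inverse.\<close>

lemma is_symbol_partial_sigma_inv: "is_symbol (\<lambda>\<phi>. partial l (sigma_inv_symbol \<phi>))"
proof -
  have "partial l (sigma_inv_symbol \<phi>) x =
      (-1) * (sigma_inv_symbol \<phi> x * (sigma_inv_symbol \<phi> x * partial l (det_symbol \<phi>) x))" for \<phi> :: "'a diffeo" and x
  proof -
    have "partial l (\<lambda>x. det_symbol \<phi> x * sigma_inv_symbol \<phi> x) x = 0"
      by (simp add: det_sigma_inv_symbol partial_const)
    then have "det_symbol \<phi> x * partial l (sigma_inv_symbol \<phi>) x =
        - (partial l (det_symbol \<phi>) x * sigma_inv_symbol \<phi> x)"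
      by (simp add: partial_mult is_symbol_smooth is_symbol_det is_symbol_sigma_inv eq_neg_iff_add_eq_0)
    moreover have "sigma_inv_symbol \<phi> x * (det_symbol \<phi> x * y) = y" for y
      using det_sigma_inv_symbol[of \<phi> x] by (simp only: mult.assoc[symmetric] mult.commute[of "sigma_inv_symbol \<phi> x"] mult_1)
    ultimately have "partial l (sigma_inv_symbol \<phi>) x =
        sigma_inv_symbol \<phi> x * - (partial l (det_symbol \<phi>) x * sigma_inv_symbol \<phi> x)" by metis
    then show ?thesis by simp
  qed
  then have "(\<lambda>\<phi>. partial l (sigma_inv_symbol \<phi>)) = (\<lambda>\<phi> x.
      (-1) * (sigma_inv_symbol \<phi> x * (sigma_inv_symbol \<phi> x * partial l (det_symbol \<phi>) x)))"
    by (simp add: fun_eq_iff)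
  then show ?thesis
    by (simp only:) (intro is_symbol_mult is_symbol_const is_symbol_sigma_inv is_symbol_partial_det)
qed

lemma kab_gamma_fun: "kab_gamma (f + g) \<phi> = (\<lambda>x. kab_gamma f \<phi> x + kab_gamma g \<phi> x)"
  "kab_gamma (f * g) \<phi> = (\<lambda>x. kab_gamma f \<phi> x * kab_gamma g \<phi> x)"
  "kab_gamma (c *\<^sub>C f) \<phi> = (\<lambda>x. c * kab_gamma f \<phi> x)"
  "kab_gamma 1 \<phi> = (\<lambda>x. 1)"
  by (rule ext, simp)+

lemma is_symbol_partial: "is_symbol (\<lambda>\<phi>. partial l (kab_gamma f \<phi>))"
proof (induction f arbitrary: l rule: kab_induct)
  case one
  show ?case by (simp add: kab_gamma_fun partial_const is_symbol_const)
next
  case (add f g)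
  then show ?case by (simp add: kab_gamma_fun is_symbol_partial_add is_symbol_gamma)
next
  case (scale c f)
  then show ?case
    by (simp add: kab_gamma_fun is_symbol_partial_mult is_symbol_gamma is_symbol_const partial_const)
next
  case (mult f g)
  then show ?case by (simp add: kab_gamma_fun is_symbol_partial_mult is_symbol_gamma)
next
  case (sigma i js)
  then show ?case by (simp add: kab_gamma_sigma_list is_symbol_partial_sigma)
next
  case sigma_inv
  then show ?case by (simp add: is_symbol_partial_sigma_inv)
qed

definition kab_D :: "'n \<Rightarrow> 'n::finite kab \<Rightarrow> 'n kab"
  where "kab_D l f = kab_of_symbol (\<lambda>\<phi>. partial l (kab_gamma f \<phi>))"

lemma kab_gamma_D [simp]: "kab_gamma (kab_D l f) \<phi> = partial l (kab_gamma f \<phi>)"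
  by (simp add: kab_D_def kab_gamma_of_symbol is_symbol_partial)

lemma kn_of_kab_D: "kn_of_kab (kab_D l f) = kn_X l * kn_of_kab f - kn_of_kab f * kn_X l"
proof -
  have "kab_app (kab_D l f) = (\<lambda>a. X_op l (kab_app f a) - kab_app f (X_op l a))"
    unfolding kab_app_gamma commutator_X_diag_op[OF smooth_gamma, symmetric]
    by (rule arg_cong[where f = diag_op]) (rule ext, simp)
  then show ?thesis
    by (intro kn_app_inject[THEN iffD1]) (simp add: minus_kn.rep_eq times_kn.rep_eq kn_X.rep_eq fun_eq_iff)
qed

lemma kab_D_commute: "kab_D k (kab_D l f) = kab_D l (kab_D k f)"
  by (rule kab_eqI) (simp add: partial_commute smooth_gamma)

lemma kab_D_sigma: "kab_D l (kab_sigma i j) = kab_D j (kab_sigma i l)"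
proof (rule kab_eqI)
  have "sigma_symbol i [] \<phi> = (\<lambda>x. of_real (diffeo_map \<phi> x $ i))" for \<phi> :: "'a diffeo"
    by (simp add: sigma_symbol_def fun_eq_iff)
  then have "smooth (sigma_symbol i [] \<phi>)" for \<phi> :: "'a diffeo" by (rule ssubst) (intro smooth_of_real smooth_nth smooth_diffeo)
  then show "kab_gamma (kab_D l (kab_sigma i j)) \<phi> x = kab_gamma (kab_D j (kab_sigma i l)) \<phi> x" for \<phi> x
    using sigma_symbol_snoc[of i "[]"] by (simp add: partial_commute)
qed

lemma kab_D_mult: "kab_D l (f * g) = kab_D l f * g + f * kab_D l g"
  by (rule kab_eqI) (simp add: kab_gamma_fun partial_mult smooth_gamma)

lemma clinear_kab_D [clinear_intros]:
  assumes "clinear F"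
  shows "clinear (\<lambda>x. kab_D l (F x))"
proof (rule clinear_compose[OF _ assms])
  show "clinear (kab_D l)"
    by (rule clinearI; rule kab_eqI)
      (simp_all add: kab_gamma_fun partial_add partial_mult smooth_gamma smooth_const partial_const)
qed

lemma kab_D_one [simp]: "kab_D l 1 = 0"
proof -
  show ?thesis by (intro kab_eqI) (simp add: kab_gamma_fun partial_const)
qed

lemma kab_sigma_list_snoc: "js \<noteq> [] \<Longrightarrow> kab_sigma_list i (js @ [l]) = kab_D l (kab_sigma_list i js)"
  by (rule kab_eqI) (simp add: kab_gamma_sigma_list sigma_symbol_snoc)


section \<open>The antipode of \<open>\<K>\<^sub>a\<^sub>b\<close>\<close>

text \<open>The involution \<open>(f U*\<^sub>\<phi>)\<^sup># = (f \<circ> \<phi>\<^sup>-\<^sup>1) U*\<^bsub>\<phi>\<^sup>-\<^sup>1\<^esub>\<close>. Conjugation with it is the antipode on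
  \<open>\<K>\<^sub>a\<^sub>b\<close> and an algebra homomorphism on \<open>\<K>\<^sub>n\<close>.\<close>

definition sharp :: "'n::finite crossed \<Rightarrow> 'n crossed"
  where "sharp a = (\<Sum>\<phi>\<in>Poly_Mapping.keys a.
    monom (test_fun_compose (Poly_Mapping.lookup a \<phi>) (diffeo_inv \<phi>)) (diffeo_inv \<phi>))"

lemma sharp_superset:
  assumes "finite A" "Poly_Mapping.keys a \<subseteq> A"
  shows "sharp a = (\<Sum>\<phi>\<in>A. monom (test_fun_compose (Poly_Mapping.lookup a \<phi>) (diffeo_inv \<phi>)) (diffeo_inv \<phi>))"
  unfolding sharp_def by (rule sum.mono_neutral_left) (use assms in \<open>auto simp: in_keys_iff\<close>)

lemma sharp_monom [simp]: "sharp (monom f \<phi>) = monom (test_fun_compose f (diffeo_inv \<phi>)) (diffeo_inv \<phi>)"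
  by (subst sharp_superset[where A = "{\<phi>}"]) (auto simp: lookup_single)

lemma clinear_sharp: "clinear sharp"
proof (rule clinearI)
  fix a b :: "'a crossed" and c :: complex
  let ?A = "Poly_Mapping.keys a \<union> Poly_Mapping.keys b"
  have "Poly_Mapping.keys (a + b) \<subseteq> ?A" by (rule keys_add)
  then show "sharp (a + b) = sharp a + sharp b"
    by (subst (1 2 3) sharp_superset[where A = ?A])
      (auto simp: lookup_add monom_add sum.distrib test_fun_compose_linear)
  have "Poly_Mapping.keys (c *\<^sub>C a) \<subseteq> Poly_Mapping.keys a"
    by (auto simp: in_keys_iff lookup_scaleC)
  then show "sharp (c *\<^sub>C a) = c *\<^sub>C sharp a"
    by (subst (1 2) sharp_superset[where A = "Poly_Mapping.keys a"])
      (auto simp: lookup_scaleC monom_scale complex_space.scale_sum_right test_fun_compose_linear)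
qed

lemma clinear_crossed_eqI:
  assumes "clinear F" "clinear G" "\<And>f \<phi>. F (monom f \<phi>) = G (monom f \<phi>)"
  shows "F = G"
proof
  show "F a = G a" for a
    by (induction a rule: crossed_induct) (simp_all add: assms clinear_add[OF assms(1)] clinear_add[OF assms(2)])
qed

lemma sharp_sharp [simp]: "sharp (sharp a) = a"
proof -
  have "(\<lambda>a. sharp (sharp a)) = (\<lambda>a. a)"
    by (rule clinear_crossed_eqI)
      (auto intro: clinear_compose clinear_sharp clinear_id' test_fun_eqI intro!: arg_cong2[where f = Poly_Mapping.single])
  then show ?thesis by (rule fun_cong)
qed

definition sharp_symbol :: "('n::finite diffeo \<Rightarrow> real^'n \<Rightarrow> complex) \<Rightarrow> 'n diffeo \<Rightarrow> real^'n \<Rightarrow> complex"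
  where "sharp_symbol d \<phi> x = d (diffeo_inv \<phi>) (diffeo_map \<phi> x)"

lemma smooth_sharp_symbol: "(\<And>\<phi>. smooth (d \<phi>)) \<Longrightarrow> smooth (sharp_symbol d \<phi>)"
  unfolding sharp_symbol_def[abs_def] by (rule smooth_compose[OF _ smooth_diffeo]) auto

lemma sharp_diag_op:
  assumes "\<And>\<phi>. smooth (d \<phi>)"
  shows "sharp \<circ> diag_op d \<circ> sharp = diag_op (sharp_symbol d)"
proof (rule clinear_crossed_eqI)
  show "clinear (sharp \<circ> diag_op d \<circ> sharp)"
    unfolding o_def by (intro clinear_compose[OF clinear_sharp] clinear_compose[OF clinear_diag_op] clinear_sharp)
  show "clinear (diag_op (sharp_symbol d))" by (rule clinear_diag_op)
  show "(sharp \<circ> diag_op d \<circ> sharp) (monom f \<phi>) = diag_op (sharp_symbol d) (monom f \<phi>)" for f \<phi>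
    by (auto intro!: arg_cong2[where f = Poly_Mapping.single] test_fun_eqI
        simp: test_fun_app_smult assms smooth_sharp_symbol sharp_symbol_def)
qed

text \<open>The chain rule for \<open>h = (h \<circ> \<phi>) \<circ> \<phi>\<^sup>-\<^sup>1\<close>.\<close>

lemma partial_at_diffeo:
  fixes h :: "real^'n::finite \<Rightarrow> complex"
  assumes "smooth h"
  shows "partial l h (diffeo_map \<phi> x) =
    (\<Sum>m\<in>UNIV. sharp_symbol (sigma_symbol m [l]) \<phi> x * partial m (\<lambda>x. h (diffeo_map \<phi> x)) x)"
proof -
  have "smooth (\<lambda>x. h (diffeo_map \<phi> x))" by (rule smooth_compose[OF assms smooth_diffeo])
  from fun_cong[OF partial_compose[OF this smooth_diffeo[of "diffeo_inv \<phi>"], of l], of "diffeo_map \<phi> x"]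
  show ?thesis
    by (simp add: sharp_symbol_def sigma_symbol_def scaleR_conv_of_real)
qed

lemma inverse_jacobian:
  "(\<Sum>m\<in>UNIV. sharp_symbol (sigma_symbol m [l]) \<phi> x * sigma_symbol i [m] \<phi> x) = (if i = l then 1 else 0)"
proof -
  let ?h = "\<lambda>y :: real^'a. of_real (y $ i) :: complex"
  have "partial l ?h = (\<lambda>x. of_real (if i = l then 1 else 0))"
    by (simp add: partial_linear_map[OF bounded_linear_of_real] smooth_nth smooth_ident partial_nth)
  moreover have "partial m (\<lambda>x. ?h (diffeo_map \<phi> x)) x = sigma_symbol i [m] \<phi> x" for m
    by (simp add: partial_linear_map[OF bounded_linear_of_real] smooth_nth smooth_diffeo sigma_symbol_def)
  moreover have "smooth ?h" by (intro smooth_of_real smooth_nth smooth_ident)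
  ultimately have "of_real (if i = l then 1 else 0) =
      (\<Sum>m\<in>UNIV. sharp_symbol (sigma_symbol m [l]) \<phi> x * sigma_symbol i [m] \<phi> x)"
    using partial_at_diffeo[of ?h l \<phi> x] by simp
  then show ?thesis by (cases "i = l") simp_all
qed

lemma inverse_jacobian':
  "(\<Sum>k\<in>UNIV. sigma_symbol k [j] \<phi> x * sharp_symbol (sigma_symbol i [k]) \<phi> x) = (if i = j then 1 else 0)"
  using inverse_jacobian[of j "diffeo_inv \<phi>" "diffeo_map \<phi> x" i]
  by (simp add: sharp_symbol_def)

text \<open>Cramer's rule expresses the entries of the inverse Jacobian matrix as polynomials in the \<open>\<sigma>\<^sup>i\<^sub>j\<close>
  times \<open>\<sigma>\<^sup>-\<^sup>1\<close>.\<close>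

lemma is_symbol_sharp_sigma: "is_symbol (sharp_symbol (sigma_symbol m [l]))"
proof -
  let ?B = "\<lambda>\<phi> x. \<chi> i j. if j = m then (if i = l then 1 else 0) else jacobian (diffeo_map \<phi>) (at x) $ i $ j"
  have cr: "sharp_symbol (sigma_symbol m [l]) \<phi> x =
      of_real (det (?B \<phi> x) / det (jacobian (diffeo_map \<phi>) (at x)))" for \<phi> :: "'a diffeo" and x
  proof -
    let ?A = "jacobian (diffeo_map \<phi>) (at x)"
    define v where "v = (\<chi> m. jacobian (diffeo_map (diffeo_inv \<phi>)) (at (diffeo_map \<phi> x)) $ m $ l)"
    have v: "of_real (v $ m) = sharp_symbol (sigma_symbol m [l]) \<phi> x" for m
      by (simp add: v_def sharp_symbol_def sigma_symbol_single)
    have "of_real ((?A *v v) $ i) = (of_real (axis l 1 $ i) :: complex)" for i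
      using inverse_jacobian[of l \<phi> x i]
      by (simp add: matrix_vector_mult_def axis_def v[symmetric] sigma_symbol_single mult.commute
          flip: of_real_mult of_real_sum)
    then have "?A *v v = axis l 1" by (simp only: vec_eq_iff of_real_eq_iff simp_thms)
    then have "v = (\<chi> k. det (\<chi> i j. if j = k then axis l 1 $ i else ?A $ i $ j) / det ?A)"
      using cramer[of ?A v "axis l 1"] jacobian_det_pos[of \<phi> x] by simp
    from arg_cong[OF this, of "\<lambda>v. v $ m"]
    have "v $ m = det (\<chi> i j. if j = m then axis l 1 $ i else ?A $ i $ j) / det ?A" by (simp only: vec_lambda_beta)
    moreover have "(\<chi> i j. if j = m then axis l 1 $ i else ?A $ i $ j) = ?B \<phi> x"
      by (simp add: vec_eq_iff axis_def)
    ultimately show ?thesis by (simp flip: v)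
  qed
  have "sharp_symbol (sigma_symbol m [l]) = (\<lambda>\<phi> x. sigma_inv_symbol \<phi> x *
      (\<Sum>p | p permutes UNIV. of_int (sign p) *
        (\<Prod>i\<in>UNIV. (if p i = m then (if i = l then 1 else 0) else sigma_symbol i [p i] \<phi> x))))"
    by (intro ext, subst cr)
      (simp add: det_def sigma_inv_symbol_def sigma_symbol_single divide_inverse mult.commute
        if_distrib[where f = of_real] cong: if_cong)
  moreover have "is_symbol (\<lambda>\<phi> x. if p i = m then (if i = l then 1 else 0) else sigma_symbol i [p i] \<phi> x)"
    for p and i :: 'a
    by (cases "p i = m") (simp_all add: is_symbol_const is_symbol_sigma)
  ultimately show ?thesis
    by (simp only:) (intro is_symbol_mult is_symbol_sigma_inv is_symbol_sum is_symbol_const is_symbol_prod)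
qed

lemma sharp_symbol_sigma_inv: "sharp_symbol sigma_inv_symbol = det_symbol"
proof (intro ext)
  fix \<phi> :: "'a diffeo" and x
  have "diffeo_map (diffeo_inv \<phi>) \<circ> diffeo_map \<phi> = id" by (simp add: fun_eq_iff)
  then have "det (jacobian (diffeo_map (diffeo_inv \<phi>)) (at (diffeo_map \<phi> x))) * det (jacobian (diffeo_map \<phi>) (at x)) = 1"
    using det_jacobian_compose[OF smooth_diffeo smooth_diffeo, of "diffeo_inv \<phi>" \<phi> x]
    by (simp add: jacobian_def matrix_id_mat_1)
  then have "inverse (det (jacobian (diffeo_map (diffeo_inv \<phi>)) (at (diffeo_map \<phi> x)))) = det (jacobian (diffeo_map \<phi>) (at x))"
    by (rule inverse_unique)
  then show "sharp_symbol sigma_inv_symbol \<phi> x = det_symbol \<phi> x"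
    by (simp add: sharp_symbol_def sigma_inv_symbol_def det_symbol_def)
qed

lemma is_symbol_partial': "is_symbol d \<Longrightarrow> is_symbol (\<lambda>\<phi>. partial l (d \<phi>))"
  using is_symbol_partial[of l "kab_of_symbol d"] by (simp add: kab_gamma_of_symbol)

text \<open>The chain rule writes \<open>(\<partial>\<^sub>l h) \<circ> \<phi>\<close>, with \<open>h\<close> a derivative of \<open>\<phi>\<^sup>-\<^sup>1\<close> of lower order, through the inverse
  Jacobian matrix and derivatives of \<open>h \<circ> \<phi>\<close>, to which the induction hypothesis applies.\<close>

lemma is_symbol_sharp_sigma_list: "js \<noteq> [] \<Longrightarrow> is_symbol (sharp_symbol (sigma_symbol i js))"
proof (induction js rule: rev_induct)
  case (snoc l js)
  show ?case
  proof (cases "js = []")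
    case True
    then show ?thesis by (simp add: is_symbol_sharp_sigma)
  next
    case False
    have "sharp_symbol (sigma_symbol i (js @ [l])) = (\<lambda>\<phi> x. \<Sum>m\<in>UNIV.
        sharp_symbol (sigma_symbol m [l]) \<phi> x * partial m (sharp_symbol (sigma_symbol i js) \<phi>) x)"
      using partial_at_diffeo[OF smooth_sigma_symbol, of l i js]
      by (simp add: sharp_symbol_def[of "sigma_symbol i _", abs_def] sigma_symbol_snoc fun_eq_iff)
    then show ?thesis
      by (simp only:) (intro is_symbol_sum is_symbol_mult is_symbol_sharp_sigma is_symbol_partial' snoc.IH False)
  qed
qed simp

lemma is_symbol_sharp_gamma: "is_symbol (sharp_symbol (kab_gamma f))"
proof (induction f rule: kab_induct)
  case one
  have "sharp_symbol (kab_gamma (1 :: 'a kab)) = (\<lambda>_ _. 1)" by (simp add: sharp_symbol_def fun_eq_iff)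
  then show ?case by (simp only: is_symbol_const)
next
  case (add f g)
  have "sharp_symbol (kab_gamma (f + g)) = (\<lambda>\<phi> x. sharp_symbol (kab_gamma f) \<phi> x + sharp_symbol (kab_gamma g) \<phi> x)"
    by (simp add: sharp_symbol_def fun_eq_iff)
  with add show ?case by (simp only: is_symbol_add)
next
  case (scale c f)
  have "sharp_symbol (kab_gamma (c *\<^sub>C f)) = (\<lambda>\<phi> x. c * sharp_symbol (kab_gamma f) \<phi> x)"
    by (simp add: sharp_symbol_def fun_eq_iff)
  with scale show ?case by (simp only: is_symbol_mult is_symbol_const)
next
  case (mult f g)
  have "sharp_symbol (kab_gamma (f * g)) = (\<lambda>\<phi> x. sharp_symbol (kab_gamma f) \<phi> x * sharp_symbol (kab_gamma g) \<phi> x)"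
    by (simp add: sharp_symbol_def fun_eq_iff)
  with mult show ?case by (simp only: is_symbol_mult)
next
  case (sigma i js)
  then show ?case by (simp add: kab_gamma_sigma_list is_symbol_sharp_sigma_list)
next
  case sigma_inv
  then show ?case by (simp add: sharp_symbol_sigma_inv is_symbol_det)
qed

lemma kab_gamma_antipode: "kab_gamma (kab_antipode f) = sharp_symbol (kab_gamma f)"
proof -
  let ?d = "sharp_symbol (kab_gamma f)"
  have d: "kab_gamma f (diffeo_inv \<psi>) \<circ> diffeo_map \<psi> = ?d \<psi>" for \<psi>
    by (simp add: fun_eq_iff sharp_symbol_def)
  let ?s = "kab_of_symbol ?d"
  have s: "kab_gamma ?s = ?d" by (rule kab_gamma_of_symbol[OF is_symbol_sharp_gamma])
  have "kab_antipode f = ?s"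
    unfolding kab_antipode_def d
  proof (rule the_equality)
    show "\<forall>g \<psi>. kab_app ?s (monom g \<psi>) = monom (test_fun_smult (?d \<psi>) g) \<psi>"
      by (simp add: kab_app_gamma[of ?s] s)
    fix s' assume s': "\<forall>g \<psi>. kab_app s' (monom g \<psi>) = monom (test_fun_smult (?d \<psi>) g) \<psi>"
    have "kab_app s' = kab_app ?s"
      by (rule clinear_crossed_eqI)
        (simp_all add: s' kab_app_gamma[of ?s] s kn_op_linear[OF kab.app_mem] clinear_diag_op)
    then show "s' = ?s" by (simp add: kab_app_inject)
  qed
  with s show ?thesis by simp
qed

lemma kab_antipode_sigma_left: "(\<Sum>k\<in>UNIV. kab_antipode (kab_sigma k j) * kab_sigma i k) = (if i = j then 1 else 0)"
proof (rule kab_eqI)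
  show "kab_gamma (\<Sum>k\<in>UNIV. kab_antipode (kab_sigma k j) * kab_sigma i k) \<phi> x =
      kab_gamma (if i = j then 1 else 0) \<phi> x" for \<phi> x
    using inverse_jacobian[of j \<phi> x i] by (simp add: kab_gamma_sum kab_gamma_antipode)
qed

lemma kab_antipode_sigma_right: "(\<Sum>k\<in>UNIV. kab_sigma k j * kab_antipode (kab_sigma i k)) = (if i = j then 1 else 0)"
proof (rule kab_eqI)
  show "kab_gamma (\<Sum>k\<in>UNIV. kab_sigma k j * kab_antipode (kab_sigma i k)) \<phi> x =
      kab_gamma (if i = j then 1 else 0) \<phi> x" for \<phi> x
    using inverse_jacobian'[of j \<phi> x i] by (simp add: kab_gamma_sum kab_gamma_antipode)
qed

lemma kab_antipode_sigma_inv: "kab_antipode kab_sigma_inv * kab_sigma_inv = 1"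
  by (rule kab_eqI) (simp add: kab_gamma_antipode sharp_symbol_sigma_inv det_sigma_inv_symbol)

lemma clinear_kab_antipode [clinear_intros]: "clinear F \<Longrightarrow> clinear (\<lambda>x. kab_antipode (F x))"
proof -
  have "clinear (kab_antipode :: 'b kab \<Rightarrow> _)"
    by (rule clinearI; rule kab_eqI) (simp_all add: kab_gamma_antipode sharp_symbol_def)
  from clinear_compose[OF this] show "clinear F \<Longrightarrow> clinear (\<lambda>x. kab_antipode (F x :: 'b kab))" .
qed

lemma kab_antipode_mult: "kab_antipode (f * g) = kab_antipode f * kab_antipode g"
  by (rule kab_eqI) (simp_all add: kab_gamma_antipode sharp_symbol_def)

lemma kab_antipode_one: "kab_antipode 1 = 1"
  by (rule kab_eqI) (simp_all add: kab_gamma_antipode sharp_symbol_def)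

text \<open>Differentiating \<open>f \<circ> \<phi>\<^sup>-\<^sup>1\<close> and pulling back along \<open>\<phi>\<close> brings in the inverse Jacobian matrix.\<close>

lemma sharp_X_op: "sharp \<circ> X_op l \<circ> sharp = (\<lambda>a. \<Sum>k\<in>UNIV. diag_op (sharp_symbol (sigma_symbol k [l])) (X_op k a))"
proof (rule clinear_crossed_eqI)
  show "clinear (sharp \<circ> X_op l \<circ> sharp)"
    unfolding o_def by (intro clinear_compose[OF clinear_sharp] clinear_compose[OF clinear_X_op] clinear_sharp)
  show "clinear (\<lambda>a. \<Sum>k\<in>UNIV. diag_op (sharp_symbol (sigma_symbol k [l])) (X_op k a))"
    by (intro clinear_sum clinear_compose[OF clinear_diag_op] clinear_X_op)
  fix f :: "'a test_fun" and \<phi> :: "'a diffeo"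
  have s: "(\<Sum>k\<in>I. monom (g k) \<phi>) = monom (\<Sum>k\<in>I. g k) \<phi>" for I :: "'a set" and g
    by (induction I rule: infinite_finite_induct) (simp_all add: monom_add)
  have f: "test_fun_app (test_fun_compose f (diffeo_inv \<phi>)) = (\<lambda>y. test_fun_app f (diffeo_map (diffeo_inv \<phi>) y))"
    by (rule ext) simp
  have "smooth (\<lambda>y. test_fun_app f (diffeo_map (diffeo_inv \<phi>) y))"
    by (rule smooth_compose[OF smooth_test_fun smooth_diffeo])
  from partial_at_diffeo[OF this, of l \<phi>]
  show "(sharp \<circ> X_op l \<circ> sharp) (monom f \<phi>) =
      (\<Sum>k\<in>UNIV. diag_op (sharp_symbol (sigma_symbol k [l])) (X_op k (monom f \<phi>)))"
    by (auto simp: s test_fun_app_partial f test_fun_app_sum test_fun_app_smult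
        smooth_sharp_symbol smooth_sigma_symbol
        intro!: arg_cong2[where f = Poly_Mapping.single] test_fun_eqI)
qed

lemma sharp_kab_in_kn: "sharp \<circ> kab_app f \<circ> sharp \<in> op_algebra kn_gens"
proof -
  have "sharp \<circ> kab_app f \<circ> sharp = diag_op (sharp_symbol (kab_gamma f))"
    by (simp only: kab_app_gamma[of f] sharp_diag_op[OF smooth_gamma])
  moreover have "diag_op (sharp_symbol (kab_gamma f)) \<in> op_algebra kab_gens"
    using is_symbol_sharp_gamma[of f] unfolding is_symbol_def by (rule conjunct2)
  ultimately show ?thesis using kab_op_in_kn by simp
qed

lemma sharp_in_kn: "sharp \<circ> kn_app k \<circ> sharp \<in> op_algebra kn_gens"
proof (induction k rule: kn_induct)
  case one
  have "sharp \<circ> kn_app (1 :: 'a kn) \<circ> sharp = id" by (simp add: one_kn.rep_eq fun_eq_iff)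
  then show ?case by (simp only: op_id)
next
  case (add f g)
  have "sharp \<circ> kn_app (f + g) \<circ> sharp = (\<lambda>a. (sharp \<circ> kn_app f \<circ> sharp) a + (sharp \<circ> kn_app g \<circ> sharp) a)"
    by (simp add: plus_kn.rep_eq fun_eq_iff clinear_add[OF clinear_sharp])
  with op_add[OF add] show ?case by (simp only:)
next
  case (scale c f)
  have "sharp \<circ> kn_app (c *\<^sub>C f) \<circ> sharp = (\<lambda>a. c *\<^sub>C (sharp \<circ> kn_app f \<circ> sharp) a)"
    by (simp add: scaleC_kn.rep_eq fun_eq_iff clinear_scale[OF clinear_sharp])
  with op_scale[OF scale] show ?case by (simp only:)
next
  case (mult f g)
  have "sharp \<circ> kn_app (f * g) \<circ> sharp = (sharp \<circ> kn_app f \<circ> sharp) \<circ> (sharp \<circ> kn_app g \<circ> sharp)"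
    by (simp add: times_kn.rep_eq fun_eq_iff)
  with op_comp[OF mult] show ?case by (simp only:)
next
  case (X l)
  have "diag_op (sharp_symbol (sigma_symbol k [l])) \<in> op_algebra kn_gens" for k
    using is_symbol_sharp_sigma kab_op_in_kn by (auto simp: is_symbol_def)
  moreover have "X_op k \<in> op_algebra kn_gens" for k by (auto intro!: op_gen simp: kn_gens_def)
  ultimately have "diag_op (sharp_symbol (sigma_symbol k [l])) \<circ> X_op k \<in> op_algebra kn_gens" for k
    by (rule op_comp)
  note XX = this
  have "sharp \<circ> kn_app (kn_X l) \<circ> sharp =
      (\<lambda>a. \<Sum>k\<in>UNIV. (diag_op (sharp_symbol (sigma_symbol k [l])) \<circ> X_op k) a)"
    by (simp only: kn_X.rep_eq sharp_X_op o_apply)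
  then show ?case by (simp only: op_sum[OF XX])
next
  case (sigma i j)
  show ?case by (simp only: kn_app_kn_of_kab sharp_kab_in_kn)
next
  case sigma_inv
  show ?case by (simp only: kn_app_kn_of_kab sharp_kab_in_kn)
qed

definition kn_sharp :: "'n::finite kn \<Rightarrow> 'n kn"
  where "kn_sharp k = Abs_kn (sharp \<circ> kn_app k \<circ> sharp)"

lemma kn_app_sharp: "kn_app (kn_sharp k) a = sharp (kn_app k (sharp a))"
  by (simp add: kn_sharp_def Abs_kn_inverse sharp_in_kn)

lemma kn_eqI: "(\<And>a. kn_app k a = kn_app l a) \<Longrightarrow> k = l"
  by (metis ext kn_app_inject)

lemma clinear_kn_sharp [clinear_intros]: "clinear F \<Longrightarrow> clinear (\<lambda>x. kn_sharp (F x))"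
proof -
  have "clinear (kn_sharp :: 'b kn \<Rightarrow> _)"
    by (rule clinearI; rule kn_eqI)
      (simp_all add: kn_app_sharp plus_kn.rep_eq scaleC_kn.rep_eq clinear_add[OF clinear_sharp] clinear_scale[OF clinear_sharp])
  from clinear_compose[OF this] show "clinear F \<Longrightarrow> clinear (\<lambda>x. kn_sharp (F x :: 'b kn))" .
qed

lemma kn_sharp_mult: "kn_sharp (k * l) = kn_sharp k * kn_sharp l"
  by (rule kn_eqI) (simp add: kn_app_sharp times_kn.rep_eq)

lemma kn_sharp_one [simp]: "kn_sharp 1 = 1"
  by (rule kn_eqI) (simp add: kn_app_sharp one_kn.rep_eq)

lemma kn_sharp_sharp [simp]: "kn_sharp (kn_sharp k) = k"
  by (rule kn_eqI) (simp add: kn_app_sharp)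

lemma kn_sharp_of_kab: "kn_sharp (kn_of_kab f) = kn_of_kab (kab_antipode f)"
proof (rule kn_eqI)
  fix a
  have "sharp \<circ> kab_app f \<circ> sharp = kab_app (kab_antipode f)"
    by (simp only: kab_app_gamma[of f] kab_app_gamma[of "kab_antipode f"] kab_gamma_antipode
        sharp_diag_op[OF smooth_gamma])
  then show "kn_app (kn_sharp (kn_of_kab f)) a = kn_app (kn_of_kab (kab_antipode f)) a"
    by (simp add: kn_app_sharp fun_eq_iff)
qed

lemma kn_sum_app: "kn_app (\<Sum>i\<in>I. k i) a = (\<Sum>i\<in>I. kn_app (k i) a)"
  using clinear_setsum[OF kn.clinear_app_left[OF clinear_id']] by blast

lemma kn_sharp_X: "kn_sharp (kn_X l) = (\<Sum>k\<in>UNIV. kn_of_kab (kab_antipode (kab_sigma k l)) * kn_X k)"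
proof (rule kn_eqI)
  fix a
  show "kn_app (kn_sharp (kn_X l)) a = kn_app (\<Sum>k\<in>UNIV. kn_of_kab (kab_antipode (kab_sigma k l)) * kn_X k) a"
    using fun_cong[OF sharp_X_op[of l], of a]
    by (simp add: kn_app_sharp kn_sum_app times_kn.rep_eq kn_X.rep_eq kab_app_gamma[of "kab_antipode _"]
        kab_gamma_antipode)
qed


section \<open>The coproducts of \<open>\<K>\<^sub>a\<^sub>b\<close> and \<open>\<K>\<^sub>n\<close>\<close>

lemma (in operator_action) leibniz_monomI:
  assumes "\<And>f \<phi> g \<psi>. app k (monom (f * test_fun_compose g \<phi>) (diffeo_comp \<psi> \<phi>)) =
    tensor_lift (\<lambda>k\<^sub>1 k\<^sub>2. crossed_mult (app k\<^sub>1 (monom f \<phi>)) (app k\<^sub>2 (monom g \<psi>))) t"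
  shows "leibniz k t"
proof -
  have "(\<lambda>b. app k (crossed_mult (monom f \<phi>) b)) =
      (\<lambda>b. tensor_lift (\<lambda>k\<^sub>1 k\<^sub>2. crossed_mult (app k\<^sub>1 (monom f \<phi>)) (app k\<^sub>2 b)) t)" for f \<phi>
    by (rule clinear_crossed_eqI)
      (simp_all add: assms clinear_app_right clinear_crossed_mult_right clinear_lift_param clinear_id')
  then have "(\<lambda>a. app k (crossed_mult a b)) =
      (\<lambda>a. tensor_lift (\<lambda>k\<^sub>1 k\<^sub>2. crossed_mult (app k\<^sub>1 a) (app k\<^sub>2 b)) t)" for b
    by (intro clinear_crossed_eqI)
      (simp_all add: fun_eq_iff clinear_app_right clinear_crossed_mult_left clinear_lift_param clinear_id')
  then show ?thesis by (simp add: leibniz_def fun_eq_iff)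
qed

lemma monom_sum: "monom (\<Sum>k\<in>I. g k) \<phi> = (\<Sum>k\<in>I. monom (g k) \<phi>)"
  by (induction I rule: infinite_finite_induct) (simp_all add: monom_add)

lemma partial_real_compose:
  fixes f :: "real^'n \<Rightarrow> complex"
  assumes "smooth f"
  shows "partial l (\<lambda>x. f (diffeo_map \<phi> x)) x =
    (\<Sum>k\<in>UNIV. sigma_symbol k [l] \<phi> x * partial k f (diffeo_map \<phi> x))"
  using partial_compose[OF assms smooth_diffeo, of l \<phi>]
  by (simp add: sigma_symbol_def scaleR_conv_of_real)

lemma kn_leibniz_X: "kn.leibniz (kn_X l) (kn_X l \<otimes> 1 + (\<Sum>k\<in>UNIV. kn_of_kab (kab_sigma k l) \<otimes> kn_X k))"
proof (rule kn.leibniz_monomI)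
  fix f g :: "'a test_fun" and \<phi> \<psi> :: "'a diffeo"
  have "test_fun_app (f * test_fun_compose g \<phi>) = (\<lambda>x. test_fun_app f x * test_fun_app g (diffeo_map \<phi> x))"
    by (simp add: fun_eq_iff)
  then have "test_fun_partial l (f * test_fun_compose g \<phi>) = test_fun_partial l f * test_fun_compose g \<phi> +
      (\<Sum>k\<in>UNIV. test_fun_smult (sigma_symbol k [l] \<phi>) f * test_fun_compose (test_fun_partial k g) \<phi>)"
    by (intro test_fun_eqI)
      (simp add: test_fun_app_partial test_fun_app_sum test_fun_app_smult smooth_sigma_symbol partial_mult
        smooth_test_fun smooth_compose[OF smooth_test_fun smooth_diffeo] partial_real_compose
        sum_distrib_left mult_ac)
  then show "kn_app (kn_X l) (monom (f * test_fun_compose g \<phi>) (diffeo_comp \<psi> \<phi>)) =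
    tensor_lift (\<lambda>k\<^sub>1 k\<^sub>2. crossed_mult (kn_app k\<^sub>1 (monom f \<phi>)) (kn_app k\<^sub>2 (monom g \<psi>)))
     (kn_X l \<otimes> 1 + (\<Sum>k\<in>UNIV. kn_of_kab (kab_sigma k l) \<otimes> kn_X k))"
    unfolding clinear_add[OF kn.clinear_leibniz_rhs] clinear_setsum[OF kn.clinear_leibniz_rhs] kn.leibniz_rhs_pure
    by (simp add: kn_X.rep_eq one_kn.rep_eq kab_sigma.rep_eq sigma_op_alt monom_add monom_sum)
qed

lemma kab_leibniz_sigma: "kab.leibniz (kab_sigma i j) (\<Sum>k\<in>UNIV. kab_sigma k j \<otimes> kab_sigma i k)"
proof (rule kab.leibniz_monomI)
  fix f g :: "'a test_fun" and \<phi> \<psi> :: "'a diffeo"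
  have "sigma_symbol i [j] (diffeo_comp \<psi> \<phi>) x =
      (\<Sum>k\<in>UNIV. sigma_symbol k [j] \<phi> x * sigma_symbol i [k] \<psi> (diffeo_map \<phi> x))" for x
    using partial_compose[OF smooth_nth[OF smooth_diffeo[of \<psi>], of i] smooth_diffeo[of \<phi>], of j]
    by (simp add: sigma_symbol_def)
  then have "test_fun_smult (sigma_symbol i [j] (diffeo_comp \<psi> \<phi>)) (f * test_fun_compose g \<phi>) =
      (\<Sum>k\<in>UNIV. test_fun_smult (sigma_symbol k [j] \<phi>) f * test_fun_compose (test_fun_smult (sigma_symbol i [k] \<psi>) g) \<phi>)"
    by (intro test_fun_eqI)
      (simp add: test_fun_app_sum test_fun_app_smult smooth_sigma_symbol sum_distrib_left sum_distrib_right mult_ac)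
  then show "kab_app (kab_sigma i j) (monom (f * test_fun_compose g \<phi>) (diffeo_comp \<psi> \<phi>)) =
    tensor_lift (\<lambda>k\<^sub>1 k\<^sub>2. crossed_mult (kab_app k\<^sub>1 (monom f \<phi>)) (kab_app k\<^sub>2 (monom g \<psi>)))
     (\<Sum>k\<in>UNIV. kab_sigma k j \<otimes> kab_sigma i k)"
    unfolding clinear_setsum[OF kab.clinear_leibniz_rhs] kab.leibniz_rhs_pure
    by (simp add: kab_sigma.rep_eq sigma_op_alt monom_sum)
qed

lemma kab_leibniz_sigma_inv: "kab.leibniz kab_sigma_inv (kab_sigma_inv \<otimes> kab_sigma_inv)"
proof (rule kab.leibniz_monomI)
  fix f g :: "'a test_fun" and \<phi> \<psi> :: "'a diffeo"
  have "diffeo_map (diffeo_comp \<psi> \<phi>) = diffeo_map \<psi> \<circ> diffeo_map \<phi>" by (simp add: fun_eq_iff)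
  then have "sigma_inv_symbol (diffeo_comp \<psi> \<phi>) x = sigma_inv_symbol \<phi> x * sigma_inv_symbol \<psi> (diffeo_map \<phi> x)" for x
    using det_jacobian_compose[OF smooth_diffeo smooth_diffeo, of \<psi> \<phi> x] by (simp add: sigma_inv_symbol_def)
  then have "test_fun_smult (sigma_inv_symbol (diffeo_comp \<psi> \<phi>)) (f * test_fun_compose g \<phi>) =
      test_fun_smult (sigma_inv_symbol \<phi>) f * test_fun_compose (test_fun_smult (sigma_inv_symbol \<psi>) g) \<phi>"
    by (intro test_fun_eqI) (simp add: test_fun_app_smult smooth_sigma_inv_symbol mult_ac)
  then show "kab_app kab_sigma_inv (monom (f * test_fun_compose g \<phi>) (diffeo_comp \<psi> \<phi>)) =
    tensor_lift (\<lambda>k\<^sub>1 k\<^sub>2. crossed_mult (kab_app k\<^sub>1 (monom f \<phi>)) (kab_app k\<^sub>2 (monom g \<psi>)))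
     (kab_sigma_inv \<otimes> kab_sigma_inv)"
    unfolding kab.leibniz_rhs_pure by (simp add: kab_sigma_inv.rep_eq sigma_inv_op_alt)
qed

lemma kab_app_D: "kab_app (kab_D l f) a = X_op l (kab_app f a) - kab_app f (X_op l a)"
  using arg_cong[OF kn_of_kab_D[of l f], of kn_app]
  by (simp add: minus_kn.rep_eq times_kn.rep_eq kn_X.rep_eq fun_eq_iff)

lemma X_op_crossed_mult:
  "X_op l (crossed_mult a b) = crossed_mult (X_op l a) b +
    (\<Sum>k\<in>UNIV. crossed_mult (kab_app (kab_sigma k l) a) (X_op k b))"
  using kn_leibniz_X[of l]
  unfolding kn.leibniz_def clinear_add[OF kn.clinear_leibniz_rhs] clinear_setsum[OF kn.clinear_leibniz_rhs]
    kn.leibniz_rhs_pure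
  by (simp add: kn_X.rep_eq one_kn.rep_eq)

lemma clinear_tensor_map': "clinear f \<Longrightarrow> clinear g \<Longrightarrow> clinear (tensor_map f g)"
  using clinear_tensor_map[OF _ _ clinear_id'] .

text \<open>The coproduct of \<open>[X\<^sub>l, f]\<close> is the commutator of the coproducts of \<open>X\<^sub>l\<close> and \<open>f\<close>.\<close>

lemma kab_leibniz_D:
  assumes t: "kab.leibniz f t"
  shows "kab.leibniz (kab_D l f) (tensor_map (kab_D l) id t + (\<Sum>k\<in>UNIV. tensor_map ((*) (kab_sigma k l)) (kab_D k) t))"
  unfolding kab.leibniz_def
proof (intro allI)
  fix a b
  let ?A = "\<lambda>a b. tensor_lift (\<lambda>k\<^sub>1 k\<^sub>2. crossed_mult (kab_app k\<^sub>1 a) (kab_app k\<^sub>2 b))"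
  let ?t' = "\<lambda>t. tensor_map (kab_D l) id t + (\<Sum>k\<in>UNIV. tensor_map ((*) (kab_sigma k l)) (kab_D k) t)"
  have lin: "clinear (kab_D k)" "clinear ((*) (kab_sigma k l))" "clinear (id :: 'a kab \<Rightarrow> _)" for k
    using clinear_kab_D[OF clinear_id'] clinear_mult_right[OF clinear_id'] clinear_id' by (auto simp: id_def)
  have A: "clinear (?A a b)" for a b by (rule kab.clinear_leibniz_rhs)
  have X: "clinear (X_op k)" for k by (rule clinear_X_op)
  have Am: "clinear (\<lambda>a. crossed_mult a b)" "clinear (crossed_mult a)" for a b :: "'a crossed"
    by (intro clinear_crossed_mult_left clinear_crossed_mult_right clinear_id')+
  have comm: "kab_app g (kab_app (kab_sigma k l) a) = kab_app (kab_sigma k l) (kab_app g a)" for g k a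
    by (metis kab.app_mult mult.commute)
  have "X_op l (?A a b t) - ?A (X_op l a) b t - (\<Sum>k\<in>UNIV. ?A (kab_app (kab_sigma k l) a) (X_op k b) t) = ?A a b (?t' t)"
  proof (rule tensor_eqI[where t = t])
    show "clinear (\<lambda>t. X_op l (?A a b t) - ?A (X_op l a) b t - (\<Sum>k\<in>UNIV. ?A (kab_app (kab_sigma k l) a) (X_op k b) t))"
      by (intro clinear_minus clinear_sum A clinear_compose[OF X A])
    show "clinear (\<lambda>t. ?A a b (?t' t))"
      by (intro clinear_compose[OF A] clinear_plus clinear_sum clinear_tensor_map' lin)
    fix g h
    show "X_op l (?A a b (g \<otimes> h)) - ?A (X_op l a) b (g \<otimes> h) -
        (\<Sum>k\<in>UNIV. ?A (kab_app (kab_sigma k l) a) (X_op k b) (g \<otimes> h)) = ?A a b (?t' (g \<otimes> h))"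
      unfolding tensor_map_pure[OF lin(1) lin(3)] tensor_map_pure[OF lin(2) lin(1)]
        clinear_add[OF A] clinear_setsum[OF A] kab.leibniz_rhs_pure id_apply
      by (simp add: X_op_crossed_mult kab_app_D kab.app_mult comm clinear_diff[OF Am(1)] clinear_diff[OF Am(2)]
          sum_subtractf)
  qed
  moreover have "kab_app f (crossed_mult c d) = ?A c d t" for c d using t by (simp add: kab.leibniz_def)
  ultimately show "kab_app (kab_D l f) (crossed_mult a b) = ?A a b (?t' t)"
    by (simp add: kab_app_D X_op_crossed_mult clinear_add[OF kn_op_linear[OF kab.app_mem]]
        clinear_setsum[OF kn_op_linear[OF kab.app_mem]] diff_diff_eq)
qed

text \<open>The \<open>\<sigma>\<^sup>i\<^sub>j\<close> have an explicit coproduct, and each further index is a derivation \<open>[X\<^sub>l, \<cdot>]\<close>.\<close>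

lemma kab_ex_leibniz: "\<exists>t. kab.leibniz f t"
proof (induction f rule: kab_induct)
  case (sigma i js)
  then show ?case
  proof (induction js rule: rev_induct)
    case (snoc l js)
    show ?case
    proof (cases "js = []")
      case True
      then show ?thesis using kab_leibniz_sigma by (auto simp: kab_sigma_list_single)
    next
      case False
      then obtain t where "kab.leibniz (kab_sigma_list i js) t" using snoc.IH by blast
      from kab_leibniz_D[OF this] show ?thesis
        unfolding kab_sigma_list_snoc[OF False] by (rule exI)
    qed
  qed simp
qed (blast intro: kab.leibniz_one kab.leibniz_add kab.leibniz_scale kab.leibniz_mult kab_leibniz_sigma_inv)+

lemma clinear_kn_of_kab': "clinear kn_of_kab"
  by (rule clinear_kn_of_kab[OF clinear_id'])

lemma kn_leibniz_of_kab: "kab.leibniz f t \<Longrightarrow> kn.leibniz (kn_of_kab f) (tensor_map kn_of_kab kn_of_kab t)"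
proof -
  have "tensor_lift (\<lambda>k\<^sub>1 k\<^sub>2. crossed_mult (kab_app k\<^sub>1 a) (kab_app k\<^sub>2 b)) t =
      tensor_lift (\<lambda>k\<^sub>1 k\<^sub>2. crossed_mult (kn_app k\<^sub>1 a) (kn_app k\<^sub>2 b)) (tensor_map kn_of_kab kn_of_kab t)" for a b
  proof (rule tensor_eqI[where t = t])
    show "clinear (tensor_lift (\<lambda>k\<^sub>1 k\<^sub>2. crossed_mult (kab_app k\<^sub>1 a) (kab_app k\<^sub>2 b)))"
      by (rule kab.clinear_leibniz_rhs)
    show "clinear (\<lambda>t. tensor_lift (\<lambda>k\<^sub>1 k\<^sub>2. crossed_mult (kn_app k\<^sub>1 a) (kn_app k\<^sub>2 b)) (tensor_map kn_of_kab kn_of_kab t))"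
      by (intro clinear_compose[OF kn.clinear_leibniz_rhs] clinear_tensor_map' clinear_kn_of_kab')
  qed (simp only: tensor_map_pure[OF clinear_kn_of_kab' clinear_kn_of_kab'] kn.leibniz_rhs_pure
      kab.leibniz_rhs_pure kn_app_kn_of_kab)
  then show "kab.leibniz f t \<Longrightarrow> kn.leibniz (kn_of_kab f) (tensor_map kn_of_kab kn_of_kab t)"
    by (simp add: kn.leibniz_def kab.leibniz_def)
qed

lemma kn_ex_leibniz: "\<exists>t. kn.leibniz k t"
proof (induction k rule: kn_induct)
  case (sigma i j)
  then show ?case using kab_ex_leibniz kn_leibniz_of_kab by blast
next
  case sigma_inv
  then show ?case using kab_ex_leibniz kn_leibniz_of_kab by blast
qed (blast intro: kn.leibniz_one kn.leibniz_add kn.leibniz_scale kn.leibniz_mult kn_leibniz_X)+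

lemma Kn_eq: "Kn = kn.action_data"
  by (simp add: Kn_def kn.action_data_def)

lemma Kn_simps [simp]: "mult Kn = (*)" "unit Kn = 1"
  by (simp_all add: Kn_def)

lemma comult_Kn: "comult Kn = comult_of_action kn_app" and counit_Kn: "counit Kn = counit_of_action kn_app"
  by (simp_all add: Kn_def)

lemma comult_Kab: "comult Kab = comult_of_action kab_app" and counit_Kab: "counit Kab = counit_of_action kab_app"
  by (simp_all add: Kab_def)

lemma clinear_comult_Kn [clinear_intros]: "clinear F \<Longrightarrow> clinear (\<lambda>x. comult Kn (F x))"
  unfolding comult_Kn by (rule clinear_compose[OF kn.clinear_comult[OF kn_ex_leibniz]])

lemma clinear_comult_Kab [clinear_intros]: "clinear F \<Longrightarrow> clinear (\<lambda>x. comult Kab (F x))"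
  unfolding comult_Kab by (rule clinear_compose[OF kab.clinear_comult[OF kab_ex_leibniz]])

lemma clinear_counit_Kn [clinear_intros]: "clinear F \<Longrightarrow> clinear (\<lambda>x. counit Kn (F x))"
  unfolding counit_Kn kn.counit_of_action_eq(1) by (rule clinear_compose[OF kn.clinear_eval_at])

lemma clinear_counit_Kab [clinear_intros]: "clinear F \<Longrightarrow> clinear (\<lambda>x. counit Kab (F x))"
  unfolding counit_Kab kab.counit_of_action_eq(1) by (rule clinear_compose[OF kab.clinear_eval_at])

lemma comult_Kn_mult: "comult Kn (k * l) = comult Kn k * comult Kn l"
  by (simp add: comult_Kn kn.comult_mult[OF kn_ex_leibniz])

lemma comult_Kn_one: "comult Kn 1 = 1 \<otimes> 1"
  by (simp add: comult_Kn kn.comult_one[OF kn_ex_leibniz])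

lemma comult_Kn_X: "comult Kn (kn_X l) = kn_X l \<otimes> 1 + (\<Sum>k\<in>UNIV. kn_of_kab (kab_sigma k l) \<otimes> kn_X k)"
  by (simp add: comult_Kn kn.comult_of_action_eqI[OF kn_leibniz_X])

lemma comult_Kn_of_kab: "comult Kn (kn_of_kab f) = tensor_map kn_of_kab kn_of_kab (comult Kab f)"
  unfolding comult_Kn comult_Kab
  by (rule kn.comult_of_action_eqI[OF kn_leibniz_of_kab[OF kab.leibniz_comult[OF kab_ex_leibniz]]])

lemma comult_Kab_sigma: "comult Kab (kab_sigma i j) = (\<Sum>k\<in>UNIV. kab_sigma k j \<otimes> kab_sigma i k)"
  unfolding comult_Kab by (rule kab.comult_of_action_eqI[OF kab_leibniz_sigma])

lemma comult_Kab_sigma_inv: "comult Kab kab_sigma_inv = kab_sigma_inv \<otimes> kab_sigma_inv"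
  unfolding comult_Kab by (rule kab.comult_of_action_eqI[OF kab_leibniz_sigma_inv])

lemma counit_Kn_of_kab: "counit Kn (kn_of_kab f) = counit Kab f"
  by (simp add: counit_Kn counit_Kab counit_of_action_def)

lemma counit_Kn_mult: "counit Kn (k * l) = counit Kn k * counit Kn l"
  by (simp add: counit_Kn kn.counit_mult)

lemma counit_Kn_one [simp]: "counit Kn 1 = 1"
  by (simp add: counit_Kn kn.counit_one)

lemma counit_Kn_X: "counit Kn (kn_X l) = 0"
  using partial_local[OF open_ball, of 0 0 1 "test_fun_app (plateau 0)" "\<lambda>_. 1" l] plateau_eq_1[of _ 0]
  by (auto simp: counit_Kn kn.counit_of_action_eq(1) kn.base_point_def kn.eval_at_apply kn_X.rep_eq
      test_fun_app_partial partial_const)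

lemma counit_Kab_gamma: "counit Kab f = kab_gamma f diffeo_id 0"
  using plateau_eq_1[of "0 :: real^'a" 0]
  by (simp add: counit_Kab kab.counit_of_action_eq(1) kab.base_point_def kab.eval_at_apply
      kab_app_gamma[of f] test_fun_app_smult smooth_gamma)

lemma counit_Kab_sigma: "counit Kab (kab_sigma i j) = (if i = j then 1 else 0)"
  using fun_cong[OF partial_nth[of j i], of 0] by (simp add: counit_Kab_gamma sigma_symbol_def)

lemma counit_Kab_sigma_inv: "counit Kab kab_sigma_inv = 1"
proof -
  have "jacobian (diffeo_map diffeo_id) (at x) = mat 1" for x :: "real^'a"
    by (simp add: vec_eq_iff jacobian_entry smooth_diffeo partial_nth mat_def)
  then show ?thesis by (simp add: counit_Kab_gamma sigma_inv_symbol_def)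
qed


section \<open>The enveloping algebra of \<open>V\<close>\<close>

lemma kn_of_V_simps:
  "kn_of_V (X + Y) = kn_of_V X + kn_of_V Y" "kn_of_V (c *\<^sub>C X) = c *\<^sub>C kn_of_V X" "kn_of_V (V_X k) = kn_X k"
  by (simp_all add: plus_vlie.rep_eq scaleC_vlie.rep_eq V_X.rep_eq)

lemma clinear_kn_of_V [clinear_intros]: "clinear F \<Longrightarrow> clinear (\<lambda>x. kn_of_V (F x))"
  by (rule clinearI) (simp_all add: clinear_add clinear_scale kn_of_V_simps)

lemma vlie_induct [case_names X add scale]:
  assumes "\<And>k. P (V_X k)" "\<And>X Y. P X \<Longrightarrow> P Y \<Longrightarrow> P (X + Y)" "\<And>c X. P X \<Longrightarrow> P (c *\<^sub>C X)"
  shows "P (X :: 'n::finite vlie)"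
proof -
  have "kn_of_V X \<in> complex_space.span {kn_X k | k. True}" by (rule kn_of_V)
  then have "\<exists>Y. kn_of_V Y = kn_of_V X \<and> P Y"
  proof (induction rule: complex_space.span_induct_alt)
    case base
    have "P (0 *\<^sub>C V_X undefined)" by (intro assms)
    then show ?case using zero_vlie.rep_eq by (metis complex_space.scale_zero_left)
  next
    case (step c k l)
    then obtain i Y where "k = kn_X i" "kn_of_V Y = l" "P Y" by blast
    then show ?case
      using assms by (intro exI[of _ "c *\<^sub>C V_X i + Y"]) (simp add: kn_of_V_simps)
  qed
  then show ?thesis by (metis kn_of_V_inject)
qed

lemma kn_X_commute: "kn_X k * kn_X l = kn_X l * kn_X k"
proof (rule kn_eqI)
  fix a
  have "test_fun_partial k (test_fun_partial l f) = test_fun_partial l (test_fun_partial k f)" for f :: "'a test_fun"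
    by (rule test_fun_eqI) (simp add: test_fun_app_partial partial_commute smooth_test_fun)
  then show "kn_app (kn_X k * kn_X l) a = kn_app (kn_X l * kn_X k) a"
    by (intro poly_mapping_eqI) (simp add: times_kn.rep_eq kn_X.rep_eq lookup_X_op)
qed

lemma kn_of_V_commute: "kn_of_V X * kn_of_V Y = kn_of_V Y * kn_of_V X"
proof (induction X rule: vlie_induct)
  case (X k)
  show ?case by (induction Y rule: vlie_induct)
    (simp_all add: kn_of_V_simps kn_X_commute distrib_left distrib_right mult_scaleC_left mult_scaleC_right)
qed (simp_all add: kn_of_V_simps distrib_left distrib_right mult_scaleC_left mult_scaleC_right)

lemma lie_rep_kn_of_V: "lie_rep (\<lambda>X k. kn_of_V X * k)"
  unfolding lie_rep_def
  by (auto intro!: clinear_intros simp: lie_vlie_def zero_vlie.rep_eq kn_of_V_commute simp flip: mult.assoc)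

lemma clinear_kn_of_UV [clinear_intros]: "clinear F \<Longrightarrow> clinear (\<lambda>x. kn_of_UV (F x))"
  unfolding kn_of_UV_def by (rule clinear_compose[OF uea_act_clinear_left[OF lie_rep_kn_of_V]])

lemma kn_of_UV_one [simp]: "kn_of_UV 1 = 1"
  by (simp add: kn_of_UV_def uea_act_one lie_rep_kn_of_V)

lemma kn_of_UV_of_mult: "kn_of_UV (uea_of X * u) = kn_of_V X * kn_of_UV u"
  by (simp add: kn_of_UV_def uea_act_mult uea_act_of lie_rep_kn_of_V)

lemma kn_of_UV_of [simp]: "kn_of_UV (uea_of X) = kn_of_V X"
  by (simp add: kn_of_UV_def uea_act_of lie_rep_kn_of_V)

lemma UV_induct [case_names one add scale mult]:
  assumes "P 1" "\<And>u v. P u \<Longrightarrow> P v \<Longrightarrow> P (u + v)" "\<And>c u. P u \<Longrightarrow> P (c *\<^sub>C u)"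
    "\<And>k u. P u \<Longrightarrow> P (uea_of (V_X k) * u)"
  shows "P (u :: 'n::finite UV)"
proof (induction u rule: uea_induct)
  case (mult X u)
  have "P (uea_of X * u)"
    by (induction X rule: vlie_induct)
      (simp_all add: assms mult clinear_add[OF clinear_uea_of[OF clinear_id']]
        clinear_scale[OF clinear_uea_of[OF clinear_id']] distrib_right mult_scaleC_left)
  then show ?case .
qed (use assms in auto)

lemma kn_of_UV_mult: "kn_of_UV (u * v) = kn_of_UV u * kn_of_UV v"
  by (induction u rule: uea_induct)
    (simp_all add: distrib_right mult_scaleC_left clinear_add[OF clinear_kn_of_UV[OF clinear_id']]
      clinear_scale[OF clinear_kn_of_UV[OF clinear_id']] kn_of_UV_of_mult mult.assoc)

lemma V_act_commutator: "kn_of_kab (V_act X f) = kn_of_V X * kn_of_kab f - kn_of_kab f * kn_of_V X"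
proof -
  have "\<exists>g. kn_of_kab g = kn_of_V X * kn_of_kab f - kn_of_kab f * kn_of_V X"
  proof (induction X rule: vlie_induct)
    case (X k)
    then show ?case by (metis kn_of_kab_D kn_of_V_simps(3))
  next
    case (add X Y)
    then obtain g h where "kn_of_kab g = kn_of_V X * kn_of_kab f - kn_of_kab f * kn_of_V X"
      "kn_of_kab h = kn_of_V Y * kn_of_kab f - kn_of_kab f * kn_of_V Y" by blast
    then show ?case
      by (intro exI[of _ "g + h"]) (simp add: kn_of_kab_hom kn_of_V_simps distrib_left distrib_right)
  next
    case (scale c X)
    then obtain g where "kn_of_kab g = kn_of_V X * kn_of_kab f - kn_of_kab f * kn_of_V X" by blast
    then show ?case
      by (intro exI[of _ "c *\<^sub>C g"]) (simp add: kn_of_kab_hom kn_of_V_simps mult_scaleC_left mult_scaleC_right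
          complex_space.scale_right_diff_distrib)
  qed
  then obtain g where g: "kn_of_kab g = kn_of_V X * kn_of_kab f - kn_of_kab f * kn_of_V X" by blast
  then have "V_act X f = g" unfolding V_act_def
    by (intro the_equality) (auto simp: kn_of_kab_inject simp flip: g)
  with g show ?thesis by simp
qed

lemma V_act_X: "V_act (V_X k) f = kab_D k f"
  using V_act_commutator[of "V_X k" f] by (simp add: kn_of_V_simps kn_of_kab_inject flip: kn_of_kab_D)

lemma lie_rep_V_act: "lie_rep V_act"
  unfolding lie_rep_def
proof (intro conjI allI)
  show "clinear (V_act X)" for X :: "'a vlie"
    by (rule clinearI; rule kn_of_kab_inject[THEN iffD1])
      (simp_all add: V_act_commutator kn_of_kab_hom distrib_left distrib_right mult_scaleC_left mult_scaleC_right
          complex_space.scale_right_diff_distrib)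
  show "clinear (\<lambda>X. V_act X f)" for f :: "'a kab"
    by (rule clinearI; rule kn_of_kab_inject[THEN iffD1])
      (simp_all add: V_act_commutator kn_of_kab_hom kn_of_V_simps distrib_left distrib_right mult_scaleC_left mult_scaleC_right
          complex_space.scale_right_diff_distrib)
  fix X Y :: "'a vlie" and f
  have "kn_of_kab (V_act X (V_act Y f)) = kn_of_kab (V_act Y (V_act X f))"
    by (simp add: V_act_commutator right_diff_distrib left_diff_distrib mult.assoc)
      (simp add: kn_of_V_commute[of X Y] flip: mult.assoc)
  moreover have "V_act 0 f = 0"
    by (rule kn_of_kab_inject[THEN iffD1])
      (simp add: V_act_commutator zero_vlie.rep_eq clinear_0[OF clinear_kn_of_kab'])
  ultimately show "V_act (lie X Y) f = V_act X (V_act Y f) - V_act Y (V_act X f)"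
    by (simp add: lie_vlie_def kn_of_kab_inject)
qed

lemma clinear_UV_act_left [clinear_intros]: "clinear F \<Longrightarrow> clinear (\<lambda>x. UV_act (F x) f)"
  unfolding UV_act_def by (rule clinear_compose[OF uea_act_clinear_left[OF lie_rep_V_act]])

lemma clinear_UV_act_right [clinear_intros]: "clinear F \<Longrightarrow> clinear (\<lambda>x. UV_act u (F x))"
  unfolding UV_act_def by (rule clinear_compose[OF uea_act_clinear_right[OF lie_rep_V_act]])

lemma UV_act_one [simp]: "UV_act 1 f = f"
  by (simp add: UV_act_def uea_act_one lie_rep_V_act)

lemma UV_act_X_mult: "UV_act (uea_of (V_X k) * u) f = kab_D k (UV_act u f)"
  by (simp add: UV_act_def uea_act_mult uea_act_of lie_rep_V_act V_act_X)


section \<open>The coaction on \<open>\<U>(V)\<close>\<close>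

text \<open>The operator \<open>u\<^sub>0 \<otimes> u\<^sub>1 \<mapsto> X\<^sub>k u\<^sub>0 \<otimes> \<sigma>\<^sup>k\<^sub>l u\<^sub>1 + u\<^sub>0 \<otimes> X\<^sub>l \<triangleright> u\<^sub>1\<close>, which turns the coaction of \<open>u\<close> into that of
  \<open>X\<^sub>l u\<close>. These operators commute, because \<open>X\<^sub>m \<triangleright> \<sigma>\<^sup>k\<^sub>l\<close> is symmetric in \<open>l\<close> and \<open>m\<close>; so they define
  the coaction.\<close>

definition coaction_step :: "'n::finite \<Rightarrow> ('n UV, 'n kab) tensor \<Rightarrow> ('n UV, 'n kab) tensor"
  where "coaction_step l = tensor_lift (\<lambda>u f.
    (\<Sum>k\<in>UNIV. (uea_of (V_X k) * u) \<otimes> (kab_sigma k l * f)) + u \<otimes> kab_D l f)"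

lemma clinear_coaction_step [clinear_intros]: "clinear F \<Longrightarrow> clinear (\<lambda>x. coaction_step l (F x))"
  unfolding coaction_step_def by (intro clinear_intros)

lemma coaction_step_pure:
  "coaction_step l (u \<otimes> f) = (\<Sum>k\<in>UNIV. (uea_of (V_X k) * u) \<otimes> (kab_sigma k l * f)) + u \<otimes> kab_D l f"
  unfolding coaction_step_def by (rule tensor_lift_pure) (intro clinear_intros)+

lemma uea_of_V_commute: "uea_of X * uea_of Y = uea_of Y * uea_of X" for X Y :: "'n::finite vlie"
  using uea_of_commutator[of X Y] clinear_0[OF clinear_uea_of[OF clinear_id']]
  by (metis eq_iff_diff_eq_0 lie_vlie_def)

lemma coaction_step_commute: "coaction_step l (coaction_step m t) = coaction_step m (coaction_step l t)"
proof (rule tensor_eqI[where t = t])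
  fix u :: "'a UV" and f
  have step: "coaction_step l (coaction_step m (u \<otimes> f)) =
      (\<Sum>k\<in>UNIV. \<Sum>j\<in>UNIV. (uea_of (V_X j) * (uea_of (V_X k) * u)) \<otimes> (kab_sigma j l * (kab_sigma k m * f)))
      + (\<Sum>k\<in>UNIV. (uea_of (V_X k) * u) \<otimes> (kab_D l (kab_sigma k m) * f))
      + (\<Sum>k\<in>UNIV. (uea_of (V_X k) * u) \<otimes> (kab_sigma k m * kab_D l f))
      + (\<Sum>k\<in>UNIV. (uea_of (V_X k) * u) \<otimes> (kab_sigma k l * kab_D m f))
      + u \<otimes> kab_D l (kab_D m f)" for l m :: 'a
    by (simp add: coaction_step_pure clinear_add[OF clinear_coaction_step[OF clinear_id']]
        clinear_setsum[OF clinear_coaction_step[OF clinear_id']] kab_D_mult tensor_add_right sum.distrib)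
  have "uea_of (V_X j) * (uea_of (V_X k) * u) = uea_of (V_X k) * (uea_of (V_X j) * u)" for j k
    by (metis mult.assoc uea_of_V_commute)
  moreover have "kab_sigma j l * (kab_sigma k m * f) = kab_sigma k m * (kab_sigma j l * f)" for j k
    by (rule mult.left_commute)
  ultimately have "(\<Sum>k\<in>UNIV. \<Sum>j\<in>UNIV. (uea_of (V_X j) * (uea_of (V_X k) * u)) \<otimes> (kab_sigma j l * (kab_sigma k m * f)))
      = (\<Sum>k\<in>UNIV. \<Sum>j\<in>UNIV. (uea_of (V_X k) * (uea_of (V_X j) * u)) \<otimes> (kab_sigma k m * (kab_sigma j l * f)))"
    by (simp only:)
  also have "\<dots> = (\<Sum>k\<in>UNIV. \<Sum>j\<in>UNIV. (uea_of (V_X j) * (uea_of (V_X k) * u)) \<otimes> (kab_sigma j m * (kab_sigma k l * f)))"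
    by (rule sum.swap)
  finally show "coaction_step l (coaction_step m (u \<otimes> f)) = coaction_step m (coaction_step l (u \<otimes> f))"
    unfolding step by (simp add: kab_D_sigma[of l _ m] kab_D_commute[of l m] ac_simps)
qed (intro clinear_intros)+

text \<open>The coordinates of a vector of \<open>V\<close> with respect to the \<open>X\<^sub>k\<close>, read off by differentiating a
  test function that is a coordinate function near the origin.\<close>

definition V_coord :: "'n::finite vlie \<Rightarrow> 'n \<Rightarrow> complex"
  where "V_coord X k = kn.eval_at (diffeo_id, 0, test_fun_smult (\<lambda>x. of_real (x $ k)) (plateau 0)) (kn_of_V X)"

lemma V_coord_X: "V_coord (V_X l) k = (if k = l then 1 else 0)"
proof -
  have s: "smooth (\<lambda>x :: real^'a. of_real (x $ k) :: complex)"
    by (intro smooth_of_real smooth_nth smooth_ident)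
  have "partial l (test_fun_app (test_fun_smult (\<lambda>x. of_real (x $ k)) (plateau 0))) 0 =
      partial l (\<lambda>x. of_real (x $ k) :: complex) 0"
    by (rule partial_local[OF open_ball, of 0 0 1]) (auto simp: test_fun_app_smult s plateau_eq_1)
  also have "\<dots> = (if k = l then 1 else 0)"
    by (subst partial_linear_map[OF bounded_linear_of_real])
      (simp_all add: smooth_nth smooth_ident partial_nth)
  finally show ?thesis
    by (simp add: V_coord_def kn.eval_at_apply kn_of_V_simps kn_X.rep_eq test_fun_app_partial)
qed

lemma clinear_V_coord: "clinear (\<lambda>X. V_coord X k)"
  unfolding V_coord_def by (intro clinear_compose[OF kn.clinear_eval_at] clinear_intros)

definition coaction_rep :: "'n::finite vlie \<Rightarrow> ('n UV, 'n kab) tensor \<Rightarrow> ('n UV, 'n kab) tensor"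
  where "coaction_rep X t = (\<Sum>l\<in>UNIV. V_coord X l *\<^sub>C coaction_step l t)"

lemma lie_rep_coaction: "lie_rep coaction_rep"
  unfolding lie_rep_def
proof (intro conjI allI)
  show "clinear (coaction_rep X)" for X :: "'a vlie"
    unfolding coaction_rep_def[abs_def] by (intro clinear_intros)
  show "clinear (\<lambda>X. coaction_rep X t)" for t :: "('a UV, 'a kab) tensor"
    unfolding coaction_rep_def by (intro clinear_intros clinear_V_coord)
  fix X Y :: "'a vlie" and t :: "('a UV, 'a kab) tensor"
  have step: "coaction_rep X (coaction_rep Y t) =
      (\<Sum>l\<in>UNIV. \<Sum>m\<in>UNIV. (V_coord X l * V_coord Y m) *\<^sub>C coaction_step l (coaction_step m t))" for X Y
    by (simp add: coaction_rep_def clinear_setsum[OF clinear_coaction_step[OF clinear_id']]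
        clinear_scale[OF clinear_coaction_step[OF clinear_id']] complex_space.scale_sum_right scaleC_scaleC)
  have "coaction_rep X (coaction_rep Y t) = coaction_rep Y (coaction_rep X t)"
    unfolding step by (subst sum.swap) (simp add: coaction_step_commute mult.commute)
  moreover have "coaction_rep 0 t = 0"
    by (simp add: coaction_rep_def clinear_0[OF clinear_V_coord])
  ultimately show "coaction_rep (lie X Y) t = coaction_rep X (coaction_rep Y t) - coaction_rep Y (coaction_rep X t)"
    by (simp add: lie_vlie_def)
qed

lemma coaction_rep_X: "coaction_rep (V_X l) t = coaction_step l t"
proof -
  have "coaction_rep (V_X l) t = (\<Sum>k\<in>UNIV. if k = l then coaction_step k t else 0)"
    unfolding coaction_rep_def by (intro sum.cong refl) (simp add: V_coord_X scaleC_one)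
  then show ?thesis by simp
qed

definition the_coaction :: "'n::finite UV \<Rightarrow> ('n UV, 'n kab) tensor"
  where "the_coaction u = uea_act coaction_rep u (1 \<otimes> 1)"

lemma clinear_the_coaction: "clinear the_coaction"
  unfolding the_coaction_def[abs_def] by (rule uea_act_clinear_left[OF lie_rep_coaction])

lemma the_coaction_one: "the_coaction 1 = 1 \<otimes> 1"
  by (simp add: the_coaction_def uea_act_one lie_rep_coaction)

lemma the_coaction_X_mult: "the_coaction (uea_of (V_X l) * u) = coaction_step l (the_coaction u)"
  by (simp add: the_coaction_def uea_act_mult uea_act_of lie_rep_coaction coaction_rep_X)

text \<open>The product \<open>u\<^sub>1\<^sub>0 v\<^sub>0 \<otimes> u\<^sub>1\<^sub>1 (u\<^sub>2 \<triangleright> v\<^sub>1)\<close> of the coactions \<open>p\<close> of \<open>u\<^sub>1\<close> and \<open>t\<close> of \<open>v\<close>.\<close>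

definition coaction_prod ::
    "('n::finite UV, 'n kab) tensor \<Rightarrow> 'n UV \<Rightarrow> ('n UV, 'n kab) tensor \<Rightarrow> ('n UV, 'n kab) tensor"
  where "coaction_prod p u\<^sub>2 t = tensor_lift (\<lambda>u\<^sub>1\<^sub>0 u\<^sub>1\<^sub>1. tensor_lift (\<lambda>v\<^sub>0 v\<^sub>1.
        (u\<^sub>1\<^sub>0 * v\<^sub>0) \<otimes> (u\<^sub>1\<^sub>1 * UV_act u\<^sub>2 v\<^sub>1)) t) p"

lemma clinear_coaction_prod [clinear_intros]:
  "clinear F \<Longrightarrow> clinear (\<lambda>x. coaction_prod (F x) u t)"
  "clinear G \<Longrightarrow> clinear (\<lambda>x. coaction_prod p (G x) t)"
  "clinear H \<Longrightarrow> clinear (\<lambda>x. coaction_prod p u (H x))"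
  unfolding coaction_prod_def by (intro clinear_intros; assumption)+

lemma coaction_prod_pure: "coaction_prod (a \<otimes> f) u (b \<otimes> g) = (a * b) \<otimes> (f * UV_act u g)"
  unfolding coaction_prod_def
  by (subst tensor_lift_pure; (intro clinear_intros)?)
     (subst tensor_lift_pure; (intro clinear_intros)?; rule refl)

lemma coaction_prod_one: "coaction_prod (1 \<otimes> 1) 1 t = t"
  by (rule tensor_eqI[where t = t]; (intro clinear_intros)?) (simp add: coaction_prod_pure)

text \<open>In the first tensor factor only \<open>u\<^sub>1\<^sub>0\<close> is multiplied by \<open>X\<^sub>k\<close>; in the second this is the product rule
  for \<open>X\<^sub>l\<close> acting on \<open>u\<^sub>1\<^sub>1 (u\<^sub>2 \<triangleright> v\<^sub>1)\<close>.\<close>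

lemma coaction_step_prod:
  "coaction_prod (coaction_step l p) u t + coaction_prod p (uea_of (V_X l) * u) t =
    coaction_step l (coaction_prod p u t)"
proof (rule tensor_eqI[where t = p])
  fix a :: "'a UV" and f
  show "coaction_prod (coaction_step l (a \<otimes> f)) u t + coaction_prod (a \<otimes> f) (uea_of (V_X l) * u) t =
      coaction_step l (coaction_prod (a \<otimes> f) u t)"
  proof (rule tensor_eqI[where t = t])
    fix b :: "'a UV" and g
    show "coaction_prod (coaction_step l (a \<otimes> f)) u (b \<otimes> g) + coaction_prod (a \<otimes> f) (uea_of (V_X l) * u) (b \<otimes> g) =
        coaction_step l (coaction_prod (a \<otimes> f) u (b \<otimes> g))"
      by (simp add: coaction_step_pure coaction_prod_pure clinear_add[OF clinear_coaction_prod(1)[OF clinear_id']]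
          clinear_setsum[OF clinear_coaction_prod(1)[OF clinear_id']] UV_act_X_mult kab_D_mult
          tensor_add_right mult.assoc add.assoc)
  qed (intro clinear_intros)+
qed (intro clinear_intros)+

definition is_coaction :: "('n::finite UV \<Rightarrow> ('n UV, 'n kab) tensor) \<Rightarrow> bool"
  where "is_coaction \<rho> \<longleftrightarrow> clinear \<rho> \<and> \<rho> 1 = 1 \<otimes> 1 \<and>
    (\<forall>l. \<rho> (uea_of (V_X l)) = (\<Sum>k\<in>UNIV. uea_of (V_X k) \<otimes> kab_sigma k l)) \<and>
    (\<forall>u v. \<rho> (u * v) = tensor_lift (\<lambda>u\<^sub>1 u\<^sub>2. coaction_prod (\<rho> u\<^sub>1) u\<^sub>2 (\<rho> v)) (uea_comult u))"

lemma coaction_the_is_coaction: "coaction = (THE \<rho>. is_coaction \<rho>)"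
  unfolding coaction_def is_coaction_def coaction_prod_def ..

lemma coaction_step_one: "coaction_step l (1 \<otimes> 1) = (\<Sum>k\<in>UNIV. uea_of (V_X k) \<otimes> kab_sigma k l)"
proof -
  have "(1 :: 'a UV) \<otimes> (0 :: 'a kab) = 0" by (rule clinear_0[OF clinear_tensor_right[OF clinear_id']])
  then show ?thesis by (simp add: coaction_step_pure)
qed

lemma is_coaction_the_coaction: "is_coaction (the_coaction :: 'n::finite UV \<Rightarrow> _)"
  unfolding is_coaction_def
proof (intro conjI allI)
  note rho [clinear_intros] = clinear_compose[OF clinear_the_coaction]
  show "clinear (the_coaction :: 'n UV \<Rightarrow> _)" "the_coaction (1 :: 'n UV) = 1 \<otimes> 1"
    by (rule clinear_the_coaction, rule the_coaction_one)
  show "the_coaction (uea_of (V_X l)) = (\<Sum>k\<in>UNIV. uea_of (V_X k) \<otimes> kab_sigma k l)" for l :: 'n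
    using the_coaction_X_mult[of l 1] by (simp add: the_coaction_one coaction_step_one)
  let ?M = "\<lambda>s t :: ('n UV, 'n kab) tensor. tensor_lift (\<lambda>u\<^sub>1 u\<^sub>2. coaction_prod (the_coaction u\<^sub>1) u\<^sub>2 t) s"
  have M_pure: "?M (u \<otimes> v) t = coaction_prod (the_coaction u) v t" for u v t
    by (rule tensor_lift_pure) (intro clinear_intros)+
  have M_lin: "clinear F \<Longrightarrow> clinear (\<lambda>x. ?M (F x) t)" for t and F :: "'n UV \<Rightarrow> _"
    by (intro clinear_intros)
  have M_step: "?M ((uea_of (V_X l) \<otimes> 1 + 1 \<otimes> uea_of (V_X l)) * s) t = coaction_step l (?M s t)" for l s t
  proof (rule tensor_eqI[where t = s])
    have Mc: "clinear (\<lambda>s. ?M s t)" by (intro clinear_intros)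
    fix u v :: "'n UV"
    show "?M ((uea_of (V_X l) \<otimes> 1 + 1 \<otimes> uea_of (V_X l)) * (u \<otimes> v)) t = coaction_step l (?M (u \<otimes> v) t)"
      by (simp add: distrib_right clinear_add[OF Mc] M_pure the_coaction_X_mult coaction_step_prod)
  qed (intro clinear_intros)+
  fix u v :: "'n UV"
  show "the_coaction (u * v) = ?M (uea_comult u) (the_coaction v)"
  proof (induction u rule: UV_induct)
    case one
    show ?case by (simp add: M_pure the_coaction_one coaction_prod_one)
  next
    case (add u u')
    then show ?case
      by (simp add: distrib_right clinear_add[OF clinear_the_coaction]
          clinear_add[OF M_lin[OF clinear_uea_comult[OF clinear_id']]])
  next
    case (scale c u)
    then show ?case
      by (simp add: mult_scaleC_left clinear_scale[OF clinear_the_coaction]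
          clinear_scale[OF M_lin[OF clinear_uea_comult[OF clinear_id']]])
  next
    case (mult l u)
    then show ?case by (simp add: mult.assoc the_coaction_X_mult uea_comult_of_mult M_step)
  qed
qed

text \<open>The product rule for a first factor \<open>X\<^sub>l\<close> forces the recursion that defines \<open>the_coaction\<close>.\<close>

lemma is_coaction_unique:
  assumes "is_coaction \<rho>"
  shows "\<rho> = the_coaction"
proof
  fix u
  have \<rho>: "clinear \<rho>" "\<rho> 1 = 1 \<otimes> 1" "\<And>l. \<rho> (uea_of (V_X l)) = coaction_step l (1 \<otimes> 1)"
    and prod: "\<And>u v. \<rho> (u * v) = tensor_lift (\<lambda>u\<^sub>1 u\<^sub>2. coaction_prod (\<rho> u\<^sub>1) u\<^sub>2 (\<rho> v)) (uea_comult u)"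
    using assms by (auto simp: is_coaction_def coaction_step_one)
  note rho [clinear_intros] = clinear_compose[OF \<rho>(1)]
  have lin: "clinear (tensor_lift (\<lambda>u\<^sub>1 u\<^sub>2. coaction_prod (\<rho> u\<^sub>1) u\<^sub>2 t))" for t
    by (intro clinear_tensor_lift clinear_intros)
  have pure: "tensor_lift (\<lambda>u\<^sub>1 u\<^sub>2. coaction_prod (\<rho> u\<^sub>1) u\<^sub>2 t) (u \<otimes> v) = coaction_prod (\<rho> u) v t" for u v t
    by (rule tensor_lift_pure) (intro clinear_intros)+
  have "\<rho> (uea_of (V_X l) * u) = coaction_step l (\<rho> u)" for l u
    using uea_comult_of_mult[of "V_X l" 1] coaction_step_prod[of l "1 \<otimes> 1" 1 "\<rho> u"]
    by (simp add: prod clinear_add[OF lin] pure \<rho> coaction_prod_one distrib_right)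
  then show "\<rho> u = the_coaction u"
    by (induction u rule: UV_induct)
      (simp_all add: \<rho>(2) the_coaction_one the_coaction_X_mult clinear_add[OF \<rho>(1)] clinear_scale[OF \<rho>(1)]
        clinear_add[OF clinear_the_coaction] clinear_scale[OF clinear_the_coaction])
qed

lemma coaction_eq: "coaction = the_coaction"
  unfolding coaction_the_is_coaction
  using is_coaction_the_coaction is_coaction_unique by (rule the_equality)

lemma clinear_coaction [clinear_intros]: "clinear F \<Longrightarrow> clinear (\<lambda>x. coaction (F x))"
  unfolding coaction_eq by (rule clinear_compose[OF clinear_the_coaction])

lemma coaction_one: "coaction 1 = 1 \<otimes> 1"
  by (simp add: coaction_eq the_coaction_one)

lemma coaction_X_mult: "coaction (uea_of (V_X l) * u) = coaction_step l (coaction u)"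
  by (simp add: coaction_eq the_coaction_X_mult)

lemma coaction_X: "coaction (uea_of (V_X l)) = (\<Sum>k\<in>UNIV. uea_of (V_X k) \<otimes> kab_sigma k l)"
  using coaction_X_mult[of l 1] by (simp add: coaction_one coaction_step_one)


section \<open>The map \<open>\<I>\<close> is a homomorphism\<close>

lemma clinear_bicrossed_to_Kn [clinear_intros]: "clinear F \<Longrightarrow> clinear (\<lambda>x. bicrossed_to_Kn (F x))"
  unfolding bicrossed_to_Kn_def by (intro clinear_intros)

lemma bicrossed_to_Kn_pure [simp]: "bicrossed_to_Kn (f \<otimes> u) = kn_of_kab f * kn_of_UV u"
  unfolding bicrossed_to_Kn_def by (rule tensor_lift_pure) (intro clinear_intros)+

lemma clinear_bicrossed_to_Kn': "clinear bicrossed_to_Kn"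
  by (rule clinear_bicrossed_to_Kn[OF clinear_id'])

text \<open>The commutation rule \<open>u f = (u\<^sub>1 \<triangleright> f) u\<^sub>2\<close>, which iterates \<open>X f = [X, f] + f X\<close>.\<close>

lemma kn_of_UV_mult_of_kab:
  "kn_of_UV u * kn_of_kab g = tensor_lift (\<lambda>u\<^sub>1 u\<^sub>2. kn_of_kab (UV_act u\<^sub>1 g) * kn_of_UV u\<^sub>2) (uea_comult u)"
proof -
  let ?M = "tensor_lift (\<lambda>u\<^sub>1 u\<^sub>2. kn_of_kab (UV_act u\<^sub>1 g) * kn_of_UV u\<^sub>2)"
  have lin: "clinear ?M" by (intro clinear_tensor_lift clinear_intros)
  have pure: "?M (u \<otimes> v) = kn_of_kab (UV_act u g) * kn_of_UV v" for u v
    by (rule tensor_lift_pure) (intro clinear_intros)+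
  have step: "?M ((uea_of (V_X l) \<otimes> 1 + 1 \<otimes> uea_of (V_X l)) * s) = kn_X l * ?M s" for l s
  proof (rule tensor_eqI[where t = s])
    fix u v :: "'a UV"
    show "?M ((uea_of (V_X l) \<otimes> 1 + 1 \<otimes> uea_of (V_X l)) * (u \<otimes> v)) = kn_X l * ?M (u \<otimes> v)"
      by (simp add: distrib_right clinear_add[OF lin] pure UV_act_X_mult kn_of_kab_D kn_of_UV_of_mult
          kn_of_V_simps left_diff_distrib mult.assoc)
  qed (intro clinear_intros clinear_compose[OF lin])+
  show ?thesis
  proof (induction u rule: UV_induct)
    case (mult l u)
    then show ?case by (simp add: kn_of_UV_of_mult kn_of_V_simps mult.assoc uea_comult_of_mult step)
  qed (simp_all add: pure clinear_add[OF clinear_kn_of_UV[OF clinear_id']] clinear_scale[OF clinear_kn_of_UV[OF clinear_id']]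
      distrib_right mult_scaleC_left clinear_add[OF clinear_compose[OF lin clinear_uea_comult[OF clinear_id']]]
      clinear_scale[OF clinear_compose[OF lin clinear_uea_comult[OF clinear_id']]])
qed

lemma bicrossed_to_Kn_mult: "bicrossed_to_Kn (mult bicrossed s t) = bicrossed_to_Kn s * bicrossed_to_Kn t"
proof -
  let ?P = "\<lambda>f u g v. tensor_lift (\<lambda>u\<^sub>1 u\<^sub>2. (f * UV_act u\<^sub>1 g) \<otimes> (u\<^sub>2 * v)) (uea_comult u) :: ('a kab, 'a UV) tensor"
  have m: "mult bicrossed s t = tensor_lift (\<lambda>f u. tensor_lift (\<lambda>g v. ?P f u g v) t) s" for s t
    by (simp add: bicrossed_def)
  have inner: "bicrossed_to_Kn (?P f u g v) = kn_of_kab f * kn_of_UV u * (kn_of_kab g * kn_of_UV v)" for f u g v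
  proof -
    have "bicrossed_to_Kn (?P f u g v) =
        tensor_lift (\<lambda>u\<^sub>1 u\<^sub>2. bicrossed_to_Kn ((f * UV_act u\<^sub>1 g) \<otimes> (u\<^sub>2 * v))) (uea_comult u)"
      by (rule clinear_tensor_lift_apply[OF clinear_bicrossed_to_Kn']) (intro clinear_intros)+
    also have "\<dots> = tensor_lift (\<lambda>u\<^sub>1 u\<^sub>2. kn_of_kab f * (kn_of_kab (UV_act u\<^sub>1 g) * kn_of_UV u\<^sub>2) * kn_of_UV v) (uea_comult u)"
      by (simp add: kn_of_kab_hom kn_of_UV_mult mult.assoc)
    also have "\<dots> = kn_of_kab f * tensor_lift (\<lambda>u\<^sub>1 u\<^sub>2. kn_of_kab (UV_act u\<^sub>1 g) * kn_of_UV u\<^sub>2) (uea_comult u) * kn_of_UV v"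
    proof (rule clinear_tensor_lift_apply[symmetric, of "\<lambda>k. kn_of_kab f * k * kn_of_UV v"])
      show "clinear (\<lambda>k. kn_of_kab f * k * kn_of_UV v)" by (intro clinear_intros)
    qed (intro clinear_intros)+
    finally show ?thesis
      unfolding kn_of_UV_mult_of_kab[symmetric] by (simp only: mult.assoc)
  qed
  show ?thesis
  proof (rule tensor_eqI[where t = s])
    show "clinear (\<lambda>s. bicrossed_to_Kn (mult bicrossed s t))" unfolding m by (intro clinear_intros)
    fix f u
    show "bicrossed_to_Kn (mult bicrossed (f \<otimes> u) t) = bicrossed_to_Kn (f \<otimes> u) * bicrossed_to_Kn t"
    proof (rule tensor_eqI[where t = t])
      show "clinear (\<lambda>t. bicrossed_to_Kn (mult bicrossed (f \<otimes> u) t))" unfolding m by (intro clinear_intros)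
      fix g v
      have "mult bicrossed (f \<otimes> u) (g \<otimes> v) = ?P f u g v"
        unfolding m
        by (subst tensor_lift_pure; (intro clinear_intros)?) (subst tensor_lift_pure; (intro clinear_intros)?; rule refl)
      with inner show "bicrossed_to_Kn (mult bicrossed (f \<otimes> u) (g \<otimes> v)) = bicrossed_to_Kn (f \<otimes> u) * bicrossed_to_Kn (g \<otimes> v)"
        by simp
    qed (intro clinear_intros)
  qed (intro clinear_intros)
qed

lemma bicrossed_to_Kn_unit: "bicrossed_to_Kn (unit bicrossed) = 1"
  by (simp add: bicrossed_def kn_of_kab_hom)

lemma counit_Kn_X_mult: "counit Kn (kn_X l * k) = 0"
  by (simp add: counit_Kn_mult counit_Kn_X)

lemma counit_Kn_of_UV: "counit Kn (kn_of_UV u) = uea_counit u"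
  by (induction u rule: UV_induct)
    (simp_all add: kn_of_UV_of_mult kn_of_V_simps counit_Kn_X_mult
      clinear_add[OF clinear_counit_Kn[OF clinear_kn_of_UV[OF clinear_id']]]
      clinear_scale[OF clinear_counit_Kn[OF clinear_kn_of_UV[OF clinear_id']]]
      clinear_add[OF clinear_uea_counit[OF clinear_id']] clinear_scale[OF clinear_uea_counit[OF clinear_id']])

lemma bicrossed_to_Kn_counit: "counit Kn (bicrossed_to_Kn t) = counit bicrossed t"
  for t :: "('a::finite kab, 'a UV) tensor"
proof -
  have c: "counit bicrossed = tensor_lift (\<lambda>(f :: 'a kab) (u :: 'a UV). counit Kab f * uea_counit u)"
    by (simp add: bicrossed_def cop_def)
  show ?thesis
    unfolding c
  proof (rule tensor_eqI[where t = t])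
    show "clinear (tensor_lift (\<lambda>f u. counit Kab f * uea_counit u))"
      by (intro clinear_tensor_lift clinear_intros)
    have "tensor_lift (\<lambda>f u. counit Kab f * uea_counit u) (f \<otimes> u) = counit Kab f * uea_counit u" for f :: "'a kab" and u :: "'a UV"
      by (rule tensor_lift_pure) (intro clinear_intros)+
    then show "counit Kn (bicrossed_to_Kn (f \<otimes> u)) = tensor_lift (\<lambda>f u. counit Kab f * uea_counit u) (f \<otimes> u)"
      for f :: "'a kab" and u :: "'a UV"
      by (simp add: counit_Kn_mult counit_Kn_of_kab counit_Kn_of_UV)
  qed (intro clinear_intros)
qed

text \<open>The image of the coproduct of \<open>1 \<bowtie> u\<close> under \<open>\<I> \<otimes> \<I>\<close>.\<close>

definition UV_cop_comult :: "'n::finite UV \<Rightarrow> ('n kn, 'n kn) tensor"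
  where "UV_cop_comult u = tensor_lift (\<lambda>u\<^sub>1 u\<^sub>2. tensor_lift (\<lambda>u\<^sub>1\<^sub>0 u\<^sub>1\<^sub>1.
      kn_of_UV u\<^sub>1\<^sub>0 \<otimes> (kn_of_kab u\<^sub>1\<^sub>1 * kn_of_UV u\<^sub>2)) (coaction u\<^sub>1)) (uea_comult u)"

text \<open>Passing from \<open>u\<close> to \<open>X\<^sub>l u\<close> multiplies both sides from the left by the opposite coproduct of \<open>X\<^sub>l\<close>; on
  the side of the bicrossed product this is \<open>X\<^sub>l f = [X\<^sub>l, f] + f X\<^sub>l\<close>.\<close>

lemma UV_cop_comult_eq: "UV_cop_comult u = tensor_flip (comult Kn (kn_of_UV u))"
proof -
  let ?N = "\<lambda>p v. tensor_lift (\<lambda>a g. kn_of_UV a \<otimes> (kn_of_kab g * kn_of_UV v)) p :: ('a kn, 'a kn) tensor"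
  let ?M = "tensor_lift (\<lambda>u\<^sub>1 u\<^sub>2. ?N (coaction u\<^sub>1) u\<^sub>2)"
  let ?Q = "\<lambda>l. 1 \<otimes> kn_X l + (\<Sum>k\<in>UNIV. kn_X k \<otimes> kn_of_kab (kab_sigma k l)) :: ('a kn, 'a kn) tensor"
  have Q: "tensor_flip (comult Kn (kn_X l)) = ?Q l" for l
    by (simp add: comult_Kn_X clinear_add[OF clinear_tensor_flip[OF clinear_id']]
        clinear_setsum[OF clinear_tensor_flip[OF clinear_id']])
  have N: "clinear (\<lambda>p. ?N p v)" for v by (intro clinear_intros)
  have N_pure: "?N (a \<otimes> g) v = kn_of_UV a \<otimes> (kn_of_kab g * kn_of_UV v)" for a g v
    by (rule tensor_lift_pure) (intro clinear_intros)+
  have N_step: "?N (coaction_step l p) v + ?N p (uea_of (V_X l) * v) = ?Q l * ?N p v" for l p v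
  proof (rule tensor_eqI[where t = p])
    fix a :: "'a UV" and g
    show "?N (coaction_step l (a \<otimes> g)) v + ?N (a \<otimes> g) (uea_of (V_X l) * v) = ?Q l * ?N (a \<otimes> g) v"
      unfolding coaction_step_pure clinear_add[OF N] clinear_setsum[OF N] N_pure
      by (simp add: kn_of_UV_of_mult kn_of_V_simps kn_of_kab_hom distrib_right sum_distrib_right mult.assoc kn_of_kab_D left_diff_distrib
          clinear_diff[OF clinear_tensor_right[OF clinear_id']])
  qed (intro clinear_intros)+
  have M: "clinear ?M" by (intro clinear_tensor_lift clinear_intros)
  have M_pure: "?M (u \<otimes> v) = ?N (coaction u) v" for u v
    by (rule tensor_lift_pure) (intro clinear_intros)+
  have M_step: "?M ((uea_of (V_X l) \<otimes> 1 + 1 \<otimes> uea_of (V_X l)) * s) = ?Q l * ?M s" for l s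
  proof (rule tensor_eqI[where t = s])
    fix u v :: "'a UV"
    show "?M ((uea_of (V_X l) \<otimes> 1 + 1 \<otimes> uea_of (V_X l)) * (u \<otimes> v)) = ?Q l * ?M (u \<otimes> v)"
      using N_step[where l = l and p = "coaction u" and v = v] by (simp add: distrib_right[of _ _ "u \<otimes> v"] clinear_add[OF M] M_pure coaction_X_mult)
  qed (intro clinear_intros clinear_compose[OF M])+
  have "?M (uea_comult u) = tensor_flip (comult Kn (kn_of_UV u))"
  proof (induction u rule: UV_induct)
    case one
    show ?case
      unfolding uea_comult_one M_pure coaction_one N_pure by (simp add: kn_of_kab_hom comult_Kn_one)
  next
    case (mult l u)
    then show ?case
      by (simp add: kn_of_UV_of_mult kn_of_V_simps uea_comult_of_mult M_step comult_Kn_mult tensor_flip_mult Q)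
  qed (simp_all add: clinear_add[OF clinear_compose[OF M clinear_uea_comult[OF clinear_id']]]
      clinear_scale[OF clinear_compose[OF M clinear_uea_comult[OF clinear_id']]]
      clinear_add[OF clinear_tensor_flip[OF clinear_comult_Kn[OF clinear_kn_of_UV[OF clinear_id']]]]
      clinear_scale[OF clinear_tensor_flip[OF clinear_comult_Kn[OF clinear_kn_of_UV[OF clinear_id']]]])
  then show ?thesis by (simp add: UV_cop_comult_def)
qed

lemma bicrossed_to_Kn_comult:
  "tensor_flip (comult Kn (bicrossed_to_Kn t)) = tensor_map bicrossed_to_Kn bicrossed_to_Kn (comult bicrossed t)"
proof -
  let ?h = "bicrossed_to_Kn :: ('a kab, 'a UV) tensor \<Rightarrow> 'a kn"
  let ?C = "\<lambda>d u. tensor_lift (\<lambda>f\<^sub>1 f\<^sub>2. tensor_lift (\<lambda>u\<^sub>1 u\<^sub>2. tensor_lift (\<lambda>u\<^sub>1\<^sub>0 u\<^sub>1\<^sub>1.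
      (f\<^sub>1 \<otimes> u\<^sub>1\<^sub>0) \<otimes> ((f\<^sub>2 * u\<^sub>1\<^sub>1) \<otimes> u\<^sub>2)) (coaction u\<^sub>1)) (uea_comult u)) d
      :: (('a kab, 'a UV) tensor, ('a kab, 'a UV) tensor) tensor"
  have hh: "clinear (tensor_map ?h ?h)" by (intro clinear_tensor_map' clinear_bicrossed_to_Kn')
  have c: "comult bicrossed = tensor_lift (\<lambda>f u. ?C (tensor_flip (comult Kab f)) u)"
    by (simp add: bicrossed_def cop_def)
  have C: "tensor_map ?h ?h (?C d u) = tensor_map kn_of_kab kn_of_kab d * UV_cop_comult u" for d and u :: "'a UV"
  proof (rule tensor_eqI[where t = d])
    show "clinear (\<lambda>d. tensor_map ?h ?h (?C d u))"
      by (intro clinear_compose[OF hh] clinear_intros)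
    show "clinear (\<lambda>d. tensor_map kn_of_kab kn_of_kab d * UV_cop_comult u)"
      by (intro clinear_intros clinear_kn_of_kab')
    fix f g :: "'a kab"
    have "?C (f \<otimes> g) u = tensor_lift (\<lambda>u\<^sub>1 u\<^sub>2. tensor_lift (\<lambda>u\<^sub>1\<^sub>0 u\<^sub>1\<^sub>1.
        (f \<otimes> u\<^sub>1\<^sub>0) \<otimes> ((g * u\<^sub>1\<^sub>1) \<otimes> u\<^sub>2)) (coaction u\<^sub>1)) (uea_comult u)"
      by (rule tensor_lift_pure) (intro clinear_intros)+
    also have "tensor_map ?h ?h \<dots> = tensor_lift (\<lambda>u\<^sub>1 u\<^sub>2. tensor_map ?h ?h (tensor_lift (\<lambda>u\<^sub>1\<^sub>0 u\<^sub>1\<^sub>1.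
        (f \<otimes> u\<^sub>1\<^sub>0) \<otimes> ((g * u\<^sub>1\<^sub>1) \<otimes> u\<^sub>2)) (coaction u\<^sub>1))) (uea_comult u)"
      by (rule clinear_tensor_lift_apply[OF hh]) (intro clinear_intros)+
    also have "\<dots> = tensor_lift (\<lambda>u\<^sub>1 u\<^sub>2. tensor_lift (\<lambda>u\<^sub>1\<^sub>0 u\<^sub>1\<^sub>1. tensor_map ?h ?h
        ((f \<otimes> u\<^sub>1\<^sub>0) \<otimes> ((g * u\<^sub>1\<^sub>1) \<otimes> u\<^sub>2))) (coaction u\<^sub>1)) (uea_comult u)"
      by (intro tensor_lift_cong clinear_tensor_lift_apply[OF hh]) (intro clinear_intros)+
    also have "\<dots> = tensor_lift (\<lambda>u\<^sub>1 u\<^sub>2. tensor_lift (\<lambda>u\<^sub>1\<^sub>0 u\<^sub>1\<^sub>1. (kn_of_kab f \<otimes> kn_of_kab g) *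
        (kn_of_UV u\<^sub>1\<^sub>0 \<otimes> (kn_of_kab u\<^sub>1\<^sub>1 * kn_of_UV u\<^sub>2))) (coaction u\<^sub>1)) (uea_comult u)"
      by (simp add: tensor_map_pure clinear_bicrossed_to_Kn' kn_of_kab_hom mult.assoc)
    also have "\<dots> = tensor_lift (\<lambda>u\<^sub>1 u\<^sub>2. (kn_of_kab f \<otimes> kn_of_kab g) * tensor_lift (\<lambda>u\<^sub>1\<^sub>0 u\<^sub>1\<^sub>1.
        kn_of_UV u\<^sub>1\<^sub>0 \<otimes> (kn_of_kab u\<^sub>1\<^sub>1 * kn_of_UV u\<^sub>2)) (coaction u\<^sub>1)) (uea_comult u)"
      by (intro tensor_lift_cong clinear_tensor_lift_apply[symmetric]) (intro clinear_intros)+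
    also have "\<dots> = (kn_of_kab f \<otimes> kn_of_kab g) * UV_cop_comult u"
      unfolding UV_cop_comult_def by (intro clinear_tensor_lift_apply[symmetric]) (intro clinear_intros)+
    finally show "tensor_map ?h ?h (?C (f \<otimes> g) u) = tensor_map kn_of_kab kn_of_kab (f \<otimes> g) * UV_cop_comult u"
      by (simp add: tensor_map_pure clinear_kn_of_kab')
  qed
  have flip_map: "tensor_flip (tensor_map kn_of_kab kn_of_kab d) = tensor_map kn_of_kab kn_of_kab (tensor_flip d)"
    for d :: "('a kab, 'a kab) tensor"
    by (rule tensor_eqI[where t = d]; (intro clinear_intros clinear_kn_of_kab')?)
      (simp add: tensor_map_pure clinear_kn_of_kab')
  show ?thesis
    unfolding c
  proof (rule tensor_eqI[where t = t])
    show "clinear (\<lambda>t. tensor_map ?h ?h (tensor_lift (\<lambda>f u. ?C (tensor_flip (comult Kab f)) u) t))"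
      by (intro clinear_compose[OF hh] clinear_intros)
    fix f and u :: "'a UV"
    have "tensor_lift (\<lambda>f u. ?C (tensor_flip (comult Kab f)) u) (f \<otimes> u) = ?C (tensor_flip (comult Kab f)) u"
      by (rule tensor_lift_pure) (intro clinear_intros)+
    then show "tensor_flip (comult Kn (?h (f \<otimes> u))) =
        tensor_map ?h ?h (tensor_lift (\<lambda>f u. ?C (tensor_flip (comult Kab f)) u) (f \<otimes> u))"
      by (simp only: C) (simp add: comult_Kn_mult tensor_flip_mult comult_Kn_of_kab flip_map UV_cop_comult_eq)
  qed (intro clinear_intros)
qed


section \<open>The map \<open>\<I>\<close> is bijective\<close>

text \<open>As the \<open>X\<^sub>k\<close> commute, the monomials \<open>X\<^sup>N\<close> can be indexed by multisets \<open>N\<close> of coordinates, as can the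
  coordinate monomials \<open>x\<^sup>N\<close>.\<close>

interpretation UV_mult: comp_fun_commute "\<lambda>k (u :: 'n::finite UV). uea_of (V_X k) * u"
  by unfold_locales (simp add: fun_eq_iff uea_of_V_commute flip: mult.assoc)

definition UV_monomial :: "'n::finite multiset \<Rightarrow> 'n UV"
  where "UV_monomial N = fold_mset (\<lambda>k u. uea_of (V_X k) * u) 1 N"

lemma UV_monomial_simps [simp]:
  "UV_monomial {#} = 1" "UV_monomial (add_mset k N) = uea_of (V_X k) * UV_monomial N"
  by (simp_all add: UV_monomial_def UV_mult.fold_mset_add_mset)

definition coord_monomial :: "'n::finite multiset \<Rightarrow> real^'n \<Rightarrow> complex"
  where "coord_monomial N x = (\<Prod>i\<in>#N. of_real (x $ i))"

lemma coord_monomial_simps [simp]: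
  "coord_monomial {#} x = 1" "coord_monomial (add_mset i N) x = of_real (x $ i) * coord_monomial N x"
  by (simp_all add: coord_monomial_def)

lemma smooth_coord_monomial: "smooth (coord_monomial N)"
proof (induction N)
  case empty
  have "coord_monomial {#} = (\<lambda>x :: real^'a. 1)" by (simp add: fun_eq_iff)
  then show ?case by (simp add: smooth_const)
next
  case (add i N)
  have "coord_monomial (add_mset i N) = (\<lambda>x. of_real (x $ i) * coord_monomial N x)" by (simp add: fun_eq_iff)
  then show ?case by (simp only:) (intro smooth_times smooth_of_real smooth_nth smooth_ident add)
qed

lemma partial_coord_monomial:
  "partial k (coord_monomial N) x = of_nat (count N k) * coord_monomial (N - {#k#}) x"
proof (induction N)
  case empty
  have "coord_monomial {#} = (\<lambda>x :: real^'a. 1)" by (simp add: fun_eq_iff)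
  then show ?case by (simp add: partial_const)
next
  case (add i N)
  have e: "coord_monomial (add_mset i N) = (\<lambda>x. of_real (x $ i) * coord_monomial N x)" by (simp add: fun_eq_iff)
  have "partial k (\<lambda>x :: real^'a. of_real (x $ i) :: complex) x = (if i = k then 1 else 0)"
    by (subst partial_linear_map[OF bounded_linear_of_real]) (simp_all add: smooth_nth smooth_ident partial_nth)
  then have p: "partial k (coord_monomial (add_mset i N)) x =
      of_real (x $ i) * (of_nat (count N k) * coord_monomial (N - {#k#}) x) + (if i = k then coord_monomial N x else 0)"
    unfolding e
    by (simp add: partial_mult smooth_of_real smooth_nth smooth_ident smooth_coord_monomial add)
  show ?case
  proof (cases "k \<in># N")
    case True
    then obtain P where N: "N = add_mset k P" by (metis mset_add)
    show ?thesis unfolding p by (cases "i = k") (simp_all add: N algebra_simps)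
  next
    case False
    then have "count N k = 0" by (simp add: not_in_iff)
    then show ?thesis unfolding p by simp
  qed
qed

lemma kn_app_mult_component:
  "component (kn_app (k * l)) \<phi> f = component (kn_app k) \<phi> (component (kn_app l) \<phi> f)"
proof -
  have "kn_app (k * l) = kn_app k \<circ> kn_app l" by (simp add: fun_eq_iff times_kn.rep_eq)
  then show ?thesis by (simp only: component_comp(1)[OF kn.app_mem])
qed

lemma kn_of_UV_X_commute: "kn_X k * kn_of_UV u = kn_of_UV u * kn_X k"
proof (induction u rule: UV_induct)
  case (mult l u)
  then show ?case by (metis (no_types) kn_X_commute kn_of_UV_of_mult kn_of_V_simps(3) mult.assoc)
qed (simp_all add: clinear_add[OF clinear_kn_of_UV[OF clinear_id']] clinear_scale[OF clinear_kn_of_UV[OF clinear_id']]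
    distrib_left distrib_right mult_scaleC_left mult_scaleC_right)

definition UV_at_0 :: "'n::finite test_fun \<Rightarrow> 'n UV \<Rightarrow> complex"
  where "UV_at_0 g u = kn.eval_at (diffeo_id, 0, g) (kn_of_UV u)"

lemma clinear_UV_at_0: "clinear (UV_at_0 g)"
  unfolding UV_at_0_def[abs_def] by (intro clinear_compose[OF kn.clinear_eval_at] clinear_intros)

lemma UV_at_0_X_mult: "UV_at_0 g (uea_of (V_X k) * u) = UV_at_0 (test_fun_partial k g) u"
  by (simp add: UV_at_0_def kn_of_UV_of_mult kn_of_V_simps kn_of_UV_X_commute kn.eval_at_apply
      kn_app_mult_component kn_X.rep_eq)

text \<open>One derivative \<open>\<partial>\<^sub>k\<close> at a time turns \<open>x\<^sup>N\<close> into a multiple of \<open>x\<^bsup>N - {k}\<^esup>\<close>, with factor 0 if \<open>k\<close> does not occur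
  in \<open>N\<close>; so the operators \<open>\<partial>\<^sup>M\<close> are linearly independent.\<close>

lemma UV_at_0_monomial:
  "\<exists>K. K \<noteq> 0 \<and> (\<forall>N g c. (\<forall>x\<in>ball 0 1. test_fun_app g x = c * coord_monomial N x) \<longrightarrow>
    UV_at_0 g (UV_monomial M) = (if M = N then c * K else 0))"
proof (induction M)
  case empty
  have "coord_monomial N 0 = (if N = {#} then 1 else 0)" for N :: "'a multiset"
    by (cases N) simp_all
  moreover have "component (kn_app 1) diffeo_id g = g" for g :: "'a test_fun"
    by (simp add: one_kn.rep_eq)
  ultimately show ?case
    by (intro exI[of _ 1]) (auto simp: UV_at_0_def kn.eval_at_apply)
next
  case (add k M)
  then obtain K where K: "K \<noteq> 0" and IH: "\<And>N g c. (\<forall>x\<in>ball 0 1. test_fun_app g x = c * coord_monomial N x) \<Longrightarrow>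
      UV_at_0 g (UV_monomial M) = (if M = N then c * K else 0)" by blast
  have "UV_at_0 g (UV_monomial (add_mset k M)) = (if add_mset k M = N then c * (of_nat (Suc (count M k)) * K) else 0)"
    if g: "\<forall>x\<in>ball 0 1. test_fun_app g x = c * coord_monomial N x" for N g c
  proof -
    have "test_fun_app (test_fun_partial k g) x = c * of_nat (count N k) * coord_monomial (N - {#k#}) x"
      if "x \<in> ball 0 1" for x
    proof -
      have "partial k (test_fun_app g) x = partial k (\<lambda>x. c * coord_monomial N x) x"
        by (rule partial_local[OF open_ball that]) (use g in blast)
      also have "\<dots> = c * (of_nat (count N k) * coord_monomial (N - {#k#}) x)"
        by (simp add: partial_mult smooth_const smooth_coord_monomial partial_const partial_coord_monomial)
      finally show ?thesis by (simp add: test_fun_app_partial)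
    qed
    then have *: "UV_at_0 g (UV_monomial (add_mset k M)) = (if M = N - {#k#} then c * of_nat (count N k) * K else 0)"
      using IH by (simp add: UV_at_0_X_mult)
    show ?thesis
    proof (cases "k \<in># N")
      case True
      then obtain P where N: "N = add_mset k P" by (metis mset_add)
      show ?thesis unfolding * by (simp add: N)
    next
      case False
      then have "count N k = 0" "add_mset k M \<noteq> N" by (auto simp: not_in_iff)
      then show ?thesis unfolding * by simp
    qed
  qed
  moreover have "of_nat (Suc (count M k)) * K \<noteq> 0" using K by (simp only: mult_eq_0_iff of_nat_eq_0_iff) simp
  ultimately show ?case by blast
qed

lemma UV_span_monomials: "u \<in> complex_space.span (range UV_monomial)"
proof (induction u rule: UV_induct)
  case one
  have "UV_monomial {#} \<in> complex_space.span (range UV_monomial)" by (rule complex_space.span_base) blast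
  then show ?case by simp
next
  case (mult k u)
  show ?case
    using mult
  proof (induction rule: complex_space.span_induct_alt)
    case base
    then show ?case by (simp add: complex_space.span_zero)
  next
    case (step c v w)
    then obtain N where "v = UV_monomial N" by blast
    then have "uea_of (V_X k) * v \<in> complex_space.span (range UV_monomial)"
      by (metis UV_monomial_simps(2) complex_space.span_base rangeI)
    with step show ?case
      by (simp add: distrib_left mult_scaleC_right complex_space.span_add complex_space.span_scale)
  qed
qed (auto intro: complex_space.span_add complex_space.span_scale)

lemma separating_UV_at_0: "separating UV_at_0"
  unfolding separating_def
proof (intro conjI allI impI clinear_UV_at_0)
  fix u :: "'a UV" assume u: "\<forall>g. UV_at_0 g u = 0"
  obtain t r where t: "finite t" "t \<subseteq> range UV_monomial" "u = (\<Sum>a\<in>t. r a *\<^sub>C a)"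
    using UV_span_monomials[of u] unfolding complex_space.span_explicit by blast
  define idx where "idx a = (SOME N. a = UV_monomial N)" for a :: "'a UV"
  have idx: "a = UV_monomial (idx a)" if "a \<in> t" for a
    unfolding idx_def by (rule someI_ex) (use t(2) that in blast)
  have "r a = 0" if a: "a \<in> t" for a
  proof -
    \<comment> \<open>a test function equal to \<open>x\<^sup>N\<close> near 0 singles out the coefficient of \<open>X\<^sup>N\<close>\<close>
    let ?g = "test_fun_smult (coord_monomial (idx a)) (plateau 0)"
    have g: "\<forall>x\<in>ball 0 1. test_fun_app ?g x = 1 * coord_monomial (idx a) x"
      by (simp add: test_fun_app_smult smooth_coord_monomial plateau_eq_1)
    have z: "UV_at_0 ?g b = 0" if b: "b \<in> t" "b \<noteq> a" for b
    proof -
      have "idx b \<noteq> idx a" using idx a b by metis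
      moreover obtain K where "\<And>N g c. (\<forall>x\<in>ball 0 1. test_fun_app g x = c * coord_monomial N x) \<Longrightarrow>
          UV_at_0 g (UV_monomial (idx b)) = (if idx b = N then c * K else 0)"
        using UV_at_0_monomial[of "idx b"] by blast
      note this[OF g]
      ultimately have "UV_at_0 ?g (UV_monomial (idx b)) = 0" by simp
      with idx[OF b(1)] show ?thesis by metis
    qed
    obtain K where K: "K \<noteq> 0" "\<And>N g c. (\<forall>x\<in>ball 0 1. test_fun_app g x = c * coord_monomial N x) \<Longrightarrow>
        UV_at_0 g (UV_monomial (idx a)) = (if idx a = N then c * K else 0)"
      using UV_at_0_monomial[of "idx a"] by blast
    from K(2)[OF g] have "UV_at_0 ?g (UV_monomial (idx a)) = K" by simp
    with idx[OF a] have ga: "UV_at_0 ?g a = K" by metis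
    have "0 = UV_at_0 ?g u" using u by simp
    also have "\<dots> = (\<Sum>b\<in>t. r b * UV_at_0 ?g b)"
      unfolding t(3) by (simp add: clinear_setsum[OF clinear_UV_at_0] clinear_scale[OF clinear_UV_at_0] scaleC_complex_def)
    also have "\<dots> = (\<Sum>b\<in>{a}. r b * UV_at_0 ?g b)"
      by (rule sum.mono_neutral_right) (use t(1) a z in auto)
    finally show "r a = 0" using K(1) ga by simp
  qed
  then show "u = 0" by (simp add: t(3))
qed

lemma component_UV: "component (kn_app (kn_of_UV u)) \<phi> = component (kn_app (kn_of_UV u)) \<psi>"
proof (induction u rule: UV_induct)
  case one
  show ?case by (simp add: fun_eq_iff component_def one_kn.rep_eq)
next
  case (add u v)
  then show ?case
    by (simp add: fun_eq_iff clinear_add[OF clinear_kn_of_UV[OF clinear_id']] plus_kn.rep_eq component_def lookup_add)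
next
  case (scale c u)
  then show ?case
    by (simp add: fun_eq_iff clinear_scale[OF clinear_kn_of_UV[OF clinear_id']] scaleC_kn.rep_eq component_def lookup_scaleC)
next
  case (mult k u)
  then show ?case
    by (simp add: fun_eq_iff kn_of_UV_of_mult kn_of_V_simps kn_app_mult_component kn_X.rep_eq)
qed

lemma UV_at_0_translate:
  "UV_at_0 g u = test_fun_app (component (kn_app (kn_of_UV u)) \<phi> (test_fun_compose g (translation (- x)))) x"
proof -
  have "component (kn_app (kn_of_UV u)) \<phi> (test_fun_compose g (translation (- x))) =
      component (kn_app (kn_of_UV u)) (diffeo_comp diffeo_id (translation (- x))) (test_fun_compose g (translation (- x)))"
    by (rule fun_cong[OF component_UV])
  also have "\<dots> = test_fun_compose (component (kn_app (kn_of_UV u)) diffeo_id g) (translation (- x))"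
    by (rule component_right_translation[OF kn.app_mem])
  finally show ?thesis by (simp add: UV_at_0_def kn.eval_at_apply)
qed

lemma clinear_gamma: "clinear (\<lambda>f. kab_gamma f \<phi> x)"
  by (rule clinearI) (simp_all add: scaleC_complex_def)

lemma separating_gamma: "separating (\<lambda>(\<phi>, x) f. kab_gamma f \<phi> x)"
proof -
  have "f = 0" if "\<forall>\<phi> x. kab_gamma f \<phi> x = 0" for f :: "'a kab"
    by (rule kab_eqI) (simp add: that clinear_0[OF clinear_gamma])
  then show ?thesis by (auto simp: separating_def clinear_gamma split: prod.splits)
qed

text \<open>Evaluating \<open>f u\<close> on \<open>g U*\<^sub>\<phi>\<close> at \<open>x\<close> gives \<open>\<gamma>(f)(\<phi>)(x)\<close> times \<open>(u g)(x)\<close>; as \<open>g\<close> is arbitrary, such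
  products separate the elements of \<open>\<F>\<^sub>\<K> \<otimes> \<U>(V)\<close>.\<close>

lemma inj_bicrossed_to_Kn: "inj bicrossed_to_Kn"
proof -
  have "t = 0" if t: "bicrossed_to_Kn t = 0" for t :: "('a kab, 'a UV) tensor"
  proof (rule separating_tensor_vanish[OF separating_gamma separating_UV_at_0])
    fix p :: "'a diffeo \<times> (real^'a)" and g :: "'a test_fun"
    obtain \<phi> x where p: "p = (\<phi>, x)" by (cases p)
    let ?e = "kn.eval_at (\<phi>, x, test_fun_compose g (translation (- x)))"
    have "tensor_functional (\<lambda>f. kab_gamma f \<phi> x) (UV_at_0 g) t = ?e (bicrossed_to_Kn t)"
    proof (rule tensor_eqI[where t = t])
      show "clinear (tensor_functional (\<lambda>f. kab_gamma f \<phi> x) (UV_at_0 g))"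
        by (intro clinear_tensor_functional clinear_gamma clinear_UV_at_0)
      show "clinear (\<lambda>t. ?e (bicrossed_to_Kn t))"
        by (intro clinear_compose[OF kn.clinear_eval_at] clinear_intros)
      show "tensor_functional (\<lambda>f. kab_gamma f \<phi> x) (UV_at_0 g) (f \<otimes> u) = ?e (bicrossed_to_Kn (f \<otimes> u))" for f u
        by (simp add: tensor_functional_pure clinear_gamma clinear_UV_at_0 kn.eval_at_apply kn_app_mult_component
            kab_app_gamma[of f] test_fun_app_smult smooth_gamma UV_at_0_translate[of g u \<phi> x])
    qed
    then show "tensor_functional ((\<lambda>(\<phi>, x) f. kab_gamma f \<phi> x) p) (UV_at_0 g) t = 0"
      by (simp add: p t clinear_0[OF kn.clinear_eval_at])
  qed
  then show ?thesis
    by (intro injI) (metis clinear_diff[OF clinear_bicrossed_to_Kn'] eq_iff_diff_eq_0)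
qed

lemma surj_bicrossed_to_Kn: "surj (bicrossed_to_Kn :: ('n::finite kab, 'n UV) tensor \<Rightarrow> 'n kn)"
proof -
  have "\<exists>t. k = bicrossed_to_Kn t" for k :: "'n kn"
  proof (induction k rule: kn_induct)
    case one
    show ?case by (metis bicrossed_to_Kn_unit)
  next
    case (add k l)
    then show ?case by (metis clinear_add[OF clinear_bicrossed_to_Kn'])
  next
    case (scale c k)
    then show ?case by (metis clinear_scale[OF clinear_bicrossed_to_Kn'])
  next
    case (mult k l)
    then show ?case by (metis bicrossed_to_Kn_mult)
  next
    case (X k)
    show ?case by (intro exI[of _ "1 \<otimes> uea_of (V_X k)"]) (simp add: kn_of_kab_hom kn_of_V_simps)
  next
    case (sigma i j)
    show ?case by (intro exI[of _ "kab_sigma i j \<otimes> 1"]) simp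
  next
    case sigma_inv
    show ?case by (intro exI[of _ "kab_sigma_inv \<otimes> 1"]) simp
  qed
  then show ?thesis unfolding surj_def by blast
qed

lemma bij_bicrossed_to_Kn: "bij bicrossed_to_Kn"
  by (intro bijI inj_bicrossed_to_Kn surj_bicrossed_to_Kn)

lemma clinear_inv: "clinear h \<Longrightarrow> bij h \<Longrightarrow> clinear (inv h)"
  by (rule clinearI; rule inv_f_eq)
    (simp_all add: bij_is_inj clinear_add clinear_scale bij_is_surj surj_f_inv_f)


section \<open>The antipode of \<open>\<K>\<^sub>n\<close>\<close>

text \<open>Formal transposition \<open>\<theta>(f u) = S\<^sub>\<U>(u) f\<close>, the anti-automorphism with \<open>X\<^sub>l \<mapsto> - X\<^sub>l\<close> that fixes
  \<open>\<K>\<^sub>a\<^sub>b\<close>. It is well defined because \<open>\<I>\<close> is bijective.\<close>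

definition kn_transpose :: "'n::finite kn \<Rightarrow> 'n kn"
  where "kn_transpose k = tensor_lift (\<lambda>f u. kn_of_UV (uea_antipode u) * kn_of_kab f) (inv bicrossed_to_Kn k)"

lemma clinear_kn_transpose: "clinear kn_transpose"
  unfolding kn_transpose_def[abs_def]
  by (intro clinear_intros clinear_inv clinear_bicrossed_to_Kn' bij_bicrossed_to_Kn)

lemma kn_transpose_pure: "kn_transpose (kn_of_kab f * kn_of_UV u) = kn_of_UV (uea_antipode u) * kn_of_kab f"
proof -
  have "inv bicrossed_to_Kn (kn_of_kab f * kn_of_UV u) = f \<otimes> u"
    by (rule inv_f_eq[OF inj_bicrossed_to_Kn]) simp
  moreover have "tensor_lift (\<lambda>f u. kn_of_UV (uea_antipode u) * kn_of_kab f) (f \<otimes> u) =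
      kn_of_UV (uea_antipode u) * kn_of_kab f"
    by (rule tensor_lift_pure) (intro clinear_intros)+
  ultimately show ?thesis by (simp add: kn_transpose_def)
qed

lemma kn_transpose_of_kab [simp]: "kn_transpose (kn_of_kab f) = kn_of_kab f"
  using kn_transpose_pure[of f 1] by simp

lemma kn_transpose_of_UV: "kn_transpose (kn_of_UV u) = kn_of_UV (uea_antipode u)"
  using kn_transpose_pure[of 1 u] by (simp add: kn_of_kab_hom)

lemma kn_transpose_X: "kn_transpose (kn_X l) = - kn_X l"
proof -
  have "uea_antipode (uea_of (V_X l)) = - uea_of (V_X l)"
    using uea_antipode_of_mult[of "V_X l" 1] by simp
  then show ?thesis
    using kn_transpose_of_UV[of "uea_of (V_X l)"]
    by (simp add: kn_of_V_simps clinear_neg[OF clinear_kn_of_UV[OF clinear_id']])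
qed

lemma kn_transpose_one [simp]: "kn_transpose 1 = 1"
  using kn_transpose_of_kab[of 1] by (simp add: kn_of_kab_hom)

lemma kn_pure_eqI:
  assumes "clinear F" "clinear G" "\<And>f u. F (kn_of_kab f * kn_of_UV u) = G (kn_of_kab f * kn_of_UV u)"
  shows "F k = G k"
proof -
  obtain t where k: "k = bicrossed_to_Kn t" using surj_bicrossed_to_Kn by (metis surjD)
  show ?thesis
    unfolding k
    by (rule tensor_eqI[where t = t]; (intro clinear_compose[OF assms(1)] clinear_compose[OF assms(2)]
          clinear_bicrossed_to_Kn')?)
      (simp add: assms(3))
qed

lemma kn_transpose_of_kab_mult: "kn_transpose (kn_of_kab f * k) = kn_transpose k * kn_of_kab f"
  by (rule kn_pure_eqI[where k = k]; (intro clinear_intros clinear_compose[OF clinear_kn_transpose])?)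
    (simp add: kn_transpose_pure mult.assoc[symmetric] mult.commute flip: kn_of_kab_hom(3);
     simp add: kn_transpose_pure mult.assoc kn_of_kab_hom)

text \<open>Since \<open>X\<^sub>l f u = [X\<^sub>l, f] u + f X\<^sub>l u\<close>, the transpose is \<open>S\<^sub>\<U>(u) ([X\<^sub>l, f] - X\<^sub>l f) = - S\<^sub>\<U>(u) f X\<^sub>l\<close>.\<close>

lemma kn_transpose_X_mult: "kn_transpose (kn_X l * k) = kn_transpose k * - kn_X l"
proof (rule kn_pure_eqI[where k = k])
  show "clinear (\<lambda>k. kn_transpose (kn_X l * k))" "clinear (\<lambda>k. kn_transpose k * - kn_X l)"
    by (intro clinear_intros clinear_compose[OF clinear_kn_transpose] clinear_kn_transpose)+
  fix f u
  have "kn_X l * (kn_of_kab f * kn_of_UV u) =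
      kn_of_kab (kab_D l f) * kn_of_UV u + kn_of_kab f * kn_of_UV (uea_of (V_X l) * u)"
    by (simp add: kn_of_kab_D kn_of_UV_of_mult kn_of_V_simps left_diff_distrib mult.assoc)
  then have "kn_transpose (kn_X l * (kn_of_kab f * kn_of_UV u)) =
      kn_of_UV (uea_antipode u) * kn_of_kab (kab_D l f) + kn_of_UV (uea_antipode u * - uea_of (V_X l)) * kn_of_kab f"
    by (simp only: clinear_add[OF clinear_kn_transpose] kn_transpose_pure uea_antipode_of_mult)
  also have "\<dots> = kn_of_UV (uea_antipode u) * kn_of_kab f * - kn_X l"
    by (simp add: kn_of_kab_D kn_of_UV_mult kn_of_V_simps clinear_neg[OF clinear_kn_of_UV[OF clinear_id']]
        right_diff_distrib mult.assoc)
  finally show "kn_transpose (kn_X l * (kn_of_kab f * kn_of_UV u)) =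
      kn_transpose (kn_of_kab f * kn_of_UV u) * - kn_X l"
    by (simp add: kn_transpose_pure)
qed

lemma kn_transpose_mult: "kn_transpose (k * l) = kn_transpose l * kn_transpose k"
proof (induction k arbitrary: l rule: kn_induct)
  case (mult k k')
  then show ?case by (simp add: mult.assoc)
qed (simp_all add: distrib_left distrib_right mult_scaleC_left mult_scaleC_right clinear_add[OF clinear_kn_transpose]
    clinear_scale[OF clinear_kn_transpose] kn_transpose_X_mult kn_transpose_X kn_transpose_of_kab_mult)

lemma kn_transpose_transpose [simp]: "kn_transpose (kn_transpose k) = k"
  by (induction k rule: kn_induct)
    (simp_all add: clinear_add[OF clinear_kn_transpose] clinear_scale[OF clinear_kn_transpose]
      clinear_neg[OF clinear_kn_transpose] kn_transpose_mult kn_transpose_X)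

definition kn_antipode :: "'n::finite kn \<Rightarrow> 'n kn"
  where "kn_antipode k = kn_sharp (kn_transpose k)"

definition kn_antipode_inv :: "'n::finite kn \<Rightarrow> 'n kn"
  where "kn_antipode_inv k = kn_transpose (kn_sharp k)"

lemma kn_antipode_inverse [simp]: "kn_antipode (kn_antipode_inv k) = k"
  by (simp add: kn_antipode_def kn_antipode_inv_def)

lemma kn_antipode_inject: "kn_antipode k = kn_antipode l \<Longrightarrow> k = l"
  unfolding kn_antipode_def by (metis kn_sharp_sharp kn_transpose_transpose)

lemma clinear_kn_antipode: "clinear kn_antipode"
  unfolding kn_antipode_def[abs_def] by (intro clinear_intros clinear_kn_transpose)

lemma clinear_kn_antipode_inv: "clinear kn_antipode_inv"
  unfolding kn_antipode_inv_def[abs_def]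
  by (intro clinear_compose[OF clinear_kn_transpose] clinear_intros)

lemma kn_antipode_mult: "kn_antipode (k * l) = kn_antipode l * kn_antipode k"
  by (simp add: kn_antipode_def kn_transpose_mult kn_sharp_mult)

lemma kn_antipode_one [simp]: "kn_antipode 1 = 1"
  by (simp add: kn_antipode_def)

lemma kn_antipode_of_kab: "kn_antipode (kn_of_kab f) = kn_of_kab (kab_antipode f)"
  by (simp add: kn_antipode_def kn_sharp_of_kab)

lemma kn_antipode_X: "kn_antipode (kn_X l) = - (\<Sum>k\<in>UNIV. kn_of_kab (kab_antipode (kab_sigma k l)) * kn_X k)"
  by (simp add: kn_antipode_def kn_transpose_X clinear_neg[OF clinear_kn_sharp[OF clinear_id']] kn_sharp_X)

lemma antihom_kn_antipode: "antihom Kn kn_antipode"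
  by (simp add: antihom_def clinear_kn_antipode kn_antipode_mult)

text \<open>For an anti-multiplicative \<open>S\<close> the antipode identities pass to products, so it suffices to check
  them on generators.\<close>

lemma antipode_left_mult:
  fixes S :: "'a::{complex_algebra, monoid_mult} \<Rightarrow> 'a"
  assumes S: "clinear S" "\<And>x y. S (x * y) = S y * S x"
    and s: "tensor_lift (\<lambda>x y. S x * y) s = c *\<^sub>C 1" and t: "tensor_lift (\<lambda>x y. S x * y) t = d *\<^sub>C 1"
  shows "tensor_lift (\<lambda>x y. S x * y) (s * t) = (c * d) *\<^sub>C 1"
proof -
  note SI [clinear_intros] = clinear_compose[OF S(1)]
  let ?L = "tensor_lift (\<lambda>x y. S x * y)"
  have L: "clinear ?L" and pure: "?L (x \<otimes> y) = S x * y" for x y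
    by (intro clinear_tensor_lift tensor_lift_pure clinear_intros)+
  have 1: "?L (s * (x \<otimes> y)) = S x * ?L s * y" for x y
    by (rule tensor_eqI[where t = s]; (intro clinear_compose[OF L] clinear_intros L)?)
      (simp add: pure S(2) mult.assoc)
  have "?L (s * t) = c *\<^sub>C ?L t"
  proof (rule tensor_eqI[where t = t])
    show "?L (s * (x \<otimes> y)) = c *\<^sub>C ?L (x \<otimes> y)" for x y
      unfolding 1 s pure by (simp add: mult_scaleC_left mult_scaleC_right)
  qed (intro clinear_compose[OF L] clinear_intros L)+
  then show ?thesis by (simp add: t scaleC_scaleC)
qed

lemma antipode_right_mult:
  fixes S :: "'a::{complex_algebra, monoid_mult} \<Rightarrow> 'a"
  assumes S: "clinear S" "\<And>x y. S (x * y) = S y * S x"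
    and s: "tensor_lift (\<lambda>x y. x * S y) s = c *\<^sub>C 1" and t: "tensor_lift (\<lambda>x y. x * S y) t = d *\<^sub>C 1"
  shows "tensor_lift (\<lambda>x y. x * S y) (s * t) = (c * d) *\<^sub>C 1"
proof -
  note SI [clinear_intros] = clinear_compose[OF S(1)]
  let ?L = "tensor_lift (\<lambda>x y. x * S y)"
  have L: "clinear ?L" and pure: "?L (x \<otimes> y) = x * S y" for x y
    by (intro clinear_tensor_lift tensor_lift_pure clinear_intros)+
  have 1: "?L ((x \<otimes> y) * t) = x * ?L t * S y" for x y
    by (rule tensor_eqI[where t = t]; (intro clinear_compose[OF L] clinear_intros L)?)
      (simp add: pure S(2) mult.assoc)
  have "?L (s * t) = d *\<^sub>C ?L s"
  proof (rule tensor_eqI[where t = s])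
    show "?L ((x \<otimes> y) * t) = d *\<^sub>C ?L (x \<otimes> y)" for x y
      unfolding 1 t pure by (simp add: mult_scaleC_left mult_scaleC_right)
  qed (intro clinear_compose[OF L] clinear_intros L)+
  then show ?thesis by (simp add: s scaleC_scaleC mult.commute)
qed

lemma kn_of_kab_sum: "kn_of_kab (\<Sum>i\<in>I. f i) = (\<Sum>i\<in>I. kn_of_kab (f i))"
  by (rule clinear_setsum[OF clinear_kn_of_kab'])

lemma kn_antipode_identities:
  "tensor_lift (\<lambda>x y. kn_antipode x * y) (comult Kn k) = counit Kn k *\<^sub>C 1"
  "tensor_lift (\<lambda>x y. x * kn_antipode y) (comult Kn k) = counit Kn k *\<^sub>C 1"
proof -
  note SI [clinear_intros] = clinear_compose[OF clinear_kn_antipode]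
  let ?L = "tensor_lift (\<lambda>x y. kn_antipode x * y)" and ?R = "tensor_lift (\<lambda>x y. x * kn_antipode y)"
  have L: "clinear ?L" and L_pure: "?L (x \<otimes> y) = kn_antipode x * y" for x y :: "'a kn"
    by (intro clinear_tensor_lift tensor_lift_pure clinear_intros)+
  have R: "clinear ?R" and R_pure: "?R (x \<otimes> y) = x * kn_antipode y" for x y :: "'a kn"
    by (intro clinear_tensor_lift tensor_lift_pure clinear_intros)+
  have one: "kn_of_kab (if i = j then 1 else 0) = (if i = j then 1 else 0 :: 'a kn)" for i j :: 'a
    by (simp add: kn_of_kab_hom clinear_0[OF clinear_kn_of_kab'])
  have "?L (comult Kn k) = counit Kn k *\<^sub>C 1 \<and> ?R (comult Kn k) = counit Kn k *\<^sub>C 1"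
  proof (induction k rule: kn_induct)
    case one
    show ?case by (simp add: comult_Kn_one L_pure R_pure scaleC_one)
  next
    case (add k l)
    then show ?case
      by (simp add: clinear_add[OF clinear_comult_Kn[OF clinear_id']] clinear_add[OF L] clinear_add[OF R]
          clinear_add[OF clinear_counit_Kn[OF clinear_id']] scaleC_add_left)
  next
    case (scale c k)
    then show ?case
      by (simp add: clinear_scale[OF clinear_comult_Kn[OF clinear_id']] clinear_scale[OF L] clinear_scale[OF R]
          clinear_scale[OF clinear_counit_Kn[OF clinear_id']] scaleC_scaleC scaleC_complex_def)
  next
    case (mult k l)
    then show ?case
      by (simp add: comult_Kn_mult counit_Kn_mult antipode_left_mult[OF clinear_kn_antipode kn_antipode_mult]
          antipode_right_mult[OF clinear_kn_antipode kn_antipode_mult])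
  next
    case (X l)
    \<comment> \<open>\<open>\<sigma>\<^sup>k\<^sub>l S(X\<^sub>k) = - \<sigma>\<^sup>k\<^sub>l S(\<sigma>\<^sup>m\<^sub>k) X\<^sub>m = - X\<^sub>l\<close>, which cancels \<open>X\<^sub>l S(1)\<close>\<close>
    have "(\<Sum>k\<in>UNIV. kn_of_kab (kab_sigma k l) * kn_antipode (kn_X k)) =
        - (\<Sum>k\<in>UNIV. \<Sum>m\<in>UNIV. kn_of_kab (kab_sigma k l * kab_antipode (kab_sigma m k)) * kn_X m)"
      by (simp add: kn_antipode_X sum_negf sum_distrib_left kn_of_kab_hom mult.assoc)
    also have "(\<Sum>k\<in>UNIV. \<Sum>m\<in>UNIV. kn_of_kab (kab_sigma k l * kab_antipode (kab_sigma m k)) * kn_X m) =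
        (\<Sum>m\<in>UNIV. kn_of_kab (\<Sum>k\<in>UNIV. kab_sigma k l * kab_antipode (kab_sigma m k)) * kn_X m)"
      by (subst sum.swap) (simp add: kn_of_kab_sum sum_distrib_right)
    also have "\<dots> = (\<Sum>m\<in>UNIV. if m = l then kn_X m else 0)"
      by (intro sum.cong refl) (simp add: kab_antipode_sigma_right one)
    finally have "(\<Sum>k\<in>UNIV. kn_of_kab (kab_sigma k l) * kn_antipode (kn_X k)) = - kn_X l" by simp
    then show ?case
      by (simp add: comult_Kn_X clinear_add[OF L] clinear_add[OF R] clinear_setsum[OF L] clinear_setsum[OF R]
          L_pure R_pure counit_Kn_X kn_antipode_X kn_antipode_of_kab)
  next
    case (sigma i j)
    have "comult Kn (kn_of_kab (kab_sigma i j)) = (\<Sum>k\<in>UNIV. kn_of_kab (kab_sigma k j) \<otimes> kn_of_kab (kab_sigma i k))"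
      by (simp add: comult_Kn_of_kab comult_Kab_sigma clinear_setsum[OF clinear_tensor_map'] clinear_kn_of_kab'
          tensor_map_pure)
    moreover have "(\<Sum>k\<in>UNIV. kn_of_kab (kab_antipode (kab_sigma k j)) * kn_of_kab (kab_sigma i k)) =
        kn_of_kab (\<Sum>k\<in>UNIV. kab_antipode (kab_sigma k j) * kab_sigma i k)"
      by (simp add: kn_of_kab_sum kn_of_kab_hom)
    moreover have "(\<Sum>k\<in>UNIV. kn_of_kab (kab_sigma k j) * kn_of_kab (kab_antipode (kab_sigma i k))) =
        kn_of_kab (\<Sum>k\<in>UNIV. kab_sigma k j * kab_antipode (kab_sigma i k))"
      by (simp add: kn_of_kab_sum kn_of_kab_hom)
    ultimately show ?case
      by (simp add: clinear_setsum[OF L] clinear_setsum[OF R] L_pure R_pure kn_antipode_of_kab counit_Kn_of_kab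
          counit_Kab_sigma kab_antipode_sigma_left kab_antipode_sigma_right one scaleC_one)
  next
    case sigma_inv
    have "kn_of_kab (kab_antipode kab_sigma_inv) * kn_of_kab kab_sigma_inv = (1 :: 'a kn)"
      "kn_of_kab kab_sigma_inv * kn_of_kab (kab_antipode kab_sigma_inv) = (1 :: 'a kn)"
      using kab_antipode_sigma_inv[where 'a = 'a] by (simp_all add: mult.commute kn_of_kab_hom flip: kn_of_kab_hom(3))
    then show ?case
      by (simp add: comult_Kn_of_kab comult_Kab_sigma_inv tensor_map_pure clinear_kn_of_kab' L_pure R_pure
          kn_antipode_of_kab counit_Kn_of_kab counit_Kab_sigma_inv scaleC_one)
  qed
  then show "?L (comult Kn k) = counit Kn k *\<^sub>C 1" "?R (comult Kn k) = counit Kn k *\<^sub>C 1" by blast+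
qed

lemma antipode_kn_antipode: "antipode Kn kn_antipode"
  by (simp add: antipode_def clinear_kn_antipode kn_antipode_identities)


section \<open>The bicrossed product as a Hopf algebra\<close>

text \<open>Convolution argument: \<open>S(x) = S(x\<^sub>1) x\<^sub>2 T(x\<^sub>3) = T(x)\<close>.\<close>

lemma antipode_unique:
  fixes B :: "('a::{complex_algebra, monoid_mult}, 'm) bialgebra_data_scheme"
  assumes B: "coalgebra B" "mult B = (*)" "unit B = 1" and S: "antipode B S" and T: "antipode B T"
  shows "S x = T x"
proof -
  have lin: "clinear S" "clinear T" "clinear (comult B)" "clinear (counit B)"
    and coassoc: "tensor_assoc (tensor_map (comult B) id (comult B x)) = tensor_map id (comult B) (comult B x)"
    and counit: "tensor_lift (\<lambda>x y. counit B x *\<^sub>C y) (comult B x) = x"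
      "tensor_lift (\<lambda>x y. counit B y *\<^sub>C x) (comult B x) = x"
    and Si: "tensor_lift (\<lambda>x y. S x * y) (comult B x) = counit B x *\<^sub>C 1"
    and Ti: "tensor_lift (\<lambda>x y. x * T y) (comult B x) = counit B x *\<^sub>C 1" for x
    using B S T by (auto simp: coalgebra_def antipode_def)
  note [clinear_intros] = clinear_compose[OF lin(1)] clinear_compose[OF lin(2)] clinear_compose[OF lin(3)]
    clinear_compose[OF lin(4)]
  have id: "clinear (id :: 'a \<Rightarrow> 'a)" unfolding id_def by (rule clinear_id')
  let ?G = "tensor_lift (\<lambda>x t. S x * tensor_lift (\<lambda>y z. y * T z) t)"
  have G: "clinear ?G" by (intro clinear_tensor_lift clinear_intros)
  have G_pure: "?G (x \<otimes> t) = S x * tensor_lift (\<lambda>y z. y * T z) t" for x t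
    by (rule tensor_lift_pure) (intro clinear_intros)+
  have R: "tensor_lift (\<lambda>y z. y * T z) (y \<otimes> z) = y * T z" for y z
    by (rule tensor_lift_pure) (intro clinear_intros)+
  have Lp: "tensor_lift (\<lambda>x y. S x * y) (y \<otimes> z) = S y * z" for y z
    by (rule tensor_lift_pure) (intro clinear_intros)+
  have right: "?G (tensor_map id (comult B) t) = S (tensor_lift (\<lambda>x y. counit B y *\<^sub>C x) t)" for t
  proof (rule tensor_eqI[where t = t])
    show "clinear (\<lambda>t. ?G (tensor_map id (comult B) t))"
      by (intro clinear_compose[OF G] clinear_tensor_map' id lin)
    show "?G (tensor_map id (comult B) (x \<otimes> y)) = S (tensor_lift (\<lambda>x y. counit B y *\<^sub>C x) (x \<otimes> y))" for x y
      by (subst tensor_lift_pure[of "\<lambda>x y. counit B y *\<^sub>C x"]; (intro clinear_intros)?)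
        (simp add: tensor_map_pure id lin G_pure Ti mult_scaleC_right clinear_scale[OF lin(1)])
  qed (intro clinear_intros)
  have inner: "?G (tensor_assoc (s \<otimes> z)) = tensor_lift (\<lambda>x y. S x * y) s * T z" for s z
  proof (rule tensor_eqI[where t = s])
    show "clinear (\<lambda>s. ?G (tensor_assoc (s \<otimes> z)))" by (intro clinear_compose[OF G] clinear_intros)
    show "?G (tensor_assoc ((x \<otimes> y) \<otimes> z)) = tensor_lift (\<lambda>x y. S x * y) (x \<otimes> y) * T z" for x y
      by (simp only: tensor_assoc_pure G_pure R Lp mult.assoc)
  qed (intro clinear_intros)
  have left: "?G (tensor_assoc (tensor_map (comult B) id t)) = T (tensor_lift (\<lambda>x y. counit B x *\<^sub>C y) t)" for t
  proof (rule tensor_eqI[where t = t])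
    show "clinear (\<lambda>t. ?G (tensor_assoc (tensor_map (comult B) id t)))"
      by (intro clinear_compose[OF G] clinear_tensor_assoc clinear_tensor_map' id lin)
    show "?G (tensor_assoc (tensor_map (comult B) id (x \<otimes> y))) = T (tensor_lift (\<lambda>x y. counit B x *\<^sub>C y) (x \<otimes> y))" for x y
      by (subst tensor_lift_pure[of "\<lambda>x y. counit B x *\<^sub>C y"]; (intro clinear_intros)?)
        (simp add: tensor_map_pure id lin inner Si mult_scaleC_left clinear_scale[OF lin(2)])
  qed (intro clinear_intros)
  show ?thesis
    using left[of "comult B x"] right[of "comult B x"] by (simp add: coassoc counit)
qed

text \<open>With \<open>T = S\<^sup>-\<^sup>1\<close>, which is again anti-multiplicative, \<open>T(x\<^sub>2) x\<^sub>1 = T(S(x\<^sub>1) x\<^sub>2)\<close> and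
  \<open>x\<^sub>2 T(x\<^sub>1) = T(x\<^sub>1 S(x\<^sub>2))\<close>.\<close>

lemma antipode_cop_Kn: "antipode (cop Kn) kn_antipode_inv"
proof -
  note [clinear_intros] = clinear_compose[OF clinear_kn_antipode] clinear_compose[OF clinear_kn_antipode_inv]
  have L: "tensor_lift (\<lambda>x y. kn_antipode_inv x * y) (tensor_flip t) = kn_antipode_inv (tensor_lift (\<lambda>x y. kn_antipode x * y) t)"
    for t :: "('a kn, 'a kn) tensor"
  proof (rule tensor_eqI[where t = t])
    fix x y :: "'a kn"
    have "kn_antipode_inv y * x = kn_antipode_inv (kn_antipode x * y)"
      by (rule kn_antipode_inject) (simp add: kn_antipode_mult)
    then show "tensor_lift (\<lambda>x y. kn_antipode_inv x * y) (tensor_flip (x \<otimes> y)) =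
        kn_antipode_inv (tensor_lift (\<lambda>x y. kn_antipode x * y) (x \<otimes> y))"
      by (simp add: tensor_lift_pure clinear_intros)
  qed (intro clinear_intros)+
  have R: "tensor_lift (\<lambda>x y. x * kn_antipode_inv y) (tensor_flip t) = kn_antipode_inv (tensor_lift (\<lambda>x y. x * kn_antipode y) t)"
    for t :: "('a kn, 'a kn) tensor"
  proof (rule tensor_eqI[where t = t])
    fix x y :: "'a kn"
    have "y * kn_antipode_inv x = kn_antipode_inv (x * kn_antipode y)"
      by (rule kn_antipode_inject) (simp add: kn_antipode_mult)
    then show "tensor_lift (\<lambda>x y. x * kn_antipode_inv y) (tensor_flip (x \<otimes> y)) =
        kn_antipode_inv (tensor_lift (\<lambda>x y. x * kn_antipode y) (x \<otimes> y))"
      by (simp add: tensor_lift_pure clinear_intros)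
  qed (intro clinear_intros)+
  have one: "kn_antipode_inv 1 = (1 :: 'a kn)" by (rule kn_antipode_inject) simp
  show ?thesis
    by (simp add: antipode_def cop_def clinear_kn_antipode_inv L R kn_antipode_identities
        clinear_scale[OF clinear_kn_antipode_inv] one)
qed

lemma bialgebra_Kn: "bialgebra Kn"
  unfolding Kn_eq by (rule kn.bialgebra_action_data[OF kn_ex_leibniz])

lemma bialgebra_cop_Kn: "bialgebra (cop Kn)"
  unfolding Kn_eq by (rule kn.bialgebra_cop_action_data[OF kn_ex_leibniz])

lemma cop_Kn_simps [simp]:
  "mult (cop Kn) = (*)" "unit (cop Kn) = 1" "counit (cop Kn) = counit Kn" "comult (cop Kn) x = tensor_flip (comult Kn x)"
  by (simp_all add: cop_def)

lemma tensor_map_functional: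
  assumes "clinear h" "clinear l" "clinear m"
  shows "tensor_functional l m (tensor_map h h t) = tensor_functional (\<lambda>x. l (h x)) (\<lambda>x. m (h x)) t"
  by (rule tensor_eqI[where t = t];
      (intro clinear_compose[OF clinear_tensor_functional] clinear_tensor_functional clinear_tensor_map'
        clinear_compose[OF assms(2)] clinear_compose[OF assms(3)] assms)?)
    (simp add: tensor_map_pure tensor_functional_pure assms clinear_compose[OF assms(2)] clinear_compose[OF assms(3)])

context
  fixes h g
  defines "h \<equiv> bicrossed_to_Kn :: ('n::finite kab, 'n UV) tensor \<Rightarrow> 'n kn"
  defines "g \<equiv> inv h"
begin

lemma hom_h: "clinear h" "bij h" "\<And>x y. h (mult bicrossed x y) = h x * h y" "h (unit bicrossed) = 1"
    "\<And>x. tensor_flip (comult Kn (h x)) = tensor_map h h (comult bicrossed x)" "\<And>x. counit bicrossed x = counit Kn (h x)"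
  unfolding h_def
  by (simp_all add: clinear_bicrossed_to_Kn' bij_bicrossed_to_Kn bicrossed_to_Kn_mult bicrossed_to_Kn_unit
      bicrossed_to_Kn_comult bicrossed_to_Kn_counit)

lemma inverse_g: "clinear g" "g (h x) = x" "h (g y) = y"
  unfolding g_def using hom_h(1,2) by (simp_all add: clinear_inv bij_is_inj bij_is_surj surj_f_inv_f)

lemma tensor_map_gh: "tensor_map g g (tensor_map h h t) = t"
  by (rule tensor_eqI[where t = t]; (intro clinear_tensor_map clinear_id' inverse_g hom_h(1))?)
    (simp add: tensor_map_pure inverse_g hom_h(1))

lemma mult_bicrossed: "mult bicrossed x y = g (h x * h y)"
  by (metis inverse_g(2) hom_h(3))

lemma comult_bicrossed: "comult bicrossed x = tensor_map g g (tensor_flip (comult Kn (h x)))"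
  by (simp add: hom_h(5) tensor_map_gh)

lemma tensor_map_h_mult:
  "tensor_map h h (tensor_mult (mult bicrossed) (mult bicrossed) s t) = tensor_map h h s * tensor_map h h t"
proof -
  note [clinear_intros] = clinear_compose[OF hom_h(1)] clinear_compose[OF inverse_g(1)]
  have m: "clinear (\<lambda>y. mult bicrossed x y)" "clinear (\<lambda>x. mult bicrossed x y)" for x y :: "('n kab, 'n UV) tensor"
    unfolding mult_bicrossed by (intro clinear_intros clinear_id')+
  note [clinear_intros] = clinear_compose[OF m(1)] clinear_compose[OF m(2)]
  have hh: "clinear (tensor_map h h)" by (intro clinear_tensor_map' hom_h(1))
  have pure: "tensor_mult (mult bicrossed) (mult bicrossed) (x \<otimes> y) (x' \<otimes> y') = mult bicrossed x x' \<otimes> mult bicrossed y y'"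
    for x y x' y' :: "('n kab, 'n UV) tensor"
    unfolding tensor_mult_def
    by (subst tensor_lift_pure; (intro clinear_intros)?) (subst tensor_lift_pure; (intro clinear_intros)?; rule refl)
  show ?thesis
  proof (rule tensor_eqI[where t = s])
    show "clinear (\<lambda>s. tensor_map h h (tensor_mult (mult bicrossed) (mult bicrossed) s t))"
      unfolding tensor_mult_def by (intro clinear_compose[OF hh] clinear_intros)
    show "clinear (\<lambda>s. tensor_map h h s * tensor_map h h t)" by (intro clinear_intros hh)
    fix x y
    show "tensor_map h h (tensor_mult (mult bicrossed) (mult bicrossed) (x \<otimes> y) t) = tensor_map h h (x \<otimes> y) * tensor_map h h t"
    proof (rule tensor_eqI[where t = t])
      show "clinear (\<lambda>t. tensor_map h h (tensor_mult (mult bicrossed) (mult bicrossed) (x \<otimes> y) t))"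
        unfolding tensor_mult_def by (intro clinear_compose[OF hh] clinear_intros)
      show "clinear (\<lambda>t. tensor_map h h (x \<otimes> y) * tensor_map h h t)" by (intro clinear_intros hh)
    qed (simp add: pure tensor_map_pure hom_h)
  qed
qed

text \<open>The functionals of \<open>\<K>\<^sub>n\<close>, pulled back along \<open>\<I>\<close>, separate the bicrossed product and multiply in the
  opposite order, so \<open>coalgebra_if_separating\<close> applies to it as well.\<close>

lemma bialgebra_bicrossed: "bialgebra (bicrossed :: ('n kab, 'n UV) tensor bialgebra_data)"
  unfolding bialgebra_def
proof (intro conjI allI)
  note [clinear_intros] = clinear_compose[OF hom_h(1)] clinear_compose[OF inverse_g(1)]
  show "algebra (bicrossed :: ('n kab, 'n UV) tensor bialgebra_data)"
    unfolding algebra_def mult_bicrossed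
    by (auto intro!: clinear_intros simp: inverse_g mult.assoc hom_h(4))
  let ?L = "\<lambda>p x. kn.eval_at p (h x)"
  have lin: "clinear (?L p)" for p by (rule clinear_compose[OF kn.clinear_eval_at hom_h(1)])
  show "coalgebra (bicrossed :: ('n kab, 'n UV) tensor bialgebra_data)"
  proof (rule coalgebra_if_separating[of ?L _ "\<lambda>p q. kn.point_mult q p" kn.base_point])
    have "x = 0" if "\<forall>p. ?L p x = 0" for x
    proof -
      have "h x = 0" using kn.separating_eval_at that unfolding separating_def by blast
      then show "x = 0" by (metis inverse_g(2) clinear_0[OF hom_h(1)])
    qed
    then show "separating ?L" using lin unfolding separating_def by blast
    show "clinear (comult (bicrossed :: ('n kab, 'n UV) tensor bialgebra_data))"
      unfolding comult_bicrossed[abs_def] by (intro clinear_tensor_map inverse_g(1) clinear_intros hom_h(1))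
    fix p q x
    have "tensor_functional (?L p) (?L q) (comult bicrossed x) =
        tensor_functional (kn.eval_at p) (kn.eval_at q) (tensor_flip (comult Kn (h x)))"
      by (simp add: hom_h(5) tensor_map_functional hom_h(1) kn.clinear_eval_at)
    also have "\<dots> = ?L (kn.point_mult q p) x"
      by (simp add: tensor_functional_flip kn.clinear_eval_at comult_Kn
          kn.leibniz_eval_at[OF kn.leibniz_comult[OF kn_ex_leibniz]])
    finally show "tensor_functional (?L p) (?L q) (comult bicrossed x) = ?L (kn.point_mult q p) x" .
  qed (simp_all add: kn.point_mult_assoc kn.eval_at_base_point_left kn.eval_at_base_point_right hom_h(6) counit_Kn
      kn.counit_of_action_eq(1))
  show "comult bicrossed (unit bicrossed) = unit bicrossed \<otimes> (unit bicrossed :: ('n kab, 'n UV) tensor)"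
    by (simp add: comult_bicrossed hom_h(4) comult_Kn_one tensor_map_pure inverse_g(1)) (metis inverse_g(2) hom_h(4))
  show "counit bicrossed (unit bicrossed :: ('n kab, 'n UV) tensor) = 1" by (simp add: hom_h)
  fix x y :: "('n kab, 'n UV) tensor"
  show "counit bicrossed (mult bicrossed x y) = counit bicrossed x * counit bicrossed y"
    by (simp add: hom_h counit_Kn_mult)
  have "tensor_map h h (comult bicrossed (mult bicrossed x y)) =
      tensor_map h h (tensor_mult (mult bicrossed) (mult bicrossed) (comult bicrossed x) (comult bicrossed y))"
    by (simp add: tensor_map_h_mult hom_h(3) comult_Kn_mult tensor_flip_mult flip: hom_h(5))
  then show "comult bicrossed (mult bicrossed x y) =
      tensor_mult (mult bicrossed) (mult bicrossed) (comult bicrossed x) (comult bicrossed y)"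
    by (metis tensor_map_gh)
qed

text \<open>One direction provides an antipode of the bicrossed product; the other, with uniqueness for
  \<open>\<K>\<^sub>n\<^sup>c\<^sup>o\<^sup>p\<close>, makes \<open>\<I>\<close> compatible with all antipodes.\<close>

lemma antipode_bicrossed_iff:
  "antipode bicrossed S \<longleftrightarrow> antipode (cop Kn) (\<lambda>k. h (S (g k)))"
proof -
  note [clinear_intros] = clinear_compose[OF hom_h(1)] clinear_compose[OF inverse_g(1)]
  let ?T = "\<lambda>k. h (S (g k))"
  have hh: "clinear (tensor_map h h)" by (intro clinear_tensor_map' hom_h(1))
  have "clinear (\<lambda>x. g (?T (h x)))" if "clinear ?T" using that by (intro clinear_intros clinear_compose[OF that])
  then have lin: "clinear S \<longleftrightarrow> clinear ?T"
    using clinear_compose[of S g] by (auto simp: inverse_g intro: clinear_intros)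
  have m: "clinear (\<lambda>y. mult bicrossed x y)" "clinear (\<lambda>x. mult bicrossed x y)" for x y :: "('n kab, 'n UV) tensor"
    unfolding mult_bicrossed by (intro clinear_intros clinear_id')+
  note [clinear_intros] = clinear_compose[OF m(1)] clinear_compose[OF m(2)]
  have L: "h (tensor_lift (\<lambda>x y. mult bicrossed (S x) y) t) = tensor_lift (\<lambda>x y. ?T x * y) (tensor_map h h t)"
    and R: "h (tensor_lift (\<lambda>x y. mult bicrossed x (S y)) t) = tensor_lift (\<lambda>x y. x * ?T y) (tensor_map h h t)"
    if S: "clinear S" for t
  proof -
    note [clinear_intros] = clinear_compose[OF S]
    show "h (tensor_lift (\<lambda>x y. mult bicrossed (S x) y) t) = tensor_lift (\<lambda>x y. ?T x * y) (tensor_map h h t)"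
    proof (rule tensor_eqI[where t = t])
      show "clinear (\<lambda>t. tensor_lift (\<lambda>x y. ?T x * y) (tensor_map h h t))"
        by (intro clinear_lift hh clinear_intros)
      show "h (tensor_lift (\<lambda>x y. mult bicrossed (S x) y) (x \<otimes> y)) = tensor_lift (\<lambda>x y. ?T x * y) (tensor_map h h (x \<otimes> y))" for x y
        by (subst tensor_lift_pure; (intro clinear_intros)?)
          (simp only: tensor_map_pure hom_h(1), subst tensor_lift_pure; (intro clinear_intros)?; simp add: hom_h inverse_g)
    qed (intro clinear_intros)
    show "h (tensor_lift (\<lambda>x y. mult bicrossed x (S y)) t) = tensor_lift (\<lambda>x y. x * ?T y) (tensor_map h h t)"
    proof (rule tensor_eqI[where t = t])
      show "clinear (\<lambda>t. tensor_lift (\<lambda>x y. x * ?T y) (tensor_map h h t))"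
        by (intro clinear_lift hh clinear_intros)
      show "h (tensor_lift (\<lambda>x y. mult bicrossed x (S y)) (x \<otimes> y)) = tensor_lift (\<lambda>x y. x * ?T y) (tensor_map h h (x \<otimes> y))" for x y
        by (subst tensor_lift_pure; (intro clinear_intros)?)
          (simp only: tensor_map_pure hom_h(1), subst tensor_lift_pure; (intro clinear_intros)?; simp add: hom_h inverse_g)
    qed (intro clinear_intros)
  qed
  have unit: "h (c *\<^sub>C unit bicrossed) = c *\<^sub>C 1" for c by (simp add: clinear_scale[OF hom_h(1)] hom_h(4))
  have hinj: "x = y \<longleftrightarrow> h x = h y" for x y using hom_h(2) by (metis inverse_g(2))
  have surj: "(\<forall>k. P k) \<longleftrightarrow> (\<forall>x. P (h x))" for P by (metis inverse_g(3))
  show ?thesis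
  proof (cases "clinear S")
    case True
    have "(\<forall>k. tensor_lift (\<lambda>x y. ?T x * y) (tensor_flip (comult Kn k)) = counit Kn k *\<^sub>C 1) \<longleftrightarrow>
        (\<forall>x. tensor_lift (\<lambda>x y. ?T x * y) (tensor_map h h (comult bicrossed x)) = counit Kn (h x) *\<^sub>C 1)"
      using surj[of "\<lambda>k. tensor_lift (\<lambda>x y. ?T x * y) (tensor_flip (comult Kn k)) = counit Kn k *\<^sub>C 1"]
      by (simp only: hom_h(5))
    moreover have "(\<forall>k. tensor_lift (\<lambda>x y. x * ?T y) (tensor_flip (comult Kn k)) = counit Kn k *\<^sub>C 1) \<longleftrightarrow>
        (\<forall>x. tensor_lift (\<lambda>x y. x * ?T y) (tensor_map h h (comult bicrossed x)) = counit Kn (h x) *\<^sub>C 1)"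
      using surj[of "\<lambda>k. tensor_lift (\<lambda>x y. x * ?T y) (tensor_flip (comult Kn k)) = counit Kn k *\<^sub>C 1"]
      by (simp only: hom_h(5))
    ultimately show ?thesis
      unfolding antipode_def cop_Kn_simps
      using lin True
      by (simp only: hinj[of "tensor_lift _ _" "_ *\<^sub>C unit bicrossed"] L[OF True] R[OF True] unit hom_h(6) simp_thms)
  next
    case False
    then show ?thesis using lin by (simp add: antipode_def)
  qed
qed

lemma hopf_iso_bicrossed: "hopf_iso bicrossed (cop Kn) h"
proof -
  have "antipode bicrossed (\<lambda>x. g (kn_antipode_inv (h x)))"
    using antipode_cop_Kn by (simp add: antipode_bicrossed_iff inverse_g)
  then have A: "hopf_algebra (bicrossed :: ('n kab, 'n UV) tensor bialgebra_data)"
    using bialgebra_bicrossed by (auto simp: hopf_algebra_def)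
  have B: "hopf_algebra (cop Kn :: 'n kn bialgebra_data)"
    using bialgebra_cop_Kn antipode_cop_Kn by (auto simp: hopf_algebra_def)
  have "h (S x) = T (h x)" if "antipode bicrossed S" "antipode (cop Kn) T" for S T x
  proof -
    have "coalgebra (cop Kn :: 'n kn bialgebra_data)" using bialgebra_cop_Kn unfolding bialgebra_def by blast
    from antipode_unique[OF this _ _ that(1)[unfolded antipode_bicrossed_iff] that(2), of "h x"]
    show ?thesis by (simp add: inverse_g)
  qed
  with A B show ?thesis by (simp add: hopf_iso_def hom_h)
qed

end

text \<open>Since \<open>X\<^sub>l\<^sup># = S(\<sigma>\<^sup>k\<^sub>l) X\<^sub>k\<close> and \<open>f\<^sup># = S(f)\<close>, conjugating a product of the \<open>X\<^sub>l\<close> reproduces the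
  recursion of the coaction.\<close>

lemma kn_sharp_of_UV:
  "kn_sharp (kn_of_UV u) = tensor_lift (\<lambda>u\<^sub>0 u\<^sub>1. kn_of_kab (kab_antipode u\<^sub>1) * kn_of_UV u\<^sub>0) (coaction u)"
proof -
  let ?L = "tensor_lift (\<lambda>u\<^sub>0 u\<^sub>1. kn_of_kab (kab_antipode u\<^sub>1) * kn_of_UV u\<^sub>0)"
  have L: "clinear ?L" by (intro clinear_tensor_lift clinear_intros)
  have pure: "?L (u \<otimes> f) = kn_of_kab (kab_antipode f) * kn_of_UV u" for u f
    by (rule tensor_lift_pure) (intro clinear_intros)+
  have step: "?L (coaction_step l t) = kn_sharp (kn_X l) * ?L t" for l :: 'a and t
  proof (rule tensor_eqI[where t = t])
    fix u :: "'a UV" and f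
    have D: "kn_of_kab (kab_antipode (kab_D l f)) =
        kn_sharp (kn_X l) * kn_of_kab (kab_antipode f) - kn_of_kab (kab_antipode f) * kn_sharp (kn_X l)"
      by (simp add: kn_sharp_of_kab[symmetric] kn_of_kab_D clinear_diff[OF clinear_kn_sharp[OF clinear_id']] kn_sharp_mult)
    have c: "kn_of_kab (kab_antipode f) * kn_of_kab g = kn_of_kab g * kn_of_kab (kab_antipode f)" for g
      by (metis kn_of_kab_hom(3) mult.commute)
    have "(\<Sum>k\<in>UNIV. kn_of_kab (kab_antipode (kab_sigma k l * f)) * kn_of_UV (uea_of (V_X k) * u)) =
        kn_of_kab (kab_antipode f) * kn_sharp (kn_X l) * kn_of_UV u"
      by (simp add: kn_sharp_X kab_antipode_mult kn_of_kab_hom kn_of_UV_of_mult kn_of_V_simps sum_distrib_left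
          sum_distrib_right c flip: mult.assoc)
    then show "?L (coaction_step l (u \<otimes> f)) = kn_sharp (kn_X l) * ?L (u \<otimes> f)"
      unfolding coaction_step_pure clinear_add[OF L] clinear_setsum[OF L] pure
      by (simp add: D left_diff_distrib mult.assoc)
  qed (intro clinear_compose[OF L] clinear_intros L)+
  show ?thesis
  proof (induction u rule: UV_induct)
    case one
    show ?case unfolding coaction_one pure by (simp add: kab_antipode_one kn_of_kab_hom)
  next
    case (mult l u)
    then show ?case by (simp add: kn_of_UV_of_mult kn_of_V_simps kn_sharp_mult coaction_X_mult step)
  qed (simp_all add: clinear_add[OF clinear_kn_sharp[OF clinear_kn_of_UV[OF clinear_id']]]
      clinear_scale[OF clinear_kn_sharp[OF clinear_kn_of_UV[OF clinear_id']]]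
      clinear_add[OF clinear_compose[OF L clinear_coaction[OF clinear_id']]]
      clinear_scale[OF clinear_compose[OF L clinear_coaction[OF clinear_id']]])
qed

lemma kn_antipode_of_UV:
  "kn_antipode (kn_of_UV u) =
    tensor_lift (\<lambda>u\<^sub>0 u\<^sub>1. kn_of_kab (kab_antipode u\<^sub>1) * kn_of_UV u\<^sub>0) (coaction (uea_antipode u))"
  by (simp only: kn_antipode_def kn_transpose_of_UV kn_sharp_of_UV)

lemma kn_antipode_of_V:
  "kn_antipode (kn_of_UV (uea_of X)) =
    tensor_lift (\<lambda>u\<^sub>0 u\<^sub>1. kn_of_kab (kab_antipode u\<^sub>1) * kn_of_UV (uea_antipode u\<^sub>0)) (coaction (uea_of X))"
proof -
  let ?L = "tensor_lift (\<lambda>u\<^sub>0 u\<^sub>1. kn_of_kab (kab_antipode u\<^sub>1) * kn_of_UV (uea_antipode u\<^sub>0))"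
  have L: "clinear ?L" by (intro clinear_tensor_lift clinear_intros)
  have pure: "?L (u \<otimes> f) = kn_of_kab (kab_antipode f) * kn_of_UV (uea_antipode u)" for u f
    by (rule tensor_lift_pure) (intro clinear_intros)+
  have A: "clinear (\<lambda>X. kn_antipode (kn_of_UV (uea_of X)))"
    by (intro clinear_compose[OF clinear_kn_antipode] clinear_intros)
  have B: "clinear (\<lambda>X. ?L (coaction (uea_of X)))"
    by (intro clinear_compose[OF L] clinear_intros)
  show ?thesis
  proof (induction X rule: vlie_induct)
    case (X l)
    have "uea_antipode (uea_of (V_X k)) = - uea_of (V_X k)" for k :: 'a
      using uea_antipode_of_mult[of "V_X k" 1] by simp
    then show ?case
      unfolding coaction_X clinear_setsum[OF L] pure
      by (simp add: kn_of_V_simps kn_antipode_X clinear_neg[OF clinear_kn_of_UV[OF clinear_id']] sum_negf)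
  next
    case (add X Y)
    then show ?case by (simp only: clinear_add[OF A] clinear_add[OF B])
  next
    case (scale c X)
    then show ?case by (simp only: clinear_scale[OF A] clinear_scale[OF B])
  qed
qed

text \<open>\<open>\<K>\<^sub>n\<close> is generated by \<open>\<K>\<^sub>a\<^sub>b\<close> and \<open>V\<close>.\<close>

lemma antihom_Kn_eqI:
  assumes S: "antihom Kn S" and T: "antihom Kn T"
    and kab: "\<And>f. S (kn_of_kab f) = T (kn_of_kab f)"
    and V: "\<And>X. S (kn_of_UV (uea_of X)) = T (kn_of_UV (uea_of X))"
  shows "S = T"
proof
  have "clinear S" "S 1 = 1" "\<And>x y. S (x * y) = S y * S x" "clinear T" "T 1 = 1" "\<And>x y. T (x * y) = T y * T x"
    using S T by (simp_all add: antihom_def)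
  moreover have "S (kn_X l) = T (kn_X l)" for l using V[of "V_X l"] by (simp add: kn_of_V_simps)
  ultimately show "S k = T k" for k
    by (induction k rule: kn_induct) (simp_all add: clinear_add clinear_scale kab)
qed

theorem corollary1p6:
  "(\<exists>S :: 'n::finite kn \<Rightarrow> 'n kn.
      antipode Kn S \<and>
      (\<forall>T. T = S \<longleftrightarrow>
        antihom Kn T \<and>
        (\<forall>f. T (kn_of_kab f) = kn_of_kab (kab_antipode f)) \<and>
        (\<forall>X. T (kn_of_UV (uea_of X)) =
          tensor_lift (\<lambda>u\<^sub>0 u\<^sub>1. kn_of_kab (kab_antipode u\<^sub>1) * kn_of_UV (uea_antipode u\<^sub>0))
            (coaction (uea_of X)))) \<and>
      (\<forall>u. S (kn_of_UV u) =
        tensor_lift (\<lambda>u\<^sub>0 u\<^sub>1. kn_of_kab (kab_antipode u\<^sub>1) * kn_of_UV u\<^sub>0)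
          (coaction (uea_antipode u))))
    \<and> hopf_algebra (Kn :: 'n kn bialgebra_data)
    \<and> hopf_iso bicrossed (cop Kn) (bicrossed_to_Kn :: ('n kab, 'n UV) tensor \<Rightarrow> 'n kn)"
proof (intro conjI exI[of _ kn_antipode] allI)
  show "antipode Kn (kn_antipode :: 'n kn \<Rightarrow> _)" by (rule antipode_kn_antipode)
  then show "hopf_algebra (Kn :: 'n kn bialgebra_data)"
    using bialgebra_Kn by (auto simp: hopf_algebra_def)
  show "hopf_iso bicrossed (cop Kn) (bicrossed_to_Kn :: ('n kab, 'n UV) tensor \<Rightarrow> 'n kn)"
    by (rule hopf_iso_bicrossed)
  show "kn_antipode (kn_of_UV u) = tensor_lift (\<lambda>u\<^sub>0 u\<^sub>1. kn_of_kab (kab_antipode u\<^sub>1) * kn_of_UV u\<^sub>0)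
      (coaction (uea_antipode u))" for u :: "'n UV"
    by (rule kn_antipode_of_UV)
  show "T = kn_antipode \<longleftrightarrow> antihom Kn T \<and> (\<forall>f. T (kn_of_kab f) = kn_of_kab (kab_antipode f)) \<and>
      (\<forall>X. T (kn_of_UV (uea_of X)) =
        tensor_lift (\<lambda>u\<^sub>0 u\<^sub>1. kn_of_kab (kab_antipode u\<^sub>1) * kn_of_UV (uea_antipode u\<^sub>0)) (coaction (uea_of X)))"
    for T :: "'n kn \<Rightarrow> 'n kn"
  proof (intro iffI conjI allI)
    assume T: "T = kn_antipode"
    show "antihom Kn T" unfolding T by (rule antihom_kn_antipode)
    show "T (kn_of_kab f) = kn_of_kab (kab_antipode f)" for f unfolding T by (rule kn_antipode_of_kab)
    show "T (kn_of_UV (uea_of X)) =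
        tensor_lift (\<lambda>u\<^sub>0 u\<^sub>1. kn_of_kab (kab_antipode u\<^sub>1) * kn_of_UV (uea_antipode u\<^sub>0)) (coaction (uea_of X))" for X
      unfolding T by (rule kn_antipode_of_V)
  next
    assume T: "antihom Kn T \<and> (\<forall>f. T (kn_of_kab f) = kn_of_kab (kab_antipode f)) \<and>
      (\<forall>X. T (kn_of_UV (uea_of X)) =
        tensor_lift (\<lambda>u\<^sub>0 u\<^sub>1. kn_of_kab (kab_antipode u\<^sub>1) * kn_of_UV (uea_antipode u\<^sub>0)) (coaction (uea_of X)))"
    then have "antihom Kn T" by (rule conjunct1)
    then show "T = kn_antipode"
      by (rule antihom_Kn_eqI[OF _ antihom_kn_antipode])
        (simp_all only: T kn_antipode_of_kab kn_antipode_of_V)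
  qed
qed


end
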